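(* Let $A$ be an $\ell\cdot n\times d$ matrix whose rows are points in a metric space $(\mathbb{R}^d,\mathrm{dist})$, and let $c:[\ell\cdot n]\rightarrow[\ell]$ be a balanced coloring of $A$. Suppose there is an algorithm that computes a $\beta$-approximate fair $n$-median clustering for instances with $2$ colors (of $n$ points each) in time $T(n,d)$. Then for every $\delta\in(0,1)$ there exists a randomized algorithm that computes a $(2\beta)$-approximate fair $n$-median clustering of $A$ with $\ell$ colors, runs in time $O(\ell\cdot T(n,d)\log(1/\delta))$, and succeeds with probability $1-\delta$.
   Context: A coloring $c:[\ell n]\to[\ell]$ is balanced if each color class $A^{(i)}=\{x: c(x)=i\}$ has exactly $n$ points. For two $n$-point sets $X,Y$, $EMD(X,Y)=\min_{\pi}\sum_{x\in X}\mathrm{dist}(x,\pi(x))$ over bijections $\pi:X\to Y$. The fair $n$-median problem asks for an $n$-point (multi)set $B$ of points of the metric space minimizing $\sum_{i=1}^{\ell}EMD(A^{(i)},B)$; equivalently, a partition of the points into $n$ clusters each containing exactly one point of each color, each cluster with a center, minimizing the total distance of points to their cluster centers. A $\beta$-approximate solution is one whose cost is at most $\beta$ times the optimal cost. *)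

theory Defs
  imports
    "HOL-Probability.Probability"
    "HOL-Analysis.Abstract_Metric_Spaces"
    "Jordan_Normal_Form.Matrix"
begin

section \<open>The fair median problem\<close>

text \<open>
  Points, colors and clusters are numbered from 0.  The points are the rows of an
  \<open>(l * n) \<times> d\<close> matrix and point sets are given by sets of row indices, so repeated
  points are allowed.
\<close>

definition color_class :: "nat \<Rightarrow> nat \<Rightarrow> (nat \<Rightarrow> nat) \<Rightarrow> nat \<Rightarrow> nat set" where
  "color_class l n c i = {x. x < l * n \<and> c x = i}"

definition balanced :: "nat \<Rightarrow> nat \<Rightarrow> (nat \<Rightarrow> nat) \<Rightarrow> bool" where
  "balanced l n c \<longleftrightarrow>
     c \<in> {..<l * n} \<rightarrow> {..<l} \<and> (\<forall>i<l. card (color_class l n c i) = n)"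

definition EMD :: "('p \<Rightarrow> 'p \<Rightarrow> real) \<Rightarrow> 'i set \<Rightarrow> ('i \<Rightarrow> 'p) \<Rightarrow> 'j set \<Rightarrow> ('j \<Rightarrow> 'p) \<Rightarrow> real" where
  "EMD dst I X J Y =
     Min ((\<lambda>\<pi>. \<Sum>x\<in>I. dst (X x) (Y (\<pi> x))) ` {\<pi> \<in> I \<rightarrow>\<^sub>E J. bij_betw \<pi> I J})"

definition fair_median_cost ::
  "(real vec \<Rightarrow> real vec \<Rightarrow> real) \<Rightarrow> nat \<Rightarrow> nat \<Rightarrow> real mat \<Rightarrow> (nat \<Rightarrow> nat) \<Rightarrow> real mat \<Rightarrow> real" where
  "fair_median_cost dst l n A c B =
     (\<Sum>i<l. EMD dst (color_class l n c i) (row A) {..<n} (row B))"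

text \<open>An infimum, because in an arbitrary metric space no optimal \<open>B\<close> need exist.\<close>

definition fair_median_opt ::
  "(real vec \<Rightarrow> real vec \<Rightarrow> real) \<Rightarrow> nat \<Rightarrow> nat \<Rightarrow> real mat \<Rightarrow> (nat \<Rightarrow> nat) \<Rightarrow> real" where
  "fair_median_opt dst l n A c =
     (INF B \<in> carrier_mat n (dim_col A). fair_median_cost dst l n A c B)"

text \<open>\<open>q x\<close> is the cluster of point \<open>x\<close>.\<close>

definition fair_clustering :: "nat \<Rightarrow> nat \<Rightarrow> (nat \<Rightarrow> nat) \<Rightarrow> (nat \<Rightarrow> nat) \<Rightarrow> bool" where
  "fair_clustering l n c q \<longleftrightarrow>
     q \<in> {..<l * n} \<rightarrow> {..<n} \<and>
     (\<forall>i<l. \<forall>j<n. \<exists>!x. x \<in> color_class l n c i \<and> q x = j)"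

definition clustering_cost ::
  "(real vec \<Rightarrow> real vec \<Rightarrow> real) \<Rightarrow> nat \<Rightarrow> nat \<Rightarrow> real mat \<Rightarrow> (nat \<Rightarrow> nat) \<Rightarrow> real mat \<Rightarrow> real" where
  "clustering_cost dst l n A q B = (\<Sum>x<l * n. dst (row A x) (row B (q x)))"

definition approx_fair_median ::
  "(real vec \<Rightarrow> real vec \<Rightarrow> real) \<Rightarrow> real \<Rightarrow> nat \<Rightarrow> nat \<Rightarrow> real mat \<Rightarrow> (nat \<Rightarrow> nat)
     \<Rightarrow> (nat \<Rightarrow> nat) \<Rightarrow> real mat \<Rightarrow> bool" where
  "approx_fair_median dst \<gamma> l n A c q B \<longleftrightarrow>
     fair_clustering l n c q \<and> B \<in> carrier_mat n (dim_col A) \<and>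
     clustering_cost dst l n A q B \<le> \<gamma> * fair_median_opt dst l n A c"


section \<open>A randomized real RAM\<close>

text \<open>
  Programs are finite syntactic objects over named, unbounded arrays of natural numbers and of
  reals, with indirect addressing.  Real operations are exact; there is no rounding of reals to
  integers and there are no real constants other than those computed from natural numbers.
  The metric of the underlying space is a primitive.
\<close>

datatype nexp =
    NConst nat
  | NArr string nexp
  | NPlus nexp nexp
  | NMinus nexp nexp
  | NTimes nexp nexp

datatype rexp =
    OfNat nexp
  | RArr string nexp
  | RPlus rexp rexp
  | RMinus rexp rexp
  | RTimes rexp rexp
  | RDiv rexp rexp

datatype bexp =
    NLess nexp nexp
  | RLess rexp rexp
  | BNot bexp
  | BAnd bexp bexp

text \<open>
  \<open>Dist x i y j z k m\<close> stores in \<open>x[i]\<close> the distance between the \<open>m\<close>-dimensional vectors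
  starting at \<open>y[j]\<close> and at \<open>z[k]\<close>; \<open>Rand x i m\<close> stores in \<open>x[i]\<close> a uniformly random element
  of \<open>{0..m}\<close> that is independent of all previous random choices.
\<close>

datatype com =
    Skip
  | NAsg string nexp nexp
  | RAsg string nexp rexp
  | Dist string nexp string nexp string nexp nexp
  | Rand string nexp nexp
  | Seq com com
  | If bexp com com
  | While bexp com

record state =
  nats :: "string \<Rightarrow> nat \<Rightarrow> nat"
  reals :: "string \<Rightarrow> nat \<Rightarrow> real"

primrec nval :: "nexp \<Rightarrow> state \<Rightarrow> nat" where
  "nval (NConst k) s = k"
| "nval (NArr x e) s = nats s x (nval e s)"
| "nval (NPlus e f) s = nval e s + nval f s"
| "nval (NMinus e f) s = nval e s - nval f s"
| "nval (NTimes e f) s = nval e s * nval f s"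

primrec rval :: "rexp \<Rightarrow> state \<Rightarrow> real" where
  "rval (OfNat e) s = real (nval e s)"
| "rval (RArr x e) s = reals s x (nval e s)"
| "rval (RPlus e f) s = rval e s + rval f s"
| "rval (RMinus e f) s = rval e s - rval f s"
| "rval (RTimes e f) s = rval e s * rval f s"
| "rval (RDiv e f) s = rval e s / rval f s"

primrec bval :: "bexp \<Rightarrow> state \<Rightarrow> bool" where
  "bval (NLess e f) s \<longleftrightarrow> nval e s < nval f s"
| "bval (RLess e f) s \<longleftrightarrow> rval e s < rval f s"
| "bval (BNot b) s \<longleftrightarrow> \<not> bval b s"
| "bval (BAnd a b) s \<longleftrightarrow> bval a s \<and> bval b s"

definition set_nat :: "string \<Rightarrow> nat \<Rightarrow> nat \<Rightarrow> state \<Rightarrow> state" where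
  "set_nat x i v s = s\<lparr>nats := (nats s)(x := (nats s x)(i := v))\<rparr>"

definition set_real :: "string \<Rightarrow> nat \<Rightarrow> real \<Rightarrow> state \<Rightarrow> state" where
  "set_real x i v s = s\<lparr>reals := (reals s)(x := (reals s x)(i := v))\<rparr>"

definition read_vec :: "state \<Rightarrow> string \<Rightarrow> nat \<Rightarrow> nat \<Rightarrow> real vec" where
  "read_vec s x i m = vec m (\<lambda>k. reals s x (i + k))"

text \<open>
  \<open>big_step dst C s p\<close>: started in \<open>s\<close>, the program \<open>C\<close> terminates for all random choices, and
  \<open>p\<close> is the joint distribution of the final state and the running time.  Assignments,
  random choices and tests take one unit of time (the sizes of the expressions are fixed by the
  program), and a distance computation in dimension \<open>m\<close> takes \<open>m + 1\<close> units.
\<close>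

definition add_time :: "nat \<Rightarrow> (state \<times> nat) pmf \<Rightarrow> (state \<times> nat) pmf" where
  "add_time t p = map_pmf (\<lambda>(s, u). (s, t + u)) p"

inductive big_step ::
  "(real vec \<Rightarrow> real vec \<Rightarrow> real) \<Rightarrow> com \<Rightarrow> state \<Rightarrow> (state \<times> nat) pmf \<Rightarrow> bool"
  for dst where
  Skip: "big_step dst Skip s (return_pmf (s, 1))"
| NAsg: "big_step dst (NAsg x i e) s (return_pmf (set_nat x (nval i s) (nval e s) s, 1))"
| RAsg: "big_step dst (RAsg x i e) s (return_pmf (set_real x (nval i s) (rval e s) s, 1))"
| Dist: "big_step dst (Dist x i y j z k m) s
    (return_pmf
      (set_real x (nval i s)
         (dst (read_vec s y (nval j s) (nval m s)) (read_vec s z (nval k s) (nval m s))) s,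
       nval m s + 1))"
| Rand: "big_step dst (Rand x i m) s
    (map_pmf (\<lambda>v. (set_nat x (nval i s) v s, 1)) (pmf_of_set {0..nval m s}))"
| Seq: "big_step dst C s p \<Longrightarrow>
    (\<forall>s' t. (s', t) \<in> set_pmf p \<longrightarrow> big_step dst D s' (r s')) \<Longrightarrow>
    big_step dst (Seq C D) s (bind_pmf p (\<lambda>(s', t). add_time t (r s')))"
| IfTrue: "bval b s \<Longrightarrow> big_step dst C s p \<Longrightarrow> big_step dst (If b C D) s (add_time 1 p)"
| IfFalse: "\<not> bval b s \<Longrightarrow> big_step dst D s p \<Longrightarrow> big_step dst (If b C D) s (add_time 1 p)"
| WhileFalse: "\<not> bval b s \<Longrightarrow> big_step dst (While b C) s (return_pmf (s, 1))"
| WhileTrue: "bval b s \<Longrightarrow> big_step dst C s p \<Longrightarrow>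
    (\<forall>s' t. (s', t) \<in> set_pmf p \<longrightarrow> big_step dst (While b C) s' (r s')) \<Longrightarrow>
    big_step dst (While b C) s (bind_pmf p (\<lambda>(s', t). add_time (1 + t) (r s')))"

inductive_cases big_step_elims:
  "big_step dst Skip s p"
  "big_step dst (NAsg x i e) s p"
  "big_step dst (RAsg x i e) s p"
  "big_step dst (Dist x i y j z k m) s p"
  "big_step dst (Rand x i m) s p"
  "big_step dst (Seq C D) s p"
  "big_step dst (If b C D) s p"
  "big_step dst (While b C) s p"

lemma big_step_unique: "big_step dst C s p \<Longrightarrow> big_step dst C s p' \<Longrightarrow> p' = p"
proof (induction arbitrary: p' rule: big_step.induct)
  case (Seq C s p D r)
  from Seq.prems show ?case
  proof (rule big_step_elims(6))
    fix p2 r2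
    assume p': "p' = bind_pmf p2 (\<lambda>(s', t). add_time t (r2 s'))"
      and p2: "big_step dst C s p2"
      and r2: "\<forall>s'. (\<exists>t. (s', t) \<in> set_pmf p2) \<longrightarrow> big_step dst D s' (r2 s')"
    have eq: "p2 = p" using Seq.IH(1) p2 by blast
    have "r2 s' = r s'" if "(s', t) \<in> set_pmf p" for s' t
      using Seq.IH(2) r2 that unfolding eq by blast
    then show "p' = bind_pmf p (\<lambda>(s', t). add_time t (r s'))"
      unfolding p' eq by (auto intro!: bind_pmf_cong)
  qed
next
  case (WhileTrue b s C p r)
  from WhileTrue.prems show ?case
  proof (rule big_step_elims(8))
    fix p2 r2
    assume p': "p' = bind_pmf p2 (\<lambda>(s', t). add_time (Suc t) (r2 s'))"
      and p2: "big_step dst C s p2"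
      and r2: "\<forall>s'. (\<exists>t. (s', t) \<in> set_pmf p2) \<longrightarrow> big_step dst (While b C) s' (r2 s')"
    have eq: "p2 = p" using WhileTrue.IH(1) p2 by blast
    have "r2 s' = r s'" if "(s', t) \<in> set_pmf p" for s' t
      using WhileTrue.IH(2) r2 that unfolding eq by blast
    then show "p' = bind_pmf p (\<lambda>(s', t). add_time (1 + t) (r s'))"
      unfolding p' eq by (auto intro!: bind_pmf_cong)
  qed (use WhileTrue.hyps in blast)
next
  case (IfTrue b s C p D)
  from IfTrue.prems IfTrue.hyps IfTrue.IH show ?case
    by - (erule big_step_elims(7); force)
next
  case (IfFalse b s D p C)
  from IfFalse.prems IfFalse.hyps IfFalse.IH show ?case
    by - (erule big_step_elims(7); force)
next
  case (WhileFalse b s C)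
  from WhileFalse.prems WhileFalse.hyps show ?case
    by - (erule big_step_elims(8); simp)
qed (erule big_step_elims; simp)+

primrec deterministic :: "com \<Rightarrow> bool" where
  "deterministic Skip \<longleftrightarrow> True"
| "deterministic (NAsg x i e) \<longleftrightarrow> True"
| "deterministic (RAsg x i e) \<longleftrightarrow> True"
| "deterministic (Dist x i y j z k m) \<longleftrightarrow> True"
| "deterministic (Rand x i m) \<longleftrightarrow> False"
| "deterministic (Seq C D) \<longleftrightarrow> deterministic C \<and> deterministic D"
| "deterministic (If b C D) \<longleftrightarrow> deterministic C \<and> deterministic D"
| "deterministic (While b C) \<longleftrightarrow> deterministic C"


section \<open>Algorithms for the fair median problem\<close>

text \<open>Matrices are stored row by row.  All memory cells not mentioned have arbitrary contents.\<close>

definition holds_input ::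
  "state \<Rightarrow> nat \<Rightarrow> nat \<Rightarrow> nat \<Rightarrow> real mat \<Rightarrow> (nat \<Rightarrow> nat) \<Rightarrow> bool" where
  "holds_input s l n d A c \<longleftrightarrow>
     nats s ''l'' 0 = l \<and> nats s ''n'' 0 = n \<and> nats s ''d'' 0 = d \<and>
     (\<forall>x<l * n. \<forall>k<d. reals s ''A'' (x * d + k) = A $$ (x, k)) \<and>
     (\<forall>x<l * n. nats s ''c'' x = c x)"

definition output_clusters :: "state \<Rightarrow> nat \<Rightarrow> nat" where
  "output_clusters s = nats s ''q''"

definition output_centers :: "state \<Rightarrow> nat \<Rightarrow> nat \<Rightarrow> real mat" where
  "output_centers s n d = mat n d (\<lambda>(j, k). reals s ''B'' (j * d + k))"

text \<open>
  On every instance with \<open>l\<close> colors, \<open>P\<close> always halts within time \<open>\<tau> n d\<close>, and with probability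
  at least \<open>1 - \<epsilon>\<close> its output is a \<open>\<gamma>\<close>-approximate solution.
\<close>

definition fair_median_algorithm ::
  "(real vec \<Rightarrow> real vec \<Rightarrow> real) \<Rightarrow> com \<Rightarrow> nat \<Rightarrow> real \<Rightarrow> real \<Rightarrow> (nat \<Rightarrow> nat \<Rightarrow> real) \<Rightarrow> bool" where
  "fair_median_algorithm dst P l \<gamma> \<epsilon> \<tau> \<longleftrightarrow>
     (\<forall>n d A c s. n \<ge> 1 \<longrightarrow> d \<ge> 1 \<longrightarrow> A \<in> carrier_mat (l * n) d \<longrightarrow> balanced l n c \<longrightarrow>
        holds_input s l n d A c \<longrightarrow>
        (\<exists>p. big_step dst P s p \<and>
             (\<forall>s' t. (s', t) \<in> set_pmf p \<longrightarrow> real t \<le> \<tau> n d) \<and>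
             measure_pmf.prob p
               {(s', t). approx_fair_median dst \<gamma> l n A c (output_clusters s') (output_centers s' n d)}
               \<ge> 1 - \<epsilon>))"

end

theory Submission
  imports Defs
begin

text \<open>
  Matching every color class to one class \<open>i\<close> with the two-color algorithm, and taking the points of
  color \<open>i\<close> as centers, costs at most \<open>\<beta> * (\<Omega> + l * X i)\<close>, where \<open>X j\<close> is the distance of class \<open>j\<close> to
  a (near-)optimal center set and \<open>\<Omega>\<close> is the sum of all \<open>X j\<close>.  This is at most \<open>2 * \<beta> * \<Omega>\<close> if \<open>X i\<close>
  does not exceed the average, but only few \<open>i\<close> need satisfy this, so a uniformly random \<open>i\<close> would give
  the factor \<open>2 * \<beta>\<close> in expectation only.  Hence a second center color is sampled with probability
  proportional to how far the cost \<open>W j\<close> of class \<open>j\<close> in the first clustering lies below the average.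
  If the first color was not good enough, the bounds \<open>W j \<le> \<beta> * (X i + X j)\<close> are nearly tight, so this
  favors colors with small \<open>X j\<close>.  A round succeeds with probability at least 1/16, and the best of
  \<open>O(log (1 / \<delta>))\<close> rounds is returned.
\<close>

section \<open>Deterministic fragments and loops\<close>

text \<open>Two obstacles shape the proof. Copying two color classes and reading off a matching
  takes about \<open>n * d\<close> steps, while only \<open>T n d\<close> is granted per pair; so
  \<open>n * d \<le> T n d\<close> has to be extracted from the correctness of the given program.
  And the machine draws only uniform integers and cannot round reals, so proportional sampling is
  replaced by drawing one of \<open>4 * l\<close> equally spaced thresholds. Discretization costs
  each color at most one threshold. When fewer than \<open>l / 4\<close> colors are good, this loss
  stays below \<open>l / 4\<close>, whereas the good colors carry at least a fifth of the weight,
  worth \<open>4 * l / 5\<close> thresholds. So at least \<open>l / 2\<close> of the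
  \<open>4 * l\<close> thresholds hit a good color, a chance of 1/8; with the chance 1/2 for the
  first color this gives 1/16. The program knows neither the optimum nor distances to it:
  \<open>X j\<close> is measured against an arbitrary center matrix \<open>B\<close> that occurs
  only in the analysis, and the infimum over \<open>B\<close> is reached by a limit at the very
  end.\<close>

definition wp ::
  "(real vec \<Rightarrow> real vec \<Rightarrow> real) \<Rightarrow> com \<Rightarrow> nat \<Rightarrow> (state \<Rightarrow> bool) \<Rightarrow> state \<Rightarrow> bool" where
  "wp dst C t Q s \<longleftrightarrow> (\<exists>s' u. big_step dst C s (return_pmf (s', u)) \<and> u \<le> t \<and> Q s')"

primrec nwrites :: "com \<Rightarrow> string set" where
  "nwrites Skip = {}"
| "nwrites (NAsg x i e) = {x}"
| "nwrites (RAsg x i e) = {}"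
| "nwrites (Dist x i y j z k m) = {}"
| "nwrites (Rand x i m) = {x}"
| "nwrites (Seq C D) = nwrites C \<union> nwrites D"
| "nwrites (If b C D) = nwrites C \<union> nwrites D"
| "nwrites (While b C) = nwrites C"

primrec rwrites :: "com \<Rightarrow> string set" where
  "rwrites Skip = {}"
| "rwrites (NAsg x i e) = {}"
| "rwrites (RAsg x i e) = {x}"
| "rwrites (Dist x i y j z k m) = {x}"
| "rwrites (Rand x i m) = {}"
| "rwrites (Seq C D) = rwrites C \<union> rwrites D"
| "rwrites (If b C D) = rwrites C \<union> rwrites D"
| "rwrites (While b C) = rwrites C"

lemma finite_writes: "finite (nwrites C)" "finite (rwrites C)"
  by (induction C) auto

text \<open>Deliberately coarse: whole arrays are tracked by name, not cells, so that the frame of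
  any program, even of the unknown \<open>P\<close>, can be read off its syntax.\<close>

definition frame :: "com \<Rightarrow> state \<Rightarrow> state \<Rightarrow> bool" where
  "frame C s s' \<longleftrightarrow> (\<forall>x. x \<notin> nwrites C \<longrightarrow> nats s' x = nats s x) \<and>
     (\<forall>x. x \<notin> rwrites C \<longrightarrow> reals s' x = reals s x)"

lemma nats_set_nat [simp]: "nats (set_nat x i v s) = (nats s)(x := (nats s x)(i := v))"
  and reals_set_nat [simp]: "reals (set_nat x i v s) = reals s"
  and nats_set_real [simp]: "nats (set_real x i w s) = nats s"
  and reals_set_real [simp]: "reals (set_real x i w s) = (reals s)(x := (reals s x)(i := w))"
  by (simp_all add: set_nat_def set_real_def)

lemma set_pmf_add_time: "set_pmf (add_time t p) = (\<lambda>(s, u). (s, t + u)) ` set_pmf p"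
  by (simp add: add_time_def)

lemma add_time_return [simp]: "add_time t (return_pmf (s, u)) = return_pmf (s, t + u)"
  by (simp add: add_time_def)

lemma big_step_frame:
  "big_step dst C s p \<Longrightarrow> (s', t) \<in> set_pmf p \<Longrightarrow> frame C s s'"
proof (induction arbitrary: s' t rule: big_step.induct)
  case (Seq C s p D r)
  then obtain s1 t1 t2 where "(s1, t1) \<in> set_pmf p" "(s', t2) \<in> set_pmf (r s1)"
    by (auto simp: set_pmf_add_time)
  with Seq.IH show ?case unfolding frame_def by (metis UnCI nwrites.simps(6) rwrites.simps(6))
next
  case (WhileTrue b s C p r)
  then obtain s1 t1 t2 where "(s1, t1) \<in> set_pmf p" "(s', t2) \<in> set_pmf (r s1)"
    by (auto simp: set_pmf_add_time)
  with WhileTrue.IH show ?case unfolding frame_def by (metis nwrites.simps(8) rwrites.simps(8))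
qed (auto simp: set_pmf_add_time frame_def set_pmf_of_set; fastforce)+

lemma wp_frame: "wp dst C t Q s \<Longrightarrow> wp dst C t (\<lambda>s'. Q s' \<and> frame C s s') s"
  unfolding wp_def by (metis big_step_frame set_return_pmf singletonI)

text \<open>The consequence rule hands over the frame, so specifications of fragments need not
  mention the arrays that they leave alone.\<close>

lemma wp_mono:
  "wp dst C t Q s \<Longrightarrow> t \<le> t' \<Longrightarrow> (\<And>s'. Q s' \<Longrightarrow> frame C s s' \<Longrightarrow> Q' s') \<Longrightarrow> wp dst C t' Q' s"
  by (drule wp_frame) (auto simp: wp_def intro: le_trans)

lemma big_step_SeqI:
  assumes "big_step dst C s p" "\<And>s' t. (s', t) \<in> set_pmf p \<Longrightarrow> big_step dst D s' (r s')"
  shows "big_step dst (Seq C D) s (bind_pmf p (\<lambda>(s', t). add_time t (r s')))"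
  by (rule big_step.Seq) (use assms in auto)

lemma big_step_Seq_return:
  assumes "big_step dst C s (return_pmf (s', t))" "big_step dst D s' p"
  shows "big_step dst (Seq C D) s (add_time t p)"
  using big_step_SeqI[OF assms(1), of D "\<lambda>_. p"] assms(2) by (simp add: bind_return_pmf)

lemma wp_Seq: "wp dst C t (wp dst D u Q) s \<Longrightarrow> wp dst (Seq C D) (t + u) Q s"
  unfolding wp_def by (force dest: big_step_Seq_return intro: add_mono)

text \<open>Collapsing the output distribution to a point mass is what later turns a probability
  bound for the given algorithm into a statement about a single run.\<close>

lemma deterministic_return:
  "big_step dst C s p \<Longrightarrow> deterministic C \<Longrightarrow> \<exists>s' t. p = return_pmf (s', t)"
proof (induction rule: big_step.induct)
  case (Seq C s p D r)
  then obtain s1 t1 where p: "p = return_pmf (s1, t1)" by auto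
  with Seq obtain s2 t2 where "r s1 = return_pmf (s2, t2)" by auto
  then show ?case by (auto simp: p bind_return_pmf)
next
  case (WhileTrue b s C p r)
  then obtain s1 t1 where p: "p = return_pmf (s1, t1)" by auto
  with WhileTrue obtain s2 t2 where "r s1 = return_pmf (s2, t2)" by auto
  then show ?case by (auto simp: p bind_return_pmf)
qed auto

section \<open>Symbolic execution of loop-free programs\<close>

primrec straight :: "com \<Rightarrow> bool" where
  "straight Skip \<longleftrightarrow> True"
| "straight (NAsg x i e) \<longleftrightarrow> True"
| "straight (RAsg x i e) \<longleftrightarrow> True"
| "straight (Dist x i y j z k m) \<longleftrightarrow> True"
| "straight (Rand x i m) \<longleftrightarrow> False"
| "straight (Seq C D) \<longleftrightarrow> straight C \<and> straight D"
| "straight (If b C D) \<longleftrightarrow> straight C \<and> straight D"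
| "straight (While b C) \<longleftrightarrow> False"

text \<open>Values at \<open>Rand\<close> and \<open>While\<close> are placeholders that keep the
  function total. Under \<open>straight\<close>, simplification of \<open>final_state\<close> and
  \<open>duration\<close> replaces derivations in \<open>big_step\<close>.\<close>

primrec final_state :: "(real vec \<Rightarrow> real vec \<Rightarrow> real) \<Rightarrow> com \<Rightarrow> state \<Rightarrow> state" where
  "final_state dst Skip s = s"
| "final_state dst (NAsg x i e) s = set_nat x (nval i s) (nval e s) s"
| "final_state dst (RAsg x i e) s = set_real x (nval i s) (rval e s) s"
| "final_state dst (Dist x i y j z k m) s = set_real x (nval i s)
     (dst (read_vec s y (nval j s) (nval m s)) (read_vec s z (nval k s) (nval m s))) s"
| "final_state dst (Rand x i m) s = s"
| "final_state dst (Seq C D) s = final_state dst D (final_state dst C s)"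
| "final_state dst (If b C D) s = (if bval b s then final_state dst C s else final_state dst D s)"
| "final_state dst (While b C) s = s"

primrec duration :: "(real vec \<Rightarrow> real vec \<Rightarrow> real) \<Rightarrow> com \<Rightarrow> state \<Rightarrow> nat" where
  "duration dst Skip s = 1"
| "duration dst (NAsg x i e) s = 1"
| "duration dst (RAsg x i e) s = 1"
| "duration dst (Dist x i y j z k m) s = nval m s + 1"
| "duration dst (Rand x i m) s = 1"
| "duration dst (Seq C D) s = duration dst C s + duration dst D (final_state dst C s)"
| "duration dst (If b C D) s = 1 + (if bval b s then duration dst C s else duration dst D s)"
| "duration dst (While b C) s = 1"

lemma big_step_straight:
  "straight C \<Longrightarrow> big_step dst C s (return_pmf (final_state dst C s, duration dst C s))"
proof (induction C arbitrary: s)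
  case (Seq C D)
  have "big_step dst (Seq C D) s
      (add_time (duration dst C s) (return_pmf (final_state dst D (final_state dst C s),
         duration dst D (final_state dst C s))))"
    by (rule big_step_Seq_return) (use Seq in auto)
  then show ?case by simp
next
  case (If b C D)
  show ?case
  proof (cases "bval b s")
    case True
    from big_step.IfTrue[OF this] If show ?thesis using True by fastforce
  next
    case False
    from big_step.IfFalse[OF this] If show ?thesis using False by fastforce
  qed
qed (auto intro: big_step.intros[unfolded One_nat_def] simp: big_step.Dist[simplified])

lemma wp_straight:
  "straight C \<Longrightarrow> duration dst C s \<le> t \<Longrightarrow> Q (final_state dst C s) \<Longrightarrow> wp dst C t Q s"
  unfolding wp_def using big_step_straight by blast

section \<open>Counting loops with time bounds\<close>

definition for_loop :: "string \<Rightarrow> nexp \<Rightarrow> com \<Rightarrow> com" where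
  "for_loop i e C = Seq (NAsg i (NConst 0) (NConst 0))
     (While (NLess (NArr i (NConst 0)) e)
        (Seq C (NAsg i (NConst 0) (NPlus (NArr i (NConst 0)) (NConst 1)))))"

lemma nwrites_for_loop [simp]: "nwrites (for_loop i e C) = insert i (nwrites C)"
  and rwrites_for_loop [simp]: "rwrites (for_loop i e C) = rwrites C"
  by (auto simp: for_loop_def)

lemma big_step_WhileTrue_return:
  assumes "bval b s" "big_step dst C s (return_pmf (s', t))"
    "big_step dst (While b C) s' (return_pmf (s'', u))"
  shows "big_step dst (While b C) s (return_pmf (s'', 1 + t + u))"
  using big_step.WhileTrue[OF assms(1,2), of "\<lambda>_. return_pmf (s'', u)"] assms(3)
  by (simp add: bind_return_pmf)

text \<open>The invariant is indexed by the iteration and must hold again after the counter has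
  advanced. Every test evaluates \<open>e\<close> anew, so the invariant has to pin its value. An
  iteration costs \<open>\<tau>\<close> plus test and increment; the additional 2 are the
  initialization and the last, failing test.\<close>

lemma wp_for_loop:
  assumes init: "I 0 (set_nat i 0 0 s)"
    and bound: "\<And>k s. I k s \<Longrightarrow> nval e s = b"
    and body: "\<And>k s. I k s \<Longrightarrow> k < b \<Longrightarrow> nats s i 0 = k \<Longrightarrow>
      wp dst C \<tau> (\<lambda>s'. I (Suc k) (set_nat i 0 (Suc k) s')) s"
    and i: "i \<notin> nwrites C"
    and t: "2 + b * (\<tau> + 2) \<le> t"
    and post: "\<And>s. I b s \<Longrightarrow> Q s"
  shows "wp dst (for_loop i e C) t Q s"
proof -
  define B where "B = Seq C (NAsg i (NConst 0) (NPlus (NArr i (NConst 0)) (NConst 1)))"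
  define W where "W = While (NLess (NArr i (NConst 0)) e) B"
  \<comment> \<open>Induction on the number \<open>k\<close> of iterations still to run; the loop is
    then at index \<open>b - k\<close>.\<close>
  have W: "wp dst W (1 + k * (\<tau> + 2)) (I b) s"
    if "I (b - k) s" "k \<le> b" "nats s i 0 = b - k" for k s
    using that
  proof (induction k arbitrary: s)
    case 0
    then have "\<not> bval (NLess (NArr i (NConst 0)) e) s" using bound by auto
    from big_step.WhileFalse[OF this] 0 show ?case unfolding wp_def W_def by auto
  next
    case (Suc k)
    have lt: "b - Suc k < b" and eq: "Suc (b - Suc k) = b - k" using Suc.prems by auto
    from wp_frame[OF body[OF Suc.prems(1) lt Suc.prems(3)]] obtain s1 u
      where s1: "big_step dst C s (return_pmf (s1, u))" and u: "u \<le> \<tau>"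
        and I1: "I (b - k) (set_nat i 0 (b - k) s1)" and fr: "frame C s s1"
      unfolding wp_def eq by auto
    have n1: "nats s1 i 0 = b - Suc k" using fr i Suc.prems(3) by (simp add: frame_def)
    define s2 where "s2 = set_nat i 0 (b - k) s1"
    have "big_step dst B s (add_time u (return_pmf (s2, 1)))"
      unfolding B_def
      by (rule big_step_Seq_return[OF s1])
        (use big_step.NAsg[of dst i "NConst 0" "NPlus (NArr i (NConst 0)) (NConst 1)" s1] n1 eq
          in \<open>simp add: s2_def\<close>)
    then have B: "big_step dst B s (return_pmf (s2, u + 1))" by simp
    obtain s3 u3 where s3: "big_step dst W s2 (return_pmf (s3, u3))" "u3 \<le> 1 + k * (\<tau> + 2)" "I b s3"
      using Suc.IH[of s2] I1 Suc.prems by (auto simp: s2_def wp_def)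
    have "bval (NLess (NArr i (NConst 0)) e) s"
      using bound[OF Suc.prems(1)] Suc.prems lt by simp
    from big_step_WhileTrue_return[OF this B s3(1)[unfolded W_def]]
    have "big_step dst W s (return_pmf (s3, 1 + (u + 1) + u3))" unfolding W_def .
    moreover have "1 + (u + 1) + u3 \<le> 1 + Suc k * (\<tau> + 2)" using u s3(2) by simp
    ultimately show ?case using s3(3) unfolding wp_def by blast
  qed
  have "wp dst (for_loop i e C) (1 + (1 + b * (\<tau> + 2))) (I b) s"
    unfolding for_loop_def
  proof (rule wp_Seq, rule wp_straight)
    show "wp dst (While (NLess (NArr i (NConst 0)) e)
       (Seq C (NAsg i (NConst 0) (NPlus (NArr i (NConst 0)) (NConst 1)))))
       (1 + b * (\<tau> + 2)) (I b) (final_state dst (NAsg i (NConst 0) (NConst 0)) s)"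
      using W[of b, unfolded W_def B_def] init by simp
  qed simp_all
  then show ?thesis by (rule wp_mono) (use t post in auto)
qed

lemma wp_SeqI:
  assumes "wp dst C t R s" "\<And>s'. R s' \<Longrightarrow> frame C s s' \<Longrightarrow> wp dst D u Q s'" "t + u \<le> v"
  shows "wp dst (Seq C D) v Q s"
  by (rule wp_mono[OF wp_Seq[OF wp_mono[OF assms(1)]]]) (use assms in auto)

lemma wp_straight_Seq:
  assumes "straight C" "wp dst D u Q (final_state dst C s)" "duration dst C s + u \<le> t"
  shows "wp dst (Seq C D) t Q s"
  by (rule wp_mono[OF wp_Seq[OF wp_straight[OF assms(1)]]]) (use assms in auto)

section \<open>Randomized programs\<close>

text \<open>The sure part \<open>Q\<close> carries invariants and time bounds through sequential
  composition even along runs on which the event \<open>G\<close> fails.\<close>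

definition reach ::
  "(real vec \<Rightarrow> real vec \<Rightarrow> real) \<Rightarrow> com \<Rightarrow> nat \<Rightarrow> (state \<Rightarrow> bool) \<Rightarrow> real \<Rightarrow> (state \<Rightarrow> bool)
     \<Rightarrow> state \<Rightarrow> bool" where
  "reach dst C t Q q G s \<longleftrightarrow> (\<exists>p. big_step dst C s p \<and>
     (\<forall>s' u. (s', u) \<in> set_pmf p \<longrightarrow> u \<le> t \<and> Q s') \<and> q \<le> measure_pmf.prob p {(s', u). G s'})"

lemma prob_bind_pmf:
  "measure_pmf.prob (bind_pmf p f) X = (\<integral>x. measure_pmf.prob (f x) X \<partial>measure_pmf p)"
proof -
  have int: "integrable (measure_pmf p) (\<lambda>x. measure_pmf.prob (f x) X)"
    by (rule measure_pmf.integrable_const_bound[where B = 1]) auto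
  have "ennreal (measure_pmf.prob (bind_pmf p f) X) = (\<integral>\<^sup>+x. measure_pmf.prob (f x) X \<partial>measure_pmf p)"
    by (simp flip: measure_pmf.emeasure_eq_measure)
  also have "\<dots> = ennreal (\<integral>x. measure_pmf.prob (f x) X \<partial>measure_pmf p)"
    by (rule nn_integral_eq_integral[OF int]) simp
  finally show ?thesis by (simp add: integral_nonneg_AE)
qed

lemma prob_add_time:
  "measure_pmf.prob (add_time t p) {(s, u). G s} = measure_pmf.prob p {(s, u). G s}"
proof -
  have "(\<lambda>(s, u). (s, t + u)) -` {(s, u). G s} = {(s, u). G s}" by auto
  then show ?thesis by (simp add: add_time_def)
qed

lemma reach_mono:
  "reach dst C t Q q G s \<Longrightarrow> t \<le> t' \<Longrightarrow> q' \<le> q \<Longrightarrow> (\<And>s'. Q s' \<Longrightarrow> frame C s s' \<Longrightarrow> Q' s') \<Longrightarrow>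
     (\<And>s'. Q s' \<Longrightarrow> G s' \<Longrightarrow> G' s') \<Longrightarrow> reach dst C t' Q' q' G' s"
  unfolding reach_def
proof (elim exE conjE, goal_cases)
  case (1 p)
  have "measure_pmf.prob p {(s', u). G s'} \<le> measure_pmf.prob p {(s', u). G' s'}"
    by (rule measure_pmf.finite_measure_mono_AE)
      (use 1 in \<open>force simp: AE_measure_pmf_iff\<close>)+
  then show ?case using 1 big_step_frame by (meson order_trans)
qed

lemma reach_sure:
  assumes "reach dst C t Q q G s" "\<And>s'. Q s' \<Longrightarrow> G' s'"
  shows "reach dst C t Q 1 G' s"
proof -
  obtain p where p: "big_step dst C s p" "\<And>s' u. (s', u) \<in> set_pmf p \<Longrightarrow> u \<le> t \<and> Q s'"
    using assms(1) unfolding reach_def by blast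
  have "measure_pmf.prob p {(s', u). G' s'} = 1"
    by (subst measure_pmf.prob_eq_1) (use p(2) assms(2) in \<open>force simp: AE_measure_pmf_iff\<close>)+
  then show ?thesis unfolding reach_def using p by (intro exI[of _ p]) auto
qed

lemma wp_imp_reach: "wp dst C t Q s \<Longrightarrow> reach dst C t Q 0 G s"
  unfolding wp_def reach_def by (elim exE conjE, rule exI) auto

lemma reach_bind:
  assumes C: "big_step dst C s p"
    and D: "\<And>s' u. (s', u) \<in> set_pmf p \<Longrightarrow> u \<le> t \<and> reach dst D t' R (q s') H s'"
    and q: "\<And>s'. 0 \<le> q s'" "\<And>s'. q s' \<le> 1"
  shows "reach dst (Seq C D) (t + t') R (\<integral>(s', u). q s' \<partial>measure_pmf p) H s"
proof -
  \<comment> \<open>\<open>big_step.Seq\<close> wants the continuation as a function of the state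
    alone, hence the quantifier over the elapsed time \<open>u\<close> stands inside.\<close>
  have "\<forall>s'. \<exists>p'. \<forall>u. (s', u) \<in> set_pmf p \<longrightarrow> big_step dst D s' p' \<and>
     (\<forall>s'' u. (s'', u) \<in> set_pmf p' \<longrightarrow> u \<le> t' \<and> R s'') \<and> q s' \<le> measure_pmf.prob p' {(s', u). H s'}"
    using D unfolding reach_def by meson
  then obtain r where r: "\<And>s' u. (s', u) \<in> set_pmf p \<Longrightarrow> big_step dst D s' (r s') \<and>
     (\<forall>s'' u. (s'', u) \<in> set_pmf (r s') \<longrightarrow> u \<le> t' \<and> R s'') \<and>
     q s' \<le> measure_pmf.prob (r s') {(s', u). H s'}"
    by metis
  have le: "(case x of (s', u) \<Rightarrow> q s')
      \<le> measure_pmf.prob (case x of (s', t) \<Rightarrow> add_time t (r s')) {(s', u). H s'}"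
    if "x \<in> set_pmf p" for x
    using r that by (cases x) (auto simp: prob_add_time)
  have "(\<integral>(s', u). q s' \<partial>measure_pmf p)
      \<le> measure_pmf.prob (bind_pmf p (\<lambda>(s', t). add_time t (r s'))) {(s', u). H s'}"
    unfolding prob_bind_pmf
  proof (rule integral_mono_AE)
    show "integrable (measure_pmf p) (\<lambda>(s', u). q s')"
      by (rule measure_pmf.integrable_const_bound[where B = 1]) (use q in auto)
    show "integrable (measure_pmf p)
       (\<lambda>x. measure_pmf.prob (case x of (s', t) \<Rightarrow> add_time t (r s')) {(s', u). H s'})"
      by (rule measure_pmf.integrable_const_bound[where B = 1]) auto
  qed (use le in \<open>simp add: AE_measure_pmf_iff\<close>)
  moreover have "u \<le> t + t' \<and> R s''"
    if "(s'', u) \<in> set_pmf (bind_pmf p (\<lambda>(s', t). add_time t (r s')))" for s'' u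
    using that D r by (fastforce simp: set_pmf_add_time intro: add_mono)
  moreover have "big_step dst (Seq C D) s (bind_pmf p (\<lambda>(s', t). add_time t (r s')))"
    by (rule big_step_SeqI[OF C]) (use r in blast)
  ultimately show ?thesis unfolding reach_def by blast
qed

text \<open>Total probability: success is credited with \<open>c\<close> after \<open>G\<close> and
  with \<open>b\<close> otherwise. Since \<open>b \<le> c\<close>, the mean grows with the
  probability of \<open>G\<close>, so the lower bound \<open>a\<close> on it suffices.\<close>

lemma reach_Seq:
  assumes C: "reach dst C t Q a G s"
    and D: "\<And>s'. Q s' \<Longrightarrow> reach dst D t' R b H s'"
      "\<And>s'. Q s' \<Longrightarrow> G s' \<Longrightarrow> reach dst D t' R c H s'"
    and b: "0 \<le> b" "b \<le> c" "c \<le> 1"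
  shows "reach dst (Seq C D) (t + t') R (a * c + (1 - a) * b) H s"
proof -
  define q where "q = (\<lambda>s'. if G s' then c else b)"
  obtain p where p: "big_step dst C s p" "\<And>s' u. (s', u) \<in> set_pmf p \<Longrightarrow> u \<le> t \<and> Q s'"
    "a \<le> measure_pmf.prob p {(s', u). G s'}"
    using C unfolding reach_def by blast
  have *: "reach dst (Seq C D) (t + t') R (\<integral>(s', u). q s' \<partial>measure_pmf p) H s"
    by (rule reach_bind) (use p D b in \<open>auto simp: q_def\<close>)
  have q_eq: "(\<lambda>(s', u). q s') = (\<lambda>x. b + (c - b) * indicator {(s', u). G s'} x)"
    by (auto simp: q_def fun_eq_iff)
  have "integrable (measure_pmf p) (\<lambda>x. (c - b) * indicator {(s', u). G s'} x)"
    by (rule measure_pmf.integrable_const_bound[where B = "c - b"])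
      (use b in \<open>auto simp: indicator_def\<close>)
  then have "(\<integral>(s', u). q s' \<partial>measure_pmf p) = b + (c - b) * measure_pmf.prob p {(s', u). G s'}"
    unfolding q_eq by (subst Bochner_Integration.integral_add) auto
  moreover have "(c - b) * a \<le> (c - b) * measure_pmf.prob p {(s', u). G s'}"
    by (rule mult_left_mono) (use p b in auto)
  ultimately show ?thesis using reach_mono[OF *] by (simp add: algebra_simps)
qed

lemma wp_reach_Seq:
  assumes "wp dst C t (reach dst D t' R q H) s"
  shows "reach dst (Seq C D) (t + t') R q H s"
proof -
  obtain s' u p where s': "big_step dst C s (return_pmf (s', u))" "u \<le> t"
    and p: "big_step dst D s' p" "\<And>s'' u. (s'', u) \<in> set_pmf p \<Longrightarrow> u \<le> t' \<and> R s''"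
    "q \<le> measure_pmf.prob p {(s', u). H s'}"
    using assms unfolding reach_def wp_def by blast
  from big_step_Seq_return[OF s'(1) p(1)] show ?thesis
    unfolding reach_def using s'(2) p(2,3)
    by (intro exI conjI) (fastforce simp: set_pmf_add_time prob_add_time intro: add_mono)+
qed

lemma reach_Rand:
  assumes D: "\<And>v. v \<le> nval m s \<Longrightarrow> reach dst D t R (q v) H (set_nat x (nval i s) v s)"
    and q: "\<And>v. 0 \<le> q v" "\<And>v. q v \<le> 1"
  shows "reach dst (Seq (Rand x i m) D) (1 + t) R ((\<Sum>v\<le>nval m s. q v) / (nval m s + 1)) H s"
proof -
  define p where "p = map_pmf (\<lambda>v. (set_nat x (nval i s) v s, 1::nat)) (pmf_of_set {0..nval m s})"
  \<comment> \<open>The drawn value is read back from the cell that stores it, because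
    \<open>reach_bind\<close> takes the success probability as a function of the state.\<close>
  define f where "f = (\<lambda>s' :: state. q (nats s' x (nval i s)))"
  have "reach dst (Seq (Rand x i m) D) (1 + t) R (\<integral>(s', u). f s' \<partial>measure_pmf p) H s"
  proof (rule reach_bind)
    show "big_step dst (Rand x i m) s p" unfolding p_def by (rule big_step.Rand)
  qed (use D q in \<open>auto simp: p_def f_def\<close>)
  moreover have "(\<integral>(s', u). f s' \<partial>measure_pmf p) = (\<Sum>v\<le>nval m s. q v) / (nval m s + 1)"
    by (simp add: p_def f_def integral_pmf_of_set atMost_atLeast0)
  ultimately show ?thesis by simp
qed

text \<open>The number of rounds depends on \<delta> alone, so the rounds are unrolled into the
  program text and the machine never has to handle \<delta>.\<close>

primrec repeated :: "nat \<Rightarrow> com \<Rightarrow> com" where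
  "repeated 0 C = Skip"
| "repeated (Suc k) C = Seq C (repeated k C)"

text \<open>Once reached, \<open>G\<close> is never lost, so failure requires all \<open>k\<close>
  rounds to fail. The claim \<open>sure\<close> covers the rounds that follow a success.\<close>

lemma reach_repeated:
  assumes C: "\<And>s. Inv s \<Longrightarrow> reach dst C t (\<lambda>s'. Inv s' \<and> (G s \<longrightarrow> G s')) a G s"
    and a: "0 \<le> a" "a \<le> 1" and s: "Inv s"
  shows "reach dst (repeated k C) (k * t + 1) Inv (1 - (1 - a) ^ k) G s"
proof -
  have sure: "reach dst (repeated k C) (k * t + 1) Inv 1 G s" if "Inv s" "G s" for s k
    using that
  proof (induction k arbitrary: s)
    case 0
    then have "wp dst Skip 1 (\<lambda>s. Inv s \<and> G s) s" by (intro wp_straight) auto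
    from reach_sure[OF wp_imp_reach[OF this]] reach_mono show ?case by fastforce
  next
    case (Suc k)
    have "reach dst C t (\<lambda>s'. Inv s' \<and> G s') 1 G s"
      by (rule reach_sure[where G = G and q = a], rule reach_mono[OF C]) (use Suc.prems in auto)
    from reach_Seq[OF this, of "repeated k C" "k * t + 1" Inv 1 G 1]
    show ?case using Suc.IH by (auto simp: add_ac)
  qed
  show ?thesis using s
  proof (induction k arbitrary: s)
    case 0
    then have "wp dst Skip 1 Inv s" by (intro wp_straight) auto
    from wp_imp_reach[OF this] show ?case by simp
  next
    case (Suc k)
    have "reach dst C t Inv a G s"
      by (rule reach_mono[OF C[OF Suc.prems]]) auto
    from reach_Seq[OF this, of "repeated k C" "k * t + 1" Inv "1 - (1 - a) ^ k" G 1]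
    have "reach dst (repeated (Suc k) C) (t + (k * t + 1)) Inv
        (a * 1 + (1 - a) * (1 - (1 - a) ^ k)) G s"
      using Suc.IH sure a by (auto simp: power_le_one)
    then show ?case by (simp add: algebra_simps)
  qed
qed

section \<open>Earth mover distance\<close>

lemma EMD_set_finite:
  "finite I \<Longrightarrow> finite J \<Longrightarrow> finite {\<pi> \<in> I \<rightarrow>\<^sub>E J. bij_betw \<pi> I J}"
  by (rule finite_subset[OF _ finite_PiE]) auto

lemma EMD_le:
  assumes "finite I" "finite J" "bij_betw \<pi> I J"
  shows "EMD dst I X J Y \<le> (\<Sum>x\<in>I. dst (X x) (Y (\<pi> x)))"
  unfolding EMD_def
proof (rule Min_le)
  have "bij_betw (restrict \<pi> I) I J" using assms(3) by (simp cong: bij_betw_cong)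
  then have "restrict \<pi> I \<in> {\<pi> \<in> I \<rightarrow>\<^sub>E J. bij_betw \<pi> I J}"
    by (auto dest: bij_betwE)
  then show "(\<Sum>x\<in>I. dst (X x) (Y (\<pi> x)))
      \<in> (\<lambda>\<pi>. \<Sum>x\<in>I. dst (X x) (Y (\<pi> x))) ` {\<pi> \<in> I \<rightarrow>\<^sub>E J. bij_betw \<pi> I J}"
    by (rule rev_image_eqI) simp
qed (use assms EMD_set_finite in auto)

lemma EMD_attained:
  assumes "finite I" "finite J" "card I = card J"
  obtains \<pi> where "bij_betw \<pi> I J" "EMD dst I X J Y = (\<Sum>x\<in>I. dst (X x) (Y (\<pi> x)))"
proof -
  obtain \<sigma> where \<sigma>: "bij_betw \<sigma> I J" using assms finite_same_card_bij by blast
  then have "bij_betw (restrict \<sigma> I) I J" by (simp cong: bij_betw_cong)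
  then have "restrict \<sigma> I \<in> {\<pi> \<in> I \<rightarrow>\<^sub>E J. bij_betw \<pi> I J}" by (auto dest: bij_betwE)
  then have "EMD dst I X J Y
      \<in> (\<lambda>\<pi>. \<Sum>x\<in>I. dst (X x) (Y (\<pi> x))) ` {\<pi> \<in> I \<rightarrow>\<^sub>E J. bij_betw \<pi> I J}"
    unfolding EMD_def using EMD_set_finite[OF assms(1,2)] by (intro Min_in) blast+
  then show thesis using that by auto
qed

text \<open>The same points get indexed by input row, by sorted position and by row of a two-color
  instance. Composing an optimal matching with the change of index transfers bounds between these
  views.\<close>

lemma EMD_reindex_le:
  assumes "finite I" "finite J" "card I = card J" "bij_betw f I' I"
    and X: "\<And>x. x \<in> I' \<Longrightarrow> X' x = X (f x)"
  shows "EMD dst I' X' J Y \<le> EMD dst I X J Y"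
proof -
  obtain \<pi> where \<pi>: "bij_betw \<pi> I J" "EMD dst I X J Y = (\<Sum>x\<in>I. dst (X x) (Y (\<pi> x)))"
    by (rule EMD_attained[OF assms(1,2,3)])
  have "EMD dst I' X' J Y \<le> (\<Sum>x\<in>I'. dst (X' x) (Y ((\<pi> \<circ> f) x)))"
    by (rule EMD_le) (use assms(1,2) bij_betw_finite[OF assms(4)]
        bij_betw_trans[OF assms(4) \<pi>(1)] in blast)+
  also have "\<dots> = (\<Sum>x\<in>I'. dst (X (f x)) (Y (\<pi> (f x))))" by (simp add: X)
  also have "\<dots> = (\<Sum>x\<in>I. dst (X x) (Y (\<pi> x)))" by (rule sum.reindex_bij_betw[OF assms(4)])
  finally show ?thesis using \<pi> by simp
qed

section \<open>Sampling a color with small distance to the optimum\<close>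

lemma card_nat_interval_ge:
  fixes a b :: real
  assumes "0 \<le> a" "a \<le> b"
  shows "b - a - 1 \<le> card {k :: nat. a \<le> k \<and> k < b}"
proof -
  have "{k :: nat. a \<le> k \<and> k < b} = {nat \<lceil>a\<rceil>..<nat \<lceil>b\<rceil>}"
    by (auto simp: nat_ceiling_le_eq) linarith+
  moreover have "real (nat \<lceil>b\<rceil> - nat \<lceil>a\<rceil>) \<ge> b - a - 1" using assms by linarith
  ultimately show ?thesis by simp
qed

text \<open>The partial sums cut the range from 0 to \<open>S l\<close> into pieces of length
  \<open>w j\<close>, and the condition on \<open>k\<close>, cross-multiplied as the program tests
  it, says that \<open>k * S l / M\<close> falls into the piece of \<open>j\<close>. A piece
  contains at least \<open>w j * M / S l - 1\<close> such points; this is the loss of one per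
  element of \<open>N\<close>.\<close>

lemma card_thresholds_ge:
  fixes w S :: "nat \<Rightarrow> real" and N :: "nat set" and l M :: nat
  defines "S \<equiv> \<lambda>m. \<Sum>j<m. w j"
  assumes w: "\<And>j. 0 \<le> w j" and tot: "0 < S l" and N: "N \<subseteq> {..<l}"
  shows "real M * (\<Sum>j\<in>N. w j) / S l - card N
    \<le> card {k. k < M \<and> (\<exists>j\<in>N. S j * M \<le> k * S l \<and> k * S l < S (Suc j) * M)}"
proof -
  define K where "K = (\<lambda>j. {k :: nat. S j * M / S l \<le> k \<and> k < S (Suc j) * M / S l})"
  have finN: "finite N" using N finite_subset by blast
  have mono: "S i \<le> S j" if "i \<le> j" for i j
    unfolding S_def by (rule sum_mono2) (use w that in auto)
  have S0: "0 \<le> S i" for i unfolding S_def by (simp add: w sum_nonneg)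
  have K_eq: "k \<in> K j \<longleftrightarrow> S j * M \<le> k * S l \<and> k * S l < S (Suc j) * M" for k j
    using tot by (simp add: K_def field_simps)
  have sub: "k < M" if "k \<in> K j" "j \<in> N" for k j
  proof -
    have "k * S l < S (Suc j) * M" using that K_eq by blast
    also have "\<dots> \<le> S l * M" by (rule mult_right_mono[OF mono]) (use that N in auto)
    finally show ?thesis using tot by (simp add: mult.commute)
  qed
  have set_eq: "{k. k < M \<and> (\<exists>j\<in>N. S j * M \<le> k * S l \<and> k * S l < S (Suc j) * M)} = (\<Union>j\<in>N. K j)"
    using sub K_eq by blast
  have disj: "K i \<inter> K j = {}" if "i < j" for i j
  proof -
    have "S (Suc i) * M \<le> S j * M" by (rule mult_right_mono[OF mono]) (use that in auto)
    then show ?thesis using K_eq by fastforce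
  qed
  have "card (\<Union>j\<in>N. K j) = (\<Sum>j\<in>N. card (K j))"
  proof (rule card_UN_disjoint[OF finN])
    show "\<forall>j\<in>N. finite (K j)" using sub by (meson bounded_nat_set_is_finite)
    show "\<forall>i\<in>N. \<forall>j\<in>N. i \<noteq> j \<longrightarrow> K i \<inter> K j = {}" using disj by (metis inf_commute nat_neq_iff)
  qed
  moreover have "w j * M / S l - 1 \<le> card (K j)" for j
  proof -
    have "S (Suc j) * M / S l - S j * M / S l - 1 \<le> card (K j)"
      unfolding K_def
      by (rule card_nat_interval_ge) (use S0 tot mono[of j "Suc j"] in \<open>auto intro!: divide_right_mono mult_right_mono\<close>)
    moreover have "S (Suc j) * M / S l - S j * M / S l = w j * M / S l"
      by (simp add: S_def field_simps flip: diff_divide_distrib)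
    ultimately show ?thesis by simp
  qed
  then have "(\<Sum>j\<in>N. w j * M / S l - 1) \<le> (\<Sum>j\<in>N. real (card (K j)))" by (rule sum_mono)
  moreover have "(\<Sum>j\<in>N. w j * M / S l - 1) = real M * (\<Sum>j\<in>N. w j) / S l - card N"
    by (simp add: sum_subtractf sum_distrib_left sum_divide_distrib mult.commute)
  ultimately show ?thesis unfolding set_eq by simp
qed

text \<open>
  The first disjunct says that a uniformly random center color is good with probability at
  least 1/4.  In the second, half of the center colors \<open>i\<close> have excess \<open>X i - \<Omega> / l\<close> below twice the
  average excess of the bad colors.  Unless such an \<open>i\<close> is good itself, \<open>W\<close> is within
  \<open>2 * \<beta> * H\<close> in total of its upper bounds, and so the gaps below the average of \<open>W\<close> are
  concentrated on the good colors.
\<close>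

lemma good_color_sampling:
  fixes X :: "nat \<Rightarrow> real" and l :: nat
  defines "\<Omega> \<equiv> \<Sum>j<l. X j"
  defines "N \<equiv> {j. j < l \<and> l * X j \<le> \<Omega>}"
  assumes l: "1 \<le> l" and \<beta>: "0 < \<beta>"
  shows "l \<le> 4 * card N \<or> (\<exists>I \<subseteq> {..<l}. l \<le> 2 * card I \<and>
    (\<forall>i\<in>I. \<forall>(W :: nat \<Rightarrow> real) (S :: nat \<Rightarrow> real). (\<forall>j<l. W j \<le> \<beta> * (X i + X j)) \<longrightarrow>
      S = (\<lambda>m. \<Sum>j<m. max 0 ((\<Sum>j<l. W j) / l - W j)) \<longrightarrow>
      (\<Sum>j<l. W j) \<le> 2 * \<beta> * \<Omega> \<or>
      l \<le> 2 * card {k. k < 4 * l \<and>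
        (\<exists>j\<in>N. S j * real (4 * l) \<le> k * S l \<and> k * S l < S (Suc j) * real (4 * l))}))"
proof (cases "l \<le> 4 * card N")
  case False
  define \<mu> where "\<mu> = \<Omega> / l"
  \<comment> \<open>Excess over the average: the excesses sum to 0, so they total \<open>- H\<close>
    on the good colors and \<open>H\<close> on the bad ones.\<close>
  define x where "x = (\<lambda>j. X j - \<mu>)"
  define P where "P = {..<l} - N"
  define H where "H = (\<Sum>j\<in>P. x j)"
  define I where "I = {i. i < l \<and> l * x i < 2 * H}"
  have NP: "{..<l} = N \<union> P" "N \<inter> P = {}" "finite N" "finite P" "N \<subseteq> {..<l}"
    by (auto simp: N_def P_def)
  have split: "(\<Sum>j<l. f j) = (\<Sum>j\<in>N. f j) + (\<Sum>j\<in>P. f j)" for f :: "nat \<Rightarrow> real"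
    unfolding NP(1) by (rule sum.union_disjoint) (use NP in auto)
  have l\<mu>: "l * \<mu> = \<Omega>" using l by (simp add: \<mu>_def)
  have xN: "x j \<le> 0" if "j \<in> N" for j
    using that l by (simp add: N_def x_def \<mu>_def field_simps)
  have xP: "0 < x j" if "j \<in> P" for j
    using that l by (auto simp: P_def N_def x_def \<mu>_def field_simps not_le)
  have sx: "(\<Sum>j<l. x j) = 0" using l\<mu> by (simp add: x_def sum_subtractf \<Omega>_def)
  then have HN: "(\<Sum>j\<in>N. x j) = - H" using split[of x] by (simp add: H_def)
  have "card {..<l} = card N + card P" unfolding NP(1) by (rule card_Un_disjoint) (use NP in auto)
  then have Pne: "P \<noteq> {}" using False l by auto
  have H0: "0 < H" unfolding H_def by (rule sum_pos) (use NP Pne xP in auto)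
  have I: "I \<subseteq> {..<l}" by (auto simp: I_def)
  have card_I: "l \<le> 2 * card I"
  proof -
    define J where "J = {..<l} - I"
    have J: "J \<subseteq> P"
    proof
      fix j assume j: "j \<in> J"
      then have "2 * H \<le> l * x j" by (auto simp: J_def I_def not_less)
      then have "0 < l * x j" using H0 by linarith
      then have "0 < x j" by (simp add: zero_less_mult_iff)
      then show "j \<in> P" using j xN[of j] by (auto simp: J_def P_def)
    qed
    \<comment> \<open>Markov's inequality: colors outside \<open>I\<close> have excess at least
      \<open>2 * H / l\<close> but total excess at most \<open>H\<close>, so they make up at most
      half of all colors.\<close>
    have "real (card J) * (2 * H / l) \<le> (\<Sum>j\<in>J. x j)"
      by (rule sum_bounded_below) (use l in \<open>auto simp: J_def I_def field_simps\<close>)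
    also have "\<dots> \<le> H" unfolding H_def
      by (rule sum_mono2) (use NP J xP in \<open>auto intro: less_imp_le\<close>)
    finally have "2 * real (card J) \<le> l" using H0 l by (simp add: field_simps)
    moreover have "card J = l - card I" unfolding J_def
      using I by (subst card_Diff_subset) (auto intro: finite_subset)
    ultimately show ?thesis by linarith
  qed
  have key: "l \<le> 2 * card {k. k < 4 * l \<and>
      (\<exists>j\<in>N. S j * real (4 * l) \<le> k * S l \<and> k * S l < S (Suc j) * real (4 * l))}"
    if i: "i \<in> I" and W: "\<forall>j<l. W j \<le> \<beta> * (X i + X j)"
      and S: "S = (\<lambda>m. \<Sum>j<m. max 0 ((\<Sum>j<l. W j) / l - W j))"
      and bad: "\<not> (\<Sum>j<l. W j) \<le> 2 * \<beta> * \<Omega>" for i and W S :: "nat \<Rightarrow> real"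
  proof -
    define \<kappa> where "\<kappa> = (\<Sum>j<l. W j) / l"
    define w where "w = (\<lambda>j. max 0 (\<kappa> - W j))"
    define U where "U = (\<lambda>j. \<beta> * (2 * \<mu> + x i + x j))"
    have WU: "W j \<le> U j" if "j < l" for j 
    proof -
      have "U j = \<beta> * (X i + X j)" by (simp add: U_def x_def algebra_simps)
      then show ?thesis using W that by simp
    qed
    have sU: "(\<Sum>j<l. U j) = l * (\<beta> * (2 * \<mu> + x i))"

    proof -
      have "(\<Sum>j<l. U j) = l * (\<beta> * (2 * \<mu> + x i)) + \<beta> * (\<Sum>j<l. x j)"
        unfolding sum_distrib_left by (simp add: U_def distrib_left[of \<beta> _ "x _"] sum.distrib)
      then show ?thesis using sx by simp
    qed
    have "l * \<kappa> = (\<Sum>j<l. W j)" using l by (simp add: \<kappa>_def)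
    moreover have "(\<Sum>j<l. W j) \<le> (\<Sum>j<l. U j)" using WU by (intro sum_mono) auto
    ultimately have "l * \<kappa> \<le> l * (\<beta> * (2 * \<mu> + x i))" using sU by simp
    then have \<kappa>_le: "\<kappa> \<le> \<beta> * (2 * \<mu> + x i)" using l by simp
    have \<kappa>_ge: "2 * \<beta> * \<mu> < \<kappa>"
    proof -
      have "l * (2 * \<beta> * \<mu>) = 2 * \<beta> * \<Omega>" by (simp flip: l\<mu>)
      then have "l * (2 * \<beta> * \<mu>) < l * \<kappa>" using bad \<open>l * \<kappa> = _\<close> by linarith
      then show ?thesis using l by simp
    qed
    have lx: "l * x i < 2 * H" using i by (simp add: I_def)
    have "\<beta> * (l * x i) < \<beta> * (2 * H)" using lx \<beta> by simp
    \<comment> \<open>The bounds \<open>U j\<close> sum to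
      \<open>2 * \<beta> * \<Omega> + \<beta> * l * x i\<close>. Failure of \<open>i\<close> means
      that the \<open>W j\<close> sum to more than the first term, and \<open>i \<in> I\<close>
      bounds the second.\<close>
    then have slack: "(\<Sum>j<l. U j - W j) \<le> 2 * \<beta> * H"

    proof -
      have "l * (\<beta> * (2 * \<mu> + x i)) = 2 * \<beta> * \<Omega> + \<beta> * (l * x i)"
        by (simp add: algebra_simps flip: l\<mu>)
      then show ?thesis unfolding sum_subtractf sU using bad \<open>\<beta> * (l * x i) < _\<close> by linarith
    qed
    have x0: "0 \<le> x i"
    proof -
      have "\<beta> * (2 * \<mu>) < \<beta> * (2 * \<mu> + x i)" using \<kappa>_le \<kappa>_ge by simp
      then show ?thesis using \<beta> by simp
    qed
    \<comment> \<open>On a bad color \<open>\<kappa> \<le> U j\<close>, so its weight is at most its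
      own slack \<open>U j - W j\<close>.\<close>
    have wP: "(\<Sum>j\<in>P. w j) \<le> 2 * \<beta> * H"
    proof -
      have "(\<Sum>j\<in>P. w j) \<le> (\<Sum>j\<in>P. U j - W j)"
      proof (rule sum_mono)
        fix j assume j: "j \<in> P"
        then have "0 \<le> \<beta> * x j" using xP[of j] \<beta> by simp
        then have "\<kappa> \<le> U j" using \<kappa>_le by (simp add: U_def algebra_simps)
        moreover have "j < l" using j by (simp add: P_def)
        ultimately show "w j \<le> U j - W j" using WU[of j] by (simp add: w_def)
      qed
      also have "\<dots> \<le> (\<Sum>j<l. U j - W j)" by (rule sum_mono2) (use WU in \<open>auto simp: P_def\<close>)
      finally show ?thesis using slack by simp
    qed
    \<comment> \<open>A good color has weight at least \<open>\<beta> * (- x i - x j)\<close>. In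
      the sum, \<open>card N * x i\<close> is subtracted from \<open>H\<close>; it is at most
      \<open>H / 2\<close> because \<open>4 * card N < l\<close> and
      \<open>l * x i < 2 * H\<close>.\<close>
    have wN: "\<beta> * H / 2 \<le> (\<Sum>j\<in>N. w j)"
    proof -
      have "4 * real (card N) \<le> l" using False by linarith
      then have "4 * real (card N) * x i \<le> l * x i" using x0 by (rule mult_right_mono)
      then have "card N * x i \<le> H / 2" using lx by simp
      then have "\<beta> * (H / 2) \<le> \<beta> * (H - card N * x i)" using \<beta> by simp
      also have "\<dots> = (\<Sum>j\<in>N. \<beta> * (- x i - x j))"
        using HN by (simp add: sum_subtractf sum_negf flip: sum_distrib_left)
      also have "\<dots> \<le> (\<Sum>j\<in>N. w j)"
      proof (rule sum_mono)
        fix j assume "j \<in> N"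
        then have "W j \<le> U j" using WU by (simp add: N_def)
        then show "\<beta> * (- x i - x j) \<le> w j" using \<kappa>_ge by (simp add: w_def U_def algebra_simps)
      qed
      finally show ?thesis by simp
    qed
    have S': "S = (\<lambda>m. \<Sum>j<m. w j)" unfolding S w_def \<kappa>_def ..
    have Sl: "S l = (\<Sum>j\<in>N. w j) + (\<Sum>j\<in>P. w j)" unfolding S' by (rule split)
    have "0 < \<beta> * H" using \<beta> H0 by simp
    moreover have "0 \<le> (\<Sum>j\<in>P. w j)" by (rule sum_nonneg) (simp add: w_def)
    ultimately have Sl0: "0 < S l" using Sl wN by linarith
    \<comment> \<open>Weight at least \<open>\<beta> * H / 2\<close> on \<open>N\<close> against at
      most \<open>2 * \<beta> * H\<close> on \<open>P\<close>: a share of at least 1/5 for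
      \<open>N\<close>.\<close>
    have frac: "4 * real l / 5 \<le> real (4 * l) * (\<Sum>j\<in>N. w j) / S l"
    proof -
      have "S l \<le> 5 * (\<Sum>j\<in>N. w j)" using Sl wN wP by linarith
      then have "real l * S l \<le> real l * (5 * (\<Sum>j\<in>N. w j))" by (rule mult_left_mono) simp
      then show ?thesis using Sl0 by (simp add: field_simps)
    qed
    have "real (4 * l) * (\<Sum>j\<in>N. w j) / S l - card N
      \<le> card {k. k < 4 * l \<and>
      (\<exists>j\<in>N. S j * real (4 * l) \<le> k * S l \<and> k * S l < S (Suc j) * real (4 * l))}"
      unfolding S' by (rule card_thresholds_ge)
        (use Sl0 NP(5) in \<open>auto simp: w_def S'\<close>)
    with frac False show ?thesis by linarith
  qed
  show ?thesis
    by (rule disjI2, intro exI[of _ I] conjI ballI allI impI I card_I,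
      rule disjCI[THEN disj_commute[THEN iffD1]], rule key)
qed simp

section \<open>The given algorithm for two colors\<close>

definition changes_le :: "state \<Rightarrow> state \<Rightarrow> nat \<Rightarrow> bool" where
  "changes_le s s' t \<longleftrightarrow>
     (\<exists>X. finite X \<and> card X \<le> t \<and> (\<forall>x i. (x, i) \<notin> X \<longrightarrow> reals s' x i = reals s x i))"

lemma changes_le_trans:
  assumes "changes_le s s1 t1" "changes_le s1 s' t2"
  shows "changes_le s s' (t1 + t2)"
proof -
  obtain X where X: "finite X" "card X \<le> t1" "\<forall>x i. (x, i) \<notin> X \<longrightarrow> reals s1 x i = reals s x i"
    using assms(1) unfolding changes_le_def by blast
  obtain Y where Y: "finite Y" "card Y \<le> t2" "\<forall>x i. (x, i) \<notin> Y \<longrightarrow> reals s' x i = reals s1 x i"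
    using assms(2) unfolding changes_le_def by blast
  show ?thesis unfolding changes_le_def
    using X Y card_Un_le[of X Y] by (intro exI[of _ "X \<union> Y"]) auto
qed

lemma changes_le_refl: "changes_le s s t"
  unfolding changes_le_def by (intro exI[of _ "{}"]) auto

lemma changes_le_mono: "changes_le s s' t \<Longrightarrow> t \<le> u \<Longrightarrow> changes_le s s' u"
  unfolding changes_le_def by (meson order_trans)

lemma changes_le_set_nat: "changes_le s (set_nat x i v s) t"
  unfolding changes_le_def by (intro exI[of _ "{}"]) auto

lemma changes_le_set_real: "1 \<le> t \<Longrightarrow> changes_le s (set_real x i v s) t"
  unfolding changes_le_def by (intro exI[of _ "{(x, i)}"]) auto

text \<open>One unit of time overwrites at most one real cell, so the number of cells that a correct
  output forces to change bounds the running time from below.\<close>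

lemma big_step_changes_le:
  "big_step dst C s p \<Longrightarrow> (s', t) \<in> set_pmf p \<Longrightarrow> changes_le s s' t"
proof (induction arbitrary: s' t rule: big_step.induct)
  case (Seq C s p D r)
  then obtain s1 t1 t2 where *: "(s1, t1) \<in> set_pmf p" "(s', t2) \<in> set_pmf (r s1)" "t = t1 + t2"
    by (auto simp: set_pmf_add_time)
  then have "changes_le s s1 t1" "changes_le s1 s' t2" using Seq.IH by blast+
  then show ?case using changes_le_trans *(3) by simp
next
  case (WhileTrue b s C p r)
  then obtain s1 t1 t2 where *: "(s1, t1) \<in> set_pmf p" "(s', t2) \<in> set_pmf (r s1)" "t = 1 + (t1 + t2)"
    by (auto simp: set_pmf_add_time)
  then have "changes_le s s1 t1" "changes_le s1 s' t2" using WhileTrue.IH by blast+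
  then show ?case using changes_le_trans changes_le_mono *(3) by (metis le_add2)
next
  case (IfTrue b s C p D)
  then obtain u where "(s', u) \<in> set_pmf p" "t = 1 + u" by (auto simp: set_pmf_add_time)
  with IfTrue.IH[of s' u] show ?case by (auto intro: changes_le_mono)
next
  case (IfFalse b s D p C)
  then obtain u where "(s', u) \<in> set_pmf p" "t = 1 + u" by (auto simp: set_pmf_add_time)
  with IfFalse.IH[of s' u] show ?case by (auto intro: changes_le_mono)
qed (auto simp: changes_le_refl changes_le_set_nat changes_le_set_real)

text \<open>Used for every two-color instance handed to \<open>P\<close>: the center class comes
  first, the class to be matched second.\<close>

definition half_coloring :: "nat \<Rightarrow> nat \<Rightarrow> nat" where
  "half_coloring n x = (if x < n then 0 else 1)"

lemma color_class_half:
  "color_class 2 n (half_coloring n) 0 = {..<n}" "color_class 2 n (half_coloring n) 1 = {n..<2 * n}"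
  by (auto simp: color_class_def half_coloring_def)

lemma balanced_half: "balanced 2 n (half_coloring n)"
  unfolding balanced_def using color_class_half[of n]
  by (auto simp: half_coloring_def less_2_cases_iff)

lemma fair_clustering_bij:
  assumes "fair_clustering l n c q" "i < l"
  shows "bij_betw q (color_class l n c i) {..<n}"
proof (rule bij_betw_imageI)
  have q: "q x < n" if "x \<in> color_class l n c i" for x
    using assms(1) that by (auto simp: fair_clustering_def color_class_def Pi_iff)
  have ex: "\<exists>!x. x \<in> color_class l n c i \<and> q x = j" if "j < n" for j
    using assms that by (simp add: fair_clustering_def)
  show "inj_on q (color_class l n c i)"
    by (rule inj_onI) (use q ex in metis)
  show "q ` color_class l n c i = {..<n}"
    using q ex by (auto simp: image_iff) metis
qed

locale two_color_algorithm =
  fixes dst :: "real vec \<Rightarrow> real vec \<Rightarrow> real" and \<beta> :: real and T :: "nat \<Rightarrow> nat \<Rightarrow> real" and P :: com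
  assumes metric: "\<And>d. d \<ge> 1 \<Longrightarrow> Metric_space (carrier_vec d) dst"
    and deterministic: "deterministic P"
    and algorithm: "fair_median_algorithm dst P 2 \<beta> 0 T"
begin

definition runtime :: "nat \<Rightarrow> nat \<Rightarrow> nat" where "runtime n d = nat \<lfloor>T n d\<rfloor>"

lemma dst_nonneg: "0 \<le> dst x y"
  using Metric_space.nonneg[OF metric[of 1]] by simp

lemma dst_commute: "dst x y = dst y x"
  using Metric_space.commute[OF metric[of 1]] by simp

lemma dst_triangle:
  "\<lbrakk>d \<ge> 1; x \<in> carrier_vec d; y \<in> carrier_vec d; z \<in> carrier_vec d\<rbrakk> \<Longrightarrow> dst x z \<le> dst x y + dst y z"
  using Metric_space.triangle[OF metric[of d]] by simp

lemma dst_zero: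
  "\<lbrakk>d \<ge> 1; x \<in> carrier_vec d; y \<in> carrier_vec d\<rbrakk> \<Longrightarrow> dst x y = 0 \<longleftrightarrow> x = y"
  using Metric_space.zero[OF metric[of d]] by simp

lemma EMD_nonneg:
  assumes "finite I" "finite J" "card I = card J"
  shows "0 \<le> EMD dst I X J Y"
  using EMD_attained[OF assms, of dst X Y] by (metis dst_nonneg sum_nonneg)

lemma fair_median_cost_nonneg:
  assumes "balanced l n c"
  shows "0 \<le> fair_median_cost dst l n A c B"
  unfolding fair_median_cost_def
  by (rule sum_nonneg, rule EMD_nonneg)
    (use assms in \<open>auto simp: balanced_def color_class_def\<close>)

lemma fair_median_opt_le:
  assumes "balanced l n c" "B \<in> carrier_mat n (dim_col A)"
  shows "fair_median_opt dst l n A c \<le> fair_median_cost dst l n A c B"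
  unfolding fair_median_opt_def
  by (rule cINF_lower) (use assms fair_median_cost_nonneg in \<open>auto intro!: bdd_belowI[of _ 0]\<close>)

lemma fair_median_opt_nonneg:
  assumes "balanced l n c"
  shows "0 \<le> fair_median_opt dst l n A c"
  unfolding fair_median_opt_def
  by (rule cINF_greatest) (use assms fair_median_cost_nonneg in \<open>auto intro: zero_carrier_mat\<close>)

lemma wp_algorithm:
  assumes "n \<ge> 1" "d \<ge> 1" "A \<in> carrier_mat (2 * n) d" "balanced 2 n c" "holds_input s 2 n d A c"
  shows "wp dst P (runtime n d)
    (\<lambda>s'. approx_fair_median dst \<beta> 2 n A c (output_clusters s') (output_centers s' n d)) s"
proof -
  obtain p where p: "big_step dst P s p" "\<And>s' t. (s', t) \<in> set_pmf p \<Longrightarrow> real t \<le> T n d"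
    and pr: "measure_pmf.prob p {(s', t). approx_fair_median dst \<beta> 2 n A c
      (output_clusters s') (output_centers s' n d)} \<ge> 1"
    using algorithm[unfolded fair_median_algorithm_def, rule_format, OF assms] by auto
  obtain s' t where st: "p = return_pmf (s', t)"
    using deterministic_return[OF p(1) deterministic] by blast
  have "approx_fair_median dst \<beta> 2 n A c (output_clusters s') (output_centers s' n d)"
    using pr by (auto simp: st indicator_def of_bool_def split: if_splits)
  moreover have "t \<le> runtime n d" unfolding runtime_def using p(2) st by (simp add: le_nat_floor)
  ultimately show ?thesis using p(1) st unfolding wp_def by blast
qed

text \<open>The fill value 1 of the other real arrays differs from the zeros that
  \<open>runtime_ge\<close> forces into the output array.\<close>

definition half_input :: "nat \<Rightarrow> nat \<Rightarrow> (nat \<Rightarrow> real) \<Rightarrow> state" where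
  "half_input n d a = \<lparr>nats = (\<lambda>x. if x = ''l'' then (\<lambda>_. 2) else if x = ''n'' then (\<lambda>_. n)
       else if x = ''d'' then (\<lambda>_. d) else half_coloring n),
     reals = (\<lambda>x. if x = ''A'' then a else (\<lambda>_. 1))\<rparr>"

lemma holds_half_input:
  "holds_input (half_input n d a) 2 n d (mat (2 * n) d (\<lambda>(x, k). a (x * d + k))) (half_coloring n)"
  by (simp add: holds_input_def half_input_def)

text \<open>
  If all points are equal, every center must equal them, so started with other contents in
  the output array the algorithm has to write the whole array.
\<close>

lemma runtime_ge:
  assumes n: "n \<ge> 1" and d: "d \<ge> 1"
  shows "n * d \<le> runtime n d"
proof -
  define A :: "real mat" where "A = mat (2 * n) d (\<lambda>(x, k). 0)"
  define s where "s = half_input n d (\<lambda>_. 0)"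
  have A: "A \<in> carrier_mat (2 * n) d" by (simp add: A_def)
  have inp: "holds_input s 2 n d A (half_coloring n)"
    using holds_half_input[of n d "\<lambda>_. 0"] by (simp add: s_def A_def)
  from wp_algorithm[OF n d A balanced_half inp] obtain s' t
    where st: "big_step dst P s (return_pmf (s', t))" "t \<le> runtime n d"
      and ap: "approx_fair_median dst \<beta> 2 n A (half_coloring n) (output_clusters s') (output_centers s' n d)"
    unfolding wp_def by blast
  define B where "B = output_centers s' n d"
  define q where "q = output_clusters s'"
  have fair: "fair_clustering 2 n (half_coloring n) q"
    and cost: "clustering_cost dst 2 n A q B \<le> \<beta> * fair_median_opt dst 2 n A (half_coloring n)"
    using ap by (auto simp: approx_fair_median_def B_def q_def)
  have rowA: "row A x = 0\<^sub>v d" if "x < 2 * n" for x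
    using that by (intro eq_vecI) (auto simp: A_def)
  have "fair_median_cost dst 2 n A (half_coloring n) (0\<^sub>m n d) \<le> 0"
    unfolding fair_median_cost_def
  proof (rule sum_nonpos)
    fix i :: nat assume i: "i \<in> {..<2}"
    have bal: "finite (color_class 2 n (half_coloring n) i)"
      "card (color_class 2 n (half_coloring n) i) = card {..<n}"
      using balanced_half[of n] i by (auto simp: balanced_def color_class_def)
    obtain \<pi> where \<pi>: "bij_betw \<pi> (color_class 2 n (half_coloring n) i) {..<n}"
      and eq: "EMD dst (color_class 2 n (half_coloring n) i) (row A) {..<n} (row (0\<^sub>m n d)) =
        (\<Sum>x\<in>color_class 2 n (half_coloring n) i. dst (row A x) (row (0\<^sub>m n d) (\<pi> x)))"
      by (rule EMD_attained[OF bal(1) finite_lessThan bal(2)])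
    have "dst (row A x) (row (0\<^sub>m n d) (\<pi> x)) = 0" if "x \<in> color_class 2 n (half_coloring n) i" for x
    proof -
      have "\<pi> x < n" using \<pi> that by (auto dest: bij_betwE)
      then show ?thesis using that d by (simp add: rowA color_class_def dst_zero[OF d])
    qed
    then show "EMD dst (color_class 2 n (half_coloring n) i) (row A) {..<n} (row (0\<^sub>m n d)) \<le> 0"
      unfolding eq by simp
  qed
  with fair_median_opt_le[OF balanced_half, of "0\<^sub>m n d" n A] fair_median_opt_nonneg[OF balanced_half, of n A]
  have "fair_median_opt dst 2 n A (half_coloring n) = 0"
    by (simp add: A_def)
  then have sum0: "(\<Sum>x<2 * n. dst (row A x) (row B (q x))) \<le> 0"
    using cost by (simp add: clustering_cost_def)
  have B0: "reals s' ''B'' (j * d + k) = 0" if jk: "j < n" "k < d" for j k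
  proof -
    obtain x where x: "x < n" "q x = j"
    proof -
      have "j \<in> q ` {..<n}"
        using bij_betw_imp_surj_on[OF fair_clustering_bij[OF fair, of 0]] jk(1)
        by (simp add: color_class_half)
      then show thesis using that by auto
    qed
    have "dst (row A x) (row B (q x)) \<le> (\<Sum>x<2 * n. dst (row A x) (row B (q x)))"
      by (rule member_le_sum) (use x dst_nonneg in auto)
    then have "dst (0\<^sub>v d) (row B j) = 0"
      using sum0 dst_nonneg[of "0\<^sub>v d" "row B j"] x by (simp add: rowA)
    moreover have "row B j \<in> carrier_vec d" using jk by (simp add: B_def output_centers_def)
    ultimately have "row B j = 0\<^sub>v d" using dst_zero[OF d] by (metis zero_carrier_vec)
    then have "row B j $ k = 0" using jk by simp
    then show ?thesis using jk by (simp add: B_def output_centers_def)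
  qed
  obtain X where X: "finite X" "card X \<le> t" "\<And>x i. (x, i) \<notin> X \<Longrightarrow> reals s' x i = reals s x i"
    using big_step_changes_le[OF st(1), of s' t] unfolding changes_le_def by auto
  have "Pair ''B'' ` {..<n * d} \<subseteq> X"
  proof
    fix y assume "y \<in> Pair ''B'' ` {..<n * d}"
    then obtain i where i: "i < n * d" "y = (''B'', i)" by auto
    have "i div d < n" using i d by (simp add: less_mult_imp_div_less)
    with B0[of "i div d" "i mod d"] d have "reals s' ''B'' i = 0" by simp
    moreover have "reals s ''B'' i = 1" by (simp add: s_def half_input_def)
    ultimately show "y \<in> X" using X(3)[of "''B''" i] i by fastforce
  qed
  from card_mono[OF X(1) this] have "n * d \<le> card X" by (simp add: card_image inj_on_def)
  then show ?thesis using X(2) st(2) by simp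
qed

text \<open>For \<open>n = 1\<close> both points share the only cluster. If they are distinct, the
  triangle inequality makes the cost positive, while a factor \<open>\<beta> \<le> 0\<close> would
  force it to be at most 0.\<close>

lemma \<beta>_pos: "0 < \<beta>"
proof (rule ccontr)
  assume "\<not> 0 < \<beta>"
  define A :: "real mat" where "A = mat (2 * 1) 1 (\<lambda>(x, k). real (x * 1 + k))"
  have A: "A \<in> carrier_mat (2 * 1) 1" by (simp add: A_def)
  have "holds_input (half_input 1 1 real) 2 1 1 A (half_coloring 1)"
    unfolding A_def by (rule holds_half_input)
  from wp_algorithm[OF _ _ A balanced_half this] obtain q B
    where ap: "approx_fair_median dst \<beta> 2 1 A (half_coloring 1) q B"
    unfolding wp_def by auto
  have q: "q 0 = 0" "q 1 = 0"
    using ap unfolding approx_fair_median_def fair_clustering_def by (auto simp: Pi_iff)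
  have B: "B \<in> carrier_mat 1 1" using ap A by (auto simp: approx_fair_median_def)
  have "clustering_cost dst 2 1 A q B \<le> \<beta> * fair_median_opt dst 2 1 A (half_coloring 1)"
    using ap by (simp add: approx_fair_median_def)
  also have "\<dots> \<le> 0"
    using \<open>\<not> 0 < \<beta>\<close> fair_median_opt_nonneg[OF balanced_half, of 1 A] by (simp add: mult_nonpos_nonneg)
  finally have "dst (row A 0) (row B 0) + dst (row A 1) (row B 0) \<le> 0"
    using q by (simp add: clustering_cost_def numeral_2_eq_2)
  moreover have "dst (row A 0) (row A 1) \<le> dst (row A 0) (row B 0) + dst (row B 0) (row A 1)"
    by (rule dst_triangle[of 1]) (use A B in \<open>auto intro!: carrier_vecI\<close>)
  ultimately have "dst (row A 0) (row A 1) = 0"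
    using dst_nonneg[of "row A 0" "row A 1"] dst_commute[of "row B 0"] by simp
  moreover have "row A x \<in> carrier_vec 1" for x using A by (auto intro!: carrier_vecI)
  ultimately have "row A 0 = row A 1" using dst_zero[of 1 "row A 0" "row A 1"] by simp
  then have "row A 0 $ 0 = row A 1 $ 0" by simp
  then show False by (simp add: A_def)
qed

end

section \<open>Clustering around the points of one color\<close>

abbreviation scalar :: "string \<Rightarrow> nexp" where "scalar x \<equiv> NArr x (NConst 0)"

text \<open>
  Working memory of the new algorithm, as arrays of natural numbers:
  \<open>v 0\<close>, \<open>v 1\<close>, \<open>v 2\<close> hold \<open>l\<close>, \<open>n\<close>, \<open>d\<close>; \<open>v 3\<close> the positions of the input points after sorting by
  color; \<open>v 4\<close> the number of points of each color read so far; \<open>v 5\<close> and \<open>v 10\<close> the current clustering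
  and its center color; \<open>v 6\<close> and \<open>v 12\<close> the same for the best clustering so far; \<open>v 7\<close> and \<open>v 8\<close> loop
  variables; \<open>v 11\<close> the inverse of a matching; \<open>v 13\<close> the random threshold.
  As arrays of reals: \<open>v 0\<close> the sorted points; \<open>v 1\<close> and \<open>v 2\<close> the cost of the current clustering, per
  color and in total; \<open>v 3\<close> the least cost so far; \<open>v 4\<close> scratch; \<open>v 5\<close> and \<open>v 6\<close> the partial sums and
  the total of the sampling weights.
\<close>

locale fresh_names = two_color_algorithm dst \<beta> T P
  for dst :: "real vec \<Rightarrow> real vec \<Rightarrow> real" and \<beta> T P +
  fixes v :: "nat \<Rightarrow> string"
  assumes inj_v: "inj v"
    and fresh: "v k \<notin> nwrites P \<union> rwrites P \<union> {''A'', ''B'', ''c'', ''d'', ''l'', ''n'', ''q''}"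
begin

lemma v_eq_iff [simp]: "v i = v j \<longleftrightarrow> i = j"
  using inj_v by (auto dest: injD)

lemma v_neq [simp]:
  "v k \<noteq> ''A''" "v k \<noteq> ''B''" "v k \<noteq> ''c''" "v k \<noteq> ''d''" "v k \<noteq> ''l''" "v k \<noteq> ''n''" "v k \<noteq> ''q''"
  "''A'' \<noteq> v k" "''B'' \<noteq> v k" "''c'' \<noteq> v k" "''d'' \<noteq> v k" "''l'' \<noteq> v k" "''n'' \<noteq> v k" "''q'' \<noteq> v k"
  "v k \<notin> nwrites P" "v k \<notin> rwrites P"
  using fresh[of k] by auto

text \<open>All input of \<open>P\<close> is rewritten before each call, since \<open>P\<close> may
  destroy it. The center class fills the first \<open>n\<close> rows; it may coincide with the other
  class, which needs no special treatment.\<close>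

definition load_pair :: com where
  "load_pair =
     Seq (NAsg ''l'' (NConst 0) (NConst 2))
    (Seq (NAsg ''n'' (NConst 0) (scalar (v 1)))
    (Seq (NAsg ''d'' (NConst 0) (scalar (v 2)))
    (Seq (for_loop (v 8) (NTimes (scalar (v 1)) (scalar (v 2)))
           (Seq (RAsg ''A'' (scalar (v 8)) (RArr (v 0)
                   (NPlus (NTimes (scalar (v 10)) (NTimes (scalar (v 1)) (scalar (v 2)))) (scalar (v 8)))))
                (RAsg ''A'' (NPlus (NTimes (scalar (v 1)) (scalar (v 2))) (scalar (v 8))) (RArr (v 0)
                   (NPlus (NTimes (scalar (v 7)) (NTimes (scalar (v 1)) (scalar (v 2)))) (scalar (v 8)))))))
         (for_loop (v 8) (scalar (v 1))
           (Seq (NAsg ''c'' (scalar (v 8)) (NConst 0))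
                (NAsg ''c'' (NPlus (scalar (v 1)) (scalar (v 8))) (NConst 1)))))))"

text \<open>Each cluster found by \<open>P\<close> has one point of either class, so the clustering
  is a perfect matching; \<open>v 11\<close> sends a cluster to its point of the center class. These
  points replace the centers computed by \<open>P\<close>.\<close>

definition collect_pair :: com where
  "collect_pair =
     Seq (for_loop (v 8) (scalar (v 1)) (NAsg (v 11) (NArr ''q'' (scalar (v 8))) (scalar (v 8))))
    (Seq (RAsg (v 1) (scalar (v 7)) (OfNat (NConst 0)))
    (Seq (for_loop (v 8) (scalar (v 1))
           (Seq (NAsg (v 5) (NPlus (NTimes (scalar (v 7)) (scalar (v 1))) (scalar (v 8)))
                   (NArr (v 11) (NArr ''q'' (NPlus (scalar (v 1)) (scalar (v 8))))))
           (Seq (Dist (v 4) (NConst 0)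
                   (v 0) (NTimes (NPlus (NTimes (scalar (v 7)) (scalar (v 1))) (scalar (v 8))) (scalar (v 2)))
                   (v 0) (NTimes (NPlus (NTimes (scalar (v 10)) (scalar (v 1)))
                      (NArr (v 5) (NPlus (NTimes (scalar (v 7)) (scalar (v 1))) (scalar (v 8))))) (scalar (v 2)))
                   (scalar (v 2)))
                (RAsg (v 1) (scalar (v 7)) (RPlus (RArr (v 1) (scalar (v 7))) (RArr (v 4) (NConst 0)))))))
         (RAsg (v 2) (NConst 0) (RPlus (RArr (v 2) (NConst 0)) (RArr (v 1) (scalar (v 7)))))))"

definition star :: com where
  "star = Seq (RAsg (v 2) (NConst 0) (OfNat (NConst 0)))
     (for_loop (v 7) (scalar (v 0)) (Seq load_pair (Seq P collect_pair)))"

lemma nwrites_load_pair: "nwrites load_pair = {''l'', ''n'', ''d'', ''c'', v 8}"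
  and rwrites_load_pair: "rwrites load_pair = {''A''}"
  and nwrites_collect_pair: "nwrites collect_pair = {v 5, v 8, v 11}"
  and rwrites_collect_pair: "rwrites collect_pair = {v 1, v 2, v 4}"
  by (auto simp: load_pair_def collect_pair_def)

lemma nwrites_star: "nwrites star = {''l'', ''n'', ''d'', ''c'', v 5, v 7, v 8, v 11} \<union> nwrites P"
  and rwrites_star: "rwrites star = {''A'', v 1, v 2, v 4} \<union> rwrites P"
  by (auto simp: star_def nwrites_load_pair rwrites_load_pair nwrites_collect_pair rwrites_collect_pair)

end

text \<open>
  The \<open>t\<close>-th point of color \<open>i\<close> is \<open>pt (i * n + t)\<close>; its coordinates are consecutive entries
  of \<open>a\<close>.
\<close>

locale sorted_instance = fresh_names dst \<beta> T P v
  for dst \<beta> T P v +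
  fixes l n d :: nat and pos :: "nat \<Rightarrow> nat" and a :: "nat \<Rightarrow> real"
  assumes l: "1 \<le> l" and n: "1 \<le> n" and d: "1 \<le> d"
begin

abbreviation "\<tau> \<equiv> runtime n d"

definition ctx :: "state \<Rightarrow> bool" where
  "ctx s \<longleftrightarrow> nats s (v 0) 0 = l \<and> nats s (v 1) 0 = n \<and> nats s (v 2) 0 = d \<and>
     nats s (v 3) = pos \<and> reals s (v 0) = a"

lemma ctx_frame:
  "ctx s \<Longrightarrow> frame C s s' \<Longrightarrow> (\<And>k. k < 4 \<Longrightarrow> v k \<notin> nwrites C) \<Longrightarrow> v 0 \<notin> rwrites C \<Longrightarrow> ctx s'"
  unfolding ctx_def frame_def by simp

lemma ctx_set [simp]:
  "ctx s \<Longrightarrow> x \<notin> {v 0, v 1, v 2, v 3} \<Longrightarrow> ctx (set_nat x i m s)"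
  "ctx s \<Longrightarrow> x \<noteq> v 0 \<Longrightarrow> ctx (set_real x i r s)"
  unfolding ctx_def by auto

lemma ctxD [simp]:
  "ctx s \<Longrightarrow> nats s (v 0) 0 = l" "ctx s \<Longrightarrow> nats s (v (Suc 0)) 0 = n" "ctx s \<Longrightarrow> nats s (v 2) 0 = d"
  "ctx s \<Longrightarrow> nats s (v 3) = pos" "ctx s \<Longrightarrow> reals s (v 0) = a"
  unfolding ctx_def by auto

definition pt :: "nat \<Rightarrow> real vec" where "pt p = vec d (\<lambda>k. a (p * d + k))"

lemma pt_carrier [simp]: "pt p \<in> carrier_vec d" by (simp add: pt_def)

lemma read_vec_pt: "ctx s \<Longrightarrow> read_vec s (v 0) (p * d) d = pt p"
  by (simp add: read_vec_def pt_def)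

text \<open>The \<open>X i\<close> of the overview, relative to an arbitrary center matrix.\<close>

definition color_EMD :: "nat \<Rightarrow> real mat \<Rightarrow> real" where
  "color_EMD i B = EMD dst {..<n} (\<lambda>t. pt (i * n + t)) {..<n} (row B)"

definition pair_points :: "nat \<Rightarrow> nat \<Rightarrow> real mat" where
  "pair_points i j = mat (2 * n) d (\<lambda>(x, k). a ((if x < n then i * n + x else j * n + (x - n)) * d + k))"

lemma pair_points_carrier: "pair_points i j \<in> carrier_mat (2 * n) d"
  by (simp add: pair_points_def)

lemma row_pair_points:
  "x < n \<Longrightarrow> row (pair_points i j) x = pt (i * n + x)"
  "x < n \<Longrightarrow> row (pair_points i j) (n + x) = pt (j * n + x)"
  by (auto simp: pair_points_def pt_def intro!: eq_vecI)

lemma index_less: "x < n \<Longrightarrow> k < d \<Longrightarrow> x * d + k < n * d" for x k :: nat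
proof -
  assume "x < n" "k < d"
  then have "x * d + k < Suc x * d" by simp
  also have "\<dots> \<le> n * d" using \<open>x < n\<close> by (intro mult_le_mono1) simp
  finally show ?thesis .
qed

text \<open>Through these bounds all copying and bookkeeping is charged to the calls of
  \<open>P\<close>.\<close>

lemma n_le: "n \<le> \<tau>" and nd_le: "n * d \<le> \<tau>" and one_le: "1 \<le> \<tau>"
proof -
  show nd: "n * d \<le> \<tau>" by (rule runtime_ge[OF n d])
  have "n \<le> n * d" using d by simp
  then show "n \<le> \<tau>" using nd by linarith
  then show "1 \<le> \<tau>" using n by simp
qed

lemma l_le: "l \<le> l * \<tau>"
  using mult_le_mono2[OF one_le, of l] by linarith

lemma wp_load_pair:
  assumes s: "ctx s" "nats s (v 10) 0 = i" "nats s (v 7) 0 = j"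
  shows "wp dst load_pair (7 + 4 * (n * d) + 4 * n)
    (\<lambda>s'. holds_input s' 2 n d (pair_points i j) (half_coloring n)) s"
proof -
  define I where "I = (\<lambda>s'. ctx s' \<and> nats s' (v 10) 0 = i \<and> nats s' (v 7) 0 = j \<and>
    nats s' ''l'' 0 = 2 \<and> nats s' ''n'' 0 = n \<and> nats s' ''d'' 0 = d)"
  define J where "J = (\<lambda>m (s' :: state). \<forall>u<m. reals s' ''A'' u = a (i * (n * d) + u) \<and>
    reals s' ''A'' (n * d + u) = a (j * (n * d) + u))"
  define K where "K = (\<lambda>m (s' :: state). \<forall>u<m. nats s' ''c'' u = 0 \<and> nats s' ''c'' (n + u) = (1 :: nat))"
  have I_set [simp]: "I s' \<Longrightarrow> I (set_real ''A'' k y s')" "I s' \<Longrightarrow> I (set_nat (v 8) k z s')"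
    "I s' \<Longrightarrow> I (set_nat ''c'' k z s')" for s' k y z
    by (simp_all add: I_def)
  have I [simp]: "ctx s'" "nats s' (v 10) 0 = i" "nats s' (v 7) 0 = j" if "I s'" for s'
    using that by (simp_all add: I_def)
  have loop1: "wp dst (for_loop (v 8) (NTimes (scalar (v 1)) (scalar (v 2)))
           (Seq (RAsg ''A'' (scalar (v 8)) (RArr (v 0)
                   (NPlus (NTimes (scalar (v 10)) (NTimes (scalar (v 1)) (scalar (v 2)))) (scalar (v 8)))))
                (RAsg ''A'' (NPlus (NTimes (scalar (v 1)) (scalar (v 2))) (scalar (v 8))) (RArr (v 0)
                   (NPlus (NTimes (scalar (v 7)) (NTimes (scalar (v 1)) (scalar (v 2)))) (scalar (v 8)))))))
        (2 + 4 * (n * d)) (\<lambda>s'. I s' \<and> J (n * d) s') s'" if "I s'" for s'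
    by (rule wp_for_loop[where I = "\<lambda>m s'. I s' \<and> J m s'" and b = "n * d" and \<tau> = 2])
      (use that in \<open>auto simp: J_def less_Suc_eq intro!: wp_straight\<close>)
  have loop2: "wp dst (for_loop (v 8) (scalar (v 1))
           (Seq (NAsg ''c'' (scalar (v 8)) (NConst 0))
                (NAsg ''c'' (NPlus (scalar (v 1)) (scalar (v 8))) (NConst 1))))
        (2 + 4 * n) (\<lambda>s'. I s' \<and> J (n * d) s' \<and> K n s') s'" if "I s'" "J (n * d) s'" for s'
    by (rule wp_for_loop[where I = "\<lambda>m s'. I s' \<and> J (n * d) s' \<and> K m s'" and b = n and \<tau> = 2])
      (use that in \<open>auto simp: J_def K_def less_Suc_eq intro!: wp_straight\<close>)
  have "wp dst load_pair (7 + 4 * (n * d) + 4 * n) (\<lambda>s'. I s' \<and> J (n * d) s' \<and> K n s') s"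
    unfolding load_pair_def
    by (rule wp_straight_Seq[where u = "6 + 4 * (n * d) + 4 * n"], simp,
        rule wp_straight_Seq[where u = "5 + 4 * (n * d) + 4 * n"], simp,
        rule wp_straight_Seq[where u = "4 + 4 * (n * d) + 4 * n"], simp,
        rule wp_SeqI[OF loop1 loop2])
      (use s in \<open>auto simp: I_def simp del: I I_set\<close>)
  then show ?thesis
  proof (rule wp_mono)
    fix s' assume s': "I s' \<and> J (n * d) s' \<and> K n s'"
    have "reals s' ''A'' (x * d + k) = pair_points i j $$ (x, k)" if x: "x < 2 * n" and k: "k < d" for x k
    proof (cases "x < n")
      case True
      from index_less[OF this k] s' have "reals s' ''A'' (x * d + k) = a (i * (n * d) + (x * d + k))"
        by (simp add: J_def)
      then show ?thesis using True x k by (simp add: pair_points_def algebra_simps)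
    next
      case False
      then obtain y where y: "x = n + y" "y < n" using x by (metis add_less_cancel_left le_iff_add mult_2 not_less)
      from index_less[OF y(2) k] s'
      have "reals s' ''A'' (n * d + (y * d + k)) = a (j * (n * d) + (y * d + k))"
        by (simp add: J_def)
      then show ?thesis using y k by (simp add: pair_points_def algebra_simps)
    qed
    moreover have "nats s' ''c'' x = half_coloring n x" if x: "x < 2 * n" for x
    proof (cases "x < n")
      case False
      then obtain y where y: "x = n + y" "y < n" using x by (metis add_less_cancel_left le_iff_add mult_2 not_less)
      then show ?thesis using s' by (simp add: K_def half_coloring_def)
    qed (use s' in \<open>simp add: K_def half_coloring_def\<close>)
    ultimately show "holds_input s' 2 n d (pair_points i j) (half_coloring n)"
      using s' by (simp add: holds_input_def I_def del: I I_set)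
  qed simp
qed

lemma wp_collect_pair:
  assumes s: "ctx s" "nats s (v 10) 0 = i" "nats s (v 7) 0 = j"
    and q: "q = nats s ''q''" "fair_clustering 2 n (half_coloring n) q"
  shows "wp dst collect_pair (6 + 3 * n + n * (d + 5)) (\<lambda>s'. \<exists>f. bij_betw f {..<n} {..<n} \<and>
    (\<forall>t<n. q (f t) = q (n + t)) \<and>
    (\<forall>t<n. nats s' (v 5) (j * n + t) = f t) \<and>
    (\<forall>x. x \<notin> {j * n..<j * n + n} \<longrightarrow> nats s' (v 5) x = nats s (v 5) x) \<and>
    (\<forall>k. k \<noteq> j \<longrightarrow> reals s' (v 1) k = reals s (v 1) k) \<and>
    reals s' (v 1) j = (\<Sum>t<n. dst (pt (j * n + t)) (pt (i * n + f t))) \<and>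
    reals s' (v 2) 0 = reals s (v 2) 0 + (\<Sum>t<n. dst (pt (j * n + t)) (pt (i * n + f t)))) s"
proof -
  have q0: "bij_betw q {..<n} {..<n}" and q1: "bij_betw q {n..<2 * n} {..<n}"
    using fair_clustering_bij[OF q(2), of 0] fair_clustering_bij[OF q(2), of 1]
    unfolding color_class_half by simp_all
  define g where "g = inv_into {..<n} q"
  \<comment> \<open>The partner in class \<open>i\<close> of the \<open>t\<close>-th point of class
    \<open>j\<close>.\<close>
  define f where "f = (\<lambda>t. g (q (n + t)))"
  have "bij_betw g {..<n} {..<n}" unfolding g_def by (rule bij_betw_inv_into[OF q0])
  moreover have "bij_betw (\<lambda>t. n + t) {..<n} {n..<2 * n}"
    by (rule bij_betwI[where g = "\<lambda>x. x - n"]) auto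
  ultimately have "bij_betw (g \<circ> (q \<circ> (\<lambda>t. n + t))) {..<n} {..<n}"
    using q1 by (metis bij_betw_trans)
  then have f: "bij_betw f {..<n} {..<n}" by (simp add: f_def comp_def)
  have q_lt: "q (n + t) < n" if "t < n" for t
    using bij_betwE[OF q1] that by auto
  have qf: "q (f t) = q (n + t)" if "t < n" for t
    unfolding f_def g_def using q_lt[OF that] bij_betw_inv_into_right[OF q0] by simp
  define c where "c = (\<lambda>t. dst (pt (j * n + t)) (pt (i * n + f t)))"
  define I where "I = (\<lambda>s'. ctx s' \<and> nats s' (v 10) 0 = i \<and> nats s' (v 7) 0 = j \<and> nats s' ''q'' = q \<and>
    reals s' (v 2) = reals s (v 2))"
  define I0 where "I0 = (\<lambda>s'. I s' \<and> nats s' (v 5) = nats s (v 5) \<and> reals s' (v 1) = reals s (v 1))"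
  define J where "J = (\<lambda>m (s' :: state). (\<forall>u<m. nats s' (v 11) (q u) = u))"
  define K where "K = (\<lambda>m (s' :: state). (\<forall>t<m. nats s' (v 5) (j * n + t) = f t) \<and>
    (\<forall>x. x \<notin> {j * n..<j * n + n} \<longrightarrow> nats s' (v 5) x = nats s (v 5) x) \<and>
    (\<forall>k. k \<noteq> j \<longrightarrow> reals s' (v 1) k = reals s (v 1) k) \<and>
    reals s' (v 1) j = (\<Sum>t<m. c t))"
  have s_I: "I s" using s q by (simp add: I_def)
  have I_set [simp]: "I s' \<Longrightarrow> I (set_nat (v 5) k z s')" "I s' \<Longrightarrow> I (set_nat (v 8) k z s')"
    "I s' \<Longrightarrow> I (set_nat (v 11) k z s')" "I s' \<Longrightarrow> I (set_real (v (Suc 0)) k y s')"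
    "I s' \<Longrightarrow> I (set_real (v 4) k y s')" for s' k y z
    by (simp_all add: I_def)
  have I [simp]: "ctx s'" "nats s' (v 10) 0 = i" "nats s' (v 7) 0 = j" "nats s' ''q'' = q"
    "reals s' (v 2) = reals s (v 2)" if "I s'" for s'
    using that by (simp_all add: I_def)
  have loop1: "wp dst (for_loop (v 8) (scalar (v 1)) (NAsg (v 11) (NArr ''q'' (scalar (v 8))) (scalar (v 8))))
      (2 + 3 * n) (\<lambda>s'. I0 s' \<and> J n s') s"
  proof (rule wp_for_loop[where I = "\<lambda>m s'. I0 s' \<and> J m s'" and b = n and \<tau> = 1])
    fix m s' assume s': "I0 s' \<and> J m s'" and m: "m < n" "nats s' (v 8) 0 = m"
    \<comment> \<open>By injectivity of \<open>q\<close> on the first class, no entry of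
      \<open>v 11\<close> is overwritten later.\<close>
    have "q u \<noteq> q m" if "u < m" for u
      using inj_onD[OF bij_betw_imp_inj_on[OF q0], of u m] that m by auto
    then show "wp dst (NAsg (v 11) (NArr ''q'' (scalar (v 8))) (scalar (v 8))) 1
        (\<lambda>s'. I0 (set_nat (v 8) 0 (Suc m) s') \<and> J (Suc m) (set_nat (v 8) 0 (Suc m) s')) s'"
      using s' m by (intro wp_straight) (auto simp: I0_def J_def less_Suc_eq)
  qed (use s_I in \<open>auto simp: I0_def J_def\<close>)
  have loop2: "wp dst (for_loop (v 8) (scalar (v 1))
           (Seq (NAsg (v 5) (NPlus (NTimes (scalar (v 7)) (scalar (v 1))) (scalar (v 8)))
                   (NArr (v 11) (NArr ''q'' (NPlus (scalar (v 1)) (scalar (v 8))))))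
           (Seq (Dist (v 4) (NConst 0)
                   (v 0) (NTimes (NPlus (NTimes (scalar (v 7)) (scalar (v 1))) (scalar (v 8))) (scalar (v 2)))
                   (v 0) (NTimes (NPlus (NTimes (scalar (v 10)) (scalar (v 1)))
                      (NArr (v 5) (NPlus (NTimes (scalar (v 7)) (scalar (v 1))) (scalar (v 8))))) (scalar (v 2)))
                   (scalar (v 2)))
                (RAsg (v 1) (scalar (v 7)) (RPlus (RArr (v 1) (scalar (v 7))) (RArr (v 4) (NConst 0)))))))
      (2 + n * (d + 5)) (\<lambda>s'. I s' \<and> K n s') s'"
    if s': "I s' \<and> K 0 s' \<and> J n s'" for s'
  \<comment> \<open>\<open>d + 3\<close> stands for two assignments and one distance computation of
    cost \<open>d + 1\<close>.\<close>
  proof (rule wp_for_loop[where I = "\<lambda>m s'. I s' \<and> K m s' \<and> J n s'" and b = n and \<tau> = "d + 3"],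
      goal_cases)
    case (3 m s')
    then have m: "m < n" "nats s' (v 8) 0 = m" and I: "I s'" and K: "K m s'" and J: "J n s'" by auto
    have inv: "nats s' (v 11) (q (n + m)) = f m"
      using J qf[OF m(1)] bij_betwE[OF f] m(1) unfolding J_def by (metis lessThan_iff)
    show ?case
      by (rule wp_straight)
        (use I K J inv m in \<open>auto simp: K_def J_def less_Suc_eq read_vec_pt c_def\<close>)
  qed (use s' in \<open>auto simp: K_def J_def\<close>)
  have "wp dst collect_pair (6 + 3 * n + n * (d + 5)) (\<lambda>s'. K n s' \<and> reals s' (v 2) 0 = reals s (v 2) 0 + (\<Sum>t<n. c t)) s"
    unfolding collect_pair_def
  proof (rule wp_SeqI[OF loop1, where u = "4 + n * (d + 5)"])
    fix s' assume s': "I0 s' \<and> J n s'"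
    show "wp dst (Seq (RAsg (v 1) (scalar (v 7)) (OfNat (NConst 0)))
    (Seq (for_loop (v 8) (scalar (v 1))
           (Seq (NAsg (v 5) (NPlus (NTimes (scalar (v 7)) (scalar (v 1))) (scalar (v 8)))
                   (NArr (v 11) (NArr ''q'' (NPlus (scalar (v 1)) (scalar (v 8))))))
           (Seq (Dist (v 4) (NConst 0)
                   (v 0) (NTimes (NPlus (NTimes (scalar (v 7)) (scalar (v 1))) (scalar (v 8))) (scalar (v 2)))
                   (v 0) (NTimes (NPlus (NTimes (scalar (v 10)) (scalar (v 1)))
                      (NArr (v 5) (NPlus (NTimes (scalar (v 7)) (scalar (v 1))) (scalar (v 8))))) (scalar (v 2)))
                   (scalar (v 2)))
                (RAsg (v 1) (scalar (v 7)) (RPlus (RArr (v 1) (scalar (v 7))) (RArr (v 4) (NConst 0)))))))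
         (RAsg (v 2) (NConst 0) (RPlus (RArr (v 2) (NConst 0)) (RArr (v 1) (scalar (v 7)))))))
       (4 + n * (d + 5)) (\<lambda>s'. K n s' \<and> reals s' (v 2) 0 = reals s (v 2) 0 + (\<Sum>t<n. c t)) s'"
    proof (rule wp_straight_Seq[where u = "3 + n * (d + 5)"], simp, rule wp_SeqI[OF loop2, where u = 1])
      fix s'' assume "I s'' \<and> K n s''"
      then show "wp dst (RAsg (v 2) (NConst 0) (RPlus (RArr (v 2) (NConst 0)) (RArr (v 1) (scalar (v 7))))) 1
 (\<lambda>s'. K n s' \<and> reals s' (v 2) 0 = reals s (v 2) 0 + (\<Sum>t<n. c t)) s''"
        by (intro wp_straight) (auto simp: K_def)
    qed (use s' in \<open>auto simp: I0_def K_def J_def\<close>)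
  qed simp
  then show ?thesis
  proof (rule wp_mono)
    fix s' assume "K n s' \<and> reals s' (v 2) 0 = reals s (v 2) 0 + (\<Sum>t<n. c t)"
    then show "\<exists>f. bij_betw f {..<n} {..<n} \<and>
    (\<forall>t<n. q (f t) = q (n + t)) \<and>
    (\<forall>t<n. nats s' (v 5) (j * n + t) = f t) \<and>
    (\<forall>x. x \<notin> {j * n..<j * n + n} \<longrightarrow> nats s' (v 5) x = nats s (v 5) x) \<and>
    (\<forall>k. k \<noteq> j \<longrightarrow> reals s' (v 1) k = reals s (v 1) k) \<and>
    reals s' (v 1) j = (\<Sum>t<n. dst (pt (j * n + t)) (pt (i * n + f t))) \<and>
    reals s' (v 2) 0 = reals s (v 2) 0 + (\<Sum>t<n. dst (pt (j * n + t)) (pt (i * n + f t)))"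
      using f qf by (intro exI[of _ f]) (simp add: K_def c_def)
  qed simp
qed

text \<open>Going through the center that \<open>P\<close> gave to the common cluster bounds the
  matching by the two-color cost, each point being charged once. Any \<open>B\<close> is a feasible
  center set for the two classes, so this cost is at most \<beta> times their distances to
  \<open>B\<close>.\<close>

lemma match_cost_le:
  assumes ap: "approx_fair_median dst \<beta> 2 n (pair_points i j) (half_coloring n) q B'"
    and f: "bij_betw f {..<n} {..<n}" and qf: "\<And>t. t < n \<Longrightarrow> q (f t) = q (n + t)"
    and B: "B \<in> carrier_mat n d"
  shows "(\<Sum>t<n. dst (pt (j * n + t)) (pt (i * n + f t))) \<le> \<beta> * (color_EMD i B + color_EMD j B)"
proof -
  let ?A = "pair_points i j"
  have B': "B' \<in> carrier_mat n d"
    and cost: "clustering_cost dst 2 n ?A q B' \<le> \<beta> * fair_median_opt dst 2 n ?A (half_coloring n)"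
    using ap pair_points_carrier[of i j] by (auto simp: approx_fair_median_def)
  have rowB: "row B' x \<in> carrier_vec d" for x using B' by (auto intro!: carrier_vecI)
  have bij: "bij_betw (\<lambda>t. n + t) {..<n} {n..<2 * n}"
    by (rule bij_betwI[where g = "\<lambda>x. x - n"]) auto
  have "(\<Sum>t<n. dst (pt (j * n + t)) (pt (i * n + f t)))
      \<le> (\<Sum>t<n. dst (pt (j * n + t)) (row B' (q (n + t))) + dst (pt (i * n + f t)) (row B' (q (f t))))"
  proof (rule sum_mono)
    fix t assume "t \<in> {..<n}"
    then show "dst (pt (j * n + t)) (pt (i * n + f t))
        \<le> dst (pt (j * n + t)) (row B' (q (n + t))) + dst (pt (i * n + f t)) (row B' (q (f t)))"
      using dst_triangle[OF d pt_carrier[of "j * n + t"] rowB[of "q (n + t)"] pt_carrier[of "i * n + f t"]]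
        qf[of t] dst_commute[of "pt (i * n + f t)"] by simp
  qed
  also have "\<dots> = (\<Sum>t<n. dst (pt (j * n + t)) (row B' (q (n + t)))) + (\<Sum>t<n. dst (pt (i * n + t)) (row B' (q t)))"
    unfolding sum.distrib using sum.reindex_bij_betw[OF f, of "\<lambda>t. dst (pt (i * n + t)) (row B' (q t))"] by simp
  also have "\<dots> = clustering_cost dst 2 n ?A q B'"
  proof -
    have "clustering_cost dst 2 n ?A q B'
        = (\<Sum>x<n. dst (row ?A x) (row B' (q x))) + (\<Sum>x = n..<2 * n. dst (row ?A x) (row B' (q x)))"
      unfolding clustering_cost_def
      by (subst sum.union_disjoint[symmetric]) (auto intro!: sum.cong)
    moreover have "(\<Sum>x = n..<2 * n. dst (row ?A x) (row B' (q x)))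
        = (\<Sum>t<n. dst (row ?A (n + t)) (row B' (q (n + t))))"
      by (rule sum.reindex_bij_betw[OF bij, symmetric])
    ultimately show ?thesis by (simp add: row_pair_points)
  qed
  also have "\<dots> \<le> \<beta> * fair_median_cost dst 2 n ?A (half_coloring n) B"
    using fair_median_opt_le[OF balanced_half, of B n ?A] B pair_points_carrier[of i j] \<beta>_pos
    by (intro order_trans[OF cost] mult_left_mono) auto
  also have "\<dots> \<le> \<beta> * (color_EMD i B + color_EMD j B)"
  proof (rule mult_left_mono)
    have "EMD dst {..<n} (row ?A) {..<n} (row B) \<le> color_EMD i B"
      unfolding color_EMD_def
      by (rule EMD_reindex_le[where f = "\<lambda>x. x"]) (auto simp: row_pair_points bij_betw_def)
    moreover have "EMD dst {n..<2 * n} (row ?A) {..<n} (row B) \<le> color_EMD j B"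
      unfolding color_EMD_def
    proof (rule EMD_reindex_le[where f = "\<lambda>x. x - n"])
      show "bij_betw (\<lambda>x. x - n) {n..<2 * n} {..<n}"
        by (rule bij_betwI[where g = "\<lambda>x. x + n"]) auto
      show "row ?A x = pt (j * n + (x - n))" if "x \<in> {n..<2 * n}" for x
        using that row_pair_points(2)[of "x - n"] by auto
    qed auto
    ultimately show "fair_median_cost dst 2 n ?A (half_coloring n) B \<le> color_EMD i B + color_EMD j B"
      using color_class_half[of n]
      by (simp add: fair_median_cost_def numeral_2_eq_2)
  qed (use \<beta>_pos in simp)
  finally show ?thesis .
qed

text \<open>The bound is recorded for all \<open>B\<close> at once, because no near-optimal
  \<open>B\<close> has been fixed when the program runs.\<close>

definition block :: "nat \<Rightarrow> nat \<Rightarrow> state \<Rightarrow> bool" where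
  "block i j s \<longleftrightarrow> bij_betw (\<lambda>t. nats s (v 5) (j * n + t)) {..<n} {..<n} \<and>
     reals s (v 1) j = (\<Sum>t<n. dst (pt (j * n + t)) (pt (i * n + nats s (v 5) (j * n + t)))) \<and>
     (\<forall>B \<in> carrier_mat n d. reals s (v 1) j \<le> \<beta> * (color_EMD i B + color_EMD j B))"

lemma block_set [simp]:
  "x \<noteq> v 5 \<Longrightarrow> block i j (set_nat x k y s) \<longleftrightarrow> block i j s"
  "x \<noteq> v 1 \<Longrightarrow> block i j (set_real x k z s) \<longleftrightarrow> block i j s"
  by (simp_all add: block_def)

lemma wp_star:
  assumes s: "ctx s" "nats s (v 10) 0 = i"
  shows "wp dst star (40 * (l * \<tau>))
    (\<lambda>s'. (\<forall>j<l. block i j s') \<and> reals s' (v 2) 0 = (\<Sum>j<l. reals s' (v 1) j)) s"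
proof -
  define I where "I = (\<lambda>m s'. ctx s' \<and> nats s' (v 10) 0 = i \<and> (\<forall>j<m. block i j s') \<and>
    reals s' (v 2) 0 = (\<Sum>j<m. reals s' (v 1) j))"
  have body: "wp dst (Seq load_pair (Seq P collect_pair)) (35 * \<tau>)
      (\<lambda>s'. I (Suc j) (set_nat (v 7) 0 (Suc j) s')) s'"
    if s': "I j s'" "nats s' (v 7) 0 = j" for j s'
  proof (rule wp_SeqI[OF wp_load_pair, where u = "13 * \<tau> + 7"])
    fix s1 assume inp: "holds_input s1 2 n d (pair_points i j) (half_coloring n)"
      and fr1: "frame load_pair s' s1"
    show "wp dst (Seq P collect_pair) (13 * \<tau> + 7) (\<lambda>s'. I (Suc j) (set_nat (v 7) 0 (Suc j) s')) s1"
    proof (rule wp_SeqI[OF wp_algorithm[OF n d pair_points_carrier balanced_half inp],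
          where u = "6 + 3 * n + n * (d + 5)"])
      fix s2 assume ap: "approx_fair_median dst \<beta> 2 n (pair_points i j) (half_coloring n)
          (output_clusters s2) (output_centers s2 n d)" and fr2: "frame P s1 s2"
      \<comment> \<open>Working memory survives the call of \<open>P\<close> because its array names
        are not written by \<open>P\<close>.\<close>
      have same: "nats s2 (v k) = nats s' (v k)" if "k \<noteq> 8" for k
        using fr1 fr2 that by (simp add: frame_def nwrites_load_pair)
      have same': "reals s2 (v k) = reals s' (v k)" for k
        using fr1 fr2 by (simp add: frame_def rwrites_load_pair)
      have "ctx s'" using s' by (simp add: I_def)
      then have "ctx s1" by (rule ctx_frame[OF _ fr1]) (simp_all add: nwrites_load_pair rwrites_load_pair)
      then have ctx2: "ctx s2" by (rule ctx_frame[OF _ fr2]) simp_all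
      have fair: "fair_clustering 2 n (half_coloring n) (output_clusters s2)"
        using ap by (simp add: approx_fair_median_def)
      show "wp dst collect_pair (6 + 3 * n + n * (d + 5)) (\<lambda>s'. I (Suc j) (set_nat (v 7) 0 (Suc j) s')) s2"
      proof (rule wp_mono[OF wp_collect_pair[where i = i and j = j, OF ctx2 _ _ output_clusters_def fair]], goal_cases)
        case (4 s3)
        from 4(1) obtain f where f: "bij_betw f {..<n} {..<n}"
          "\<forall>t<n. output_clusters s2 (f t) = output_clusters s2 (n + t)"
          "\<forall>t<n. nats s3 (v 5) (j * n + t) = f t"
          "\<forall>x. x \<notin> {j * n..<j * n + n} \<longrightarrow> nats s3 (v 5) x = nats s2 (v 5) x"
          "\<forall>k. k \<noteq> j \<longrightarrow> reals s3 (v 1) k = reals s2 (v 1) k"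
          "reals s3 (v 1) j = (\<Sum>t<n. dst (pt (j * n + t)) (pt (i * n + f t)))"
          "reals s3 (v 2) 0 = reals s2 (v 2) 0 + (\<Sum>t<n. dst (pt (j * n + t)) (pt (i * n + f t)))"
          by blast
        have ctx3: "ctx s3"
          by (rule ctx_frame[OF ctx2 4(2)]) (simp_all add: nwrites_collect_pair rwrites_collect_pair)
        have i3: "nats s3 (v 10) 0 = i"
          using 4(2) s' same by (simp add: frame_def nwrites_collect_pair I_def)
        \<comment> \<open>The entries of block \<open>k\<close> lie below \<open>j * n\<close>,
          before the stretch of \<open>v 5\<close> written in this iteration.\<close>
        have "block i k s3" if "k < j" for k
        proof -
          have "k * n + t \<notin> {j * n..<j * n + n}" if "t < n" for t
          proof -
            have "Suc k * n \<le> j * n" using \<open>k < j\<close> by (intro mult_le_mono1) simp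
            then show ?thesis using that by simp
          qed
          then have eq: "nats s3 (v 5) (k * n + t) = nats s' (v 5) (k * n + t)" if "t < n" for t
            using f(4) same that by simp
          have "block i k s'" using s' that by (simp add: I_def)
          moreover have "bij_betw (\<lambda>t. nats s3 (v 5) (k * n + t)) {..<n} {..<n} \<longleftrightarrow>
             bij_betw (\<lambda>t. nats s' (v 5) (k * n + t)) {..<n} {..<n}"
            by (rule bij_betw_cong) (simp add: eq)
          moreover have "reals s3 (v 1) k = reals s' (v 1) k" using f(5) that same' by simp
          ultimately show ?thesis unfolding block_def by (auto simp: eq)
        qed
        moreover have "block i j s3"
          unfolding block_def
        proof (intro conjI ballI)
          show "bij_betw (\<lambda>t. nats s3 (v 5) (j * n + t)) {..<n} {..<n}"
            by (rule iffD1[OF bij_betw_cong f(1)]) (use f(3) in simp)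
          show "reals s3 (v 1) j \<le> \<beta> * (color_EMD i B + color_EMD j B)" if "B \<in> carrier_mat n d" for B
            using match_cost_le[OF ap f(1) _ that] f(2,6) by simp
        qed (use f(3,6) in simp)
        ultimately have "\<forall>k<Suc j. block i k s3" by (simp add: less_Suc_eq)
        moreover have "reals s3 (v 2) 0 = (\<Sum>k<Suc j. reals s3 (v 1) k)"
          using s' f(5-7) same' by (simp add: I_def)
        ultimately show ?case using ctx3 i3 by (simp add: I_def)
      qed (use s' same in \<open>auto simp: I_def\<close>)
    next
      show "\<tau> + (6 + 3 * n + n * (d + 5)) \<le> 13 * \<tau> + 7"
        using n_le nd_le one_le by (simp add: add_mult_distrib2)
    qed
  next
    \<comment> \<open>With 1, \<open>n\<close> and \<open>n * d\<close> all at most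
      \<open>\<tau>\<close>, the coefficients add up to exactly 35.\<close>
    show "7 + 4 * (n * d) + 4 * n + (13 * \<tau> + 7) \<le> 35 * \<tau>"
      using n_le nd_le one_le by simp
  qed (use s' in \<open>auto simp: I_def\<close>)
  have loop: "wp dst (for_loop (v 7) (scalar (v 0)) (Seq load_pair (Seq P collect_pair)))
      (2 + l * (35 * \<tau> + 2)) (I l) s'" if "I 0 s'" for s'
    by (rule wp_for_loop[where I = I and b = l and \<tau> = "35 * \<tau>"])
      (use that body in \<open>auto simp: I_def nwrites_load_pair nwrites_collect_pair\<close>)
  have t: "1 + (2 + l * (35 * \<tau> + 2)) \<le> 40 * (l * \<tau>)"
  proof -
    have "l * (35 * \<tau> + 2) = 35 * (l * \<tau>) + 2 * l" by (simp add: algebra_simps)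
    then show ?thesis using l_le l by linarith
  qed
  have "wp dst star (40 * (l * \<tau>)) (I l) s"
    unfolding star_def
    by (rule wp_straight_Seq[where u = "2 + l * (35 * \<tau> + 2)"], simp, rule loop)
      (use s t in \<open>auto simp: I_def\<close>)
  then show ?thesis by (rule wp_mono) (auto simp: I_def)
qed

end

section \<open>One round of sampling\<close>

lemma wp_If:
  assumes "bval b s \<Longrightarrow> wp dst C t Q s" "\<not> bval b s \<Longrightarrow> wp dst D t Q s"
  shows "wp dst (If b C D) (1 + t) Q s"
proof (cases "bval b s")
  case True
  from assms(1)[OF True] obtain s' u
    where "big_step dst C s (return_pmf (s', u))" "u \<le> t" "Q s'" unfolding wp_def by blast
  with big_step.IfTrue[OF True this(1), of D] show ?thesis unfolding wp_def by fastforce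
next
  case False
  from assms(2)[OF False] obtain s' u
    where "big_step dst D s (return_pmf (s', u))" "u \<le> t" "Q s'" unfolding wp_def by blast
  with big_step.IfFalse[OF False this(1), of C] show ?thesis unfolding wp_def by fastforce
qed

context fresh_names
begin

definition save :: com where
  "save = Seq (RAsg (v 3) (NConst 0) (RArr (v 2) (NConst 0)))
    (Seq (NAsg (v 12) (NConst 0) (scalar (v 10)))
         (for_loop (v 8) (NTimes (scalar (v 0)) (scalar (v 1)))
            (NAsg (v 6) (scalar (v 8)) (NArr (v 5) (scalar (v 8))))))"

definition attempt :: com where
  "attempt = Seq star (If (RLess (RArr (v 2) (NConst 0)) (RArr (v 3) (NConst 0))) save Skip)"

text \<open>
  Selects the color \<open>j\<close> whose sampling weight, the positive part of the average cost minus the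
  cost of \<open>j\<close>, covers the fraction \<open>v 13 / (4 * l)\<close> of the total weight.
\<close>

definition select :: com where
  "select = Seq (RAsg (v 6) (NConst 0) (OfNat (NConst 0)))
    (Seq (for_loop (v 7) (scalar (v 0))
       (Seq (RAsg (v 5) (scalar (v 7)) (RArr (v 6) (NConst 0)))
       (Seq (RAsg (v 4) (NConst 0)
               (RMinus (RDiv (RArr (v 2) (NConst 0)) (OfNat (scalar (v 0)))) (RArr (v 1) (scalar (v 7)))))
            (If (RLess (OfNat (NConst 0)) (RArr (v 4) (NConst 0)))
               (RAsg (v 6) (NConst 0) (RPlus (RArr (v 6) (NConst 0)) (RArr (v 4) (NConst 0)))) Skip))))
    (Seq (NAsg (v 10) (NConst 0) (NConst 0))
         (for_loop (v 7) (scalar (v 0))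
            (If (RLess (RTimes (OfNat (scalar (v 13))) (RArr (v 6) (NConst 0)))
                   (RTimes (RArr (v 5) (scalar (v 7))) (OfNat (NTimes (NConst 4) (scalar (v 0))))))
               Skip (NAsg (v 10) (NConst 0) (scalar (v 7)))))))"

definition second_attempt :: com where
  "second_attempt = Seq (Rand (v 13) (NConst 0) (NMinus (NTimes (NConst 4) (scalar (v 0))) (NConst 1)))
     (Seq select attempt)"

definition sampling_round :: com where
  "sampling_round = Seq (Rand (v 10) (NConst 0) (NMinus (scalar (v 0)) (NConst 1)))
     (Seq attempt second_attempt)"

lemma nwrites_save: "nwrites save = {v 6, v 8, v 12}"
  and rwrites_save: "rwrites save = {v 3}"
  and nwrites_select: "nwrites select = {v 7, v 10}"
  and rwrites_select: "rwrites select = {v 4, v 5, v 6}"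
  by (auto simp: save_def select_def)

end

context sorted_instance
begin

definition current :: "nat \<Rightarrow> state \<Rightarrow> bool" where
  "current i s \<longleftrightarrow> i < l \<and> nats s (v 10) 0 = i \<and> (\<forall>j<l. block i j s) \<and>
     reals s (v 2) 0 = (\<Sum>j<l. reals s (v 1) j)"

text \<open>Only asserts that a genuine clustering is stored together with its exact cost; how good
  this cost is gets tracked separately as a bound on \<open>v 3\<close>.\<close>

definition best :: "state \<Rightarrow> bool" where
  "best s \<longleftrightarrow> nats s (v 12) 0 < l \<and>
     (\<forall>j<l. bij_betw (\<lambda>t. nats s (v 6) (j * n + t)) {..<n} {..<n}) \<and>
     reals s (v 3) 0 = (\<Sum>j<l. \<Sum>t<n. dst (pt (j * n + t))
       (pt (nats s (v 12) 0 * n + nats s (v 6) (j * n + t))))"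

lemma best_frame:
  "best s \<Longrightarrow> frame C s s' \<Longrightarrow> v 6 \<notin> nwrites C \<Longrightarrow> v 12 \<notin> nwrites C \<Longrightarrow> v 3 \<notin> rwrites C \<Longrightarrow> best s'"
  unfolding best_def frame_def by simp

lemma wp_save:
  assumes s: "ctx s" "current i s"
  shows "wp dst save (4 + 3 * (l * n)) (\<lambda>s'. best s' \<and> reals s' (v 3) 0 = reals s (v 2) 0) s"
proof -
  define q where "q = nats s (v 5)"
  define C where "C = reals s (v 2) 0"
  define I where "I = (\<lambda>m (s' :: state). ctx s' \<and> nats s' (v 5) = q \<and> nats s' (v 12) 0 = i \<and>
    reals s' (v 3) 0 = C \<and> (\<forall>x<m. nats s' (v 6) x = q x))"
  have loop: "wp dst (for_loop (v 8) (NTimes (scalar (v 0)) (scalar (v 1)))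
       (NAsg (v 6) (scalar (v 8)) (NArr (v 5) (scalar (v 8))))) (2 + 3 * (l * n)) (I (l * n)) s'"
    if "I 0 s'" for s'
  proof (rule wp_for_loop[where I = I and b = "l * n" and \<tau> = 1])
    fix m s' assume "I m s'" "m < l * n" "nats s' (v 8) 0 = m"
    then show "wp dst (NAsg (v 6) (scalar (v 8)) (NArr (v 5) (scalar (v 8)))) 1
        (\<lambda>s'. I (Suc m) (set_nat (v 8) 0 (Suc m) s')) s'"
      by (intro wp_straight) (simp_all add: I_def All_less_Suc)
  qed (use that in \<open>simp_all add: I_def\<close>)
  have "wp dst save (4 + 3 * (l * n)) (I (l * n)) s"
    unfolding save_def
    by (rule wp_straight_Seq[where u = "3 + 3 * (l * n)"], simp,
        rule wp_straight_Seq[where u = "2 + 3 * (l * n)"], simp, rule loop)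
      (use s in \<open>simp_all add: I_def q_def C_def current_def\<close>)
  then show ?thesis
  proof (rule wp_mono)
    fix s' assume s': "I (l * n) s'"
    have eq: "nats s' (v 6) (j * n + t) = q (j * n + t)" if "j < l" "t < n" for j t
    proof -
      have "j * n + t < Suc j * n" using that by simp
      also have "\<dots> \<le> l * n" using that by (intro mult_le_mono1) simp
      finally show ?thesis using s' by (simp add: I_def)
    qed
    have "bij_betw (\<lambda>t. nats s' (v 6) (j * n + t)) {..<n} {..<n}" if "j < l" for j
    proof (rule iffD1[OF bij_betw_cong])
      show "bij_betw (\<lambda>t. q (j * n + t)) {..<n} {..<n}"
        using s that by (simp add: current_def block_def q_def)
    qed (simp add: eq that)
    moreover have "C = (\<Sum>j<l. \<Sum>t<n. dst (pt (j * n + t)) (pt (i * n + q (j * n + t))))"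
      using s by (simp add: current_def block_def q_def C_def)
    ultimately show "best s' \<and> reals s' (v 3) 0 = reals s (v 2) 0"
      using s s' by (simp add: best_def I_def eq current_def C_def)
  qed simp
qed

text \<open>Of the two inequalities on \<open>v 3\<close>, the first lets a good current clustering
  certify the stored one, and the second makes a success permanent.\<close>

lemma wp_attempt:
  assumes s: "ctx s" "nats s (v 10) 0 = i" "i < l" "best s"
  shows "wp dst attempt (50 * (l * \<tau>)) (\<lambda>s'. ctx s' \<and> best s' \<and> current i s' \<and>
    reals s' (v 3) 0 \<le> reals s' (v 2) 0 \<and> reals s' (v 3) 0 \<le> reals s (v 3) 0) s"
  unfolding attempt_def
proof (rule wp_SeqI[OF wp_star[OF s(1,2)], where u = "1 + (4 + 3 * (l * n))"])
  fix s1 assume "(\<forall>j<l. block i j s1) \<and> reals s1 (v 2) 0 = (\<Sum>j<l. reals s1 (v 1) j)"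
    and fr: "frame star s s1"
  have ctx1: "ctx s1"
    by (rule ctx_frame[OF s(1) fr]) (auto simp: nwrites_star rwrites_star)
  have best1: "best s1"
    by (rule best_frame[OF s(4) fr]) (simp_all add: nwrites_star rwrites_star)
  have v1: "nats s1 (v 10) = nats s (v 10)" "reals s1 (v 3) = reals s (v 3)"
    using fr by (simp_all add: frame_def nwrites_star rwrites_star)
  then have cur1: "current i s1" using s \<open>_ \<and> reals s1 (v 2) 0 = _\<close> by (simp add: current_def)
  show "wp dst (If (RLess (RArr (v 2) (NConst 0)) (RArr (v 3) (NConst 0))) save Skip) (1 + (4 + 3 * (l * n)))
    (\<lambda>s'. ctx s' \<and> best s' \<and> current i s' \<and>
    reals s' (v 3) 0 \<le> reals s' (v 2) 0 \<and> reals s' (v 3) 0 \<le> reals s (v 3) 0) s1"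
  proof (rule wp_If)
    assume less: "bval (RLess (RArr (v 2) (NConst 0)) (RArr (v 3) (NConst 0))) s1"
    show "wp dst save (4 + 3 * (l * n)) (\<lambda>s'. ctx s' \<and> best s' \<and> current i s' \<and>
      reals s' (v 3) 0 \<le> reals s' (v 2) 0 \<and> reals s' (v 3) 0 \<le> reals s (v 3) 0) s1"
    proof (rule wp_mono[OF wp_save[OF ctx1 cur1]])
      fix s' assume s': "best s' \<and> reals s' (v 3) 0 = reals s1 (v 2) 0" and fr': "frame save s1 s'"
      have ctx': "ctx s'" by (rule ctx_frame[OF ctx1 fr']) (simp_all add: nwrites_save rwrites_save)
      have same: "nats s' (v 10) = nats s1 (v 10)" "nats s' (v 5) = nats s1 (v 5)"
        "reals s' (v 1) = reals s1 (v 1)" "reals s' (v 2) = reals s1 (v 2)"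
        using fr' by (simp_all add: frame_def nwrites_save rwrites_save)
      have "current i s'" using cur1 unfolding current_def block_def same .
      then show "ctx s' \<and> best s' \<and> current i s' \<and>
      reals s' (v 3) 0 \<le> reals s' (v 2) 0 \<and> reals s' (v 3) 0 \<le> reals s (v 3) 0"
        using ctx' s' less same v1 by simp
    qed simp
  next
    assume "\<not> bval (RLess (RArr (v 2) (NConst 0)) (RArr (v 3) (NConst 0))) s1"
    then show "wp dst Skip (4 + 3 * (l * n)) (\<lambda>s'. ctx s' \<and> best s' \<and> current i s' \<and>
      reals s' (v 3) 0 \<le> reals s' (v 2) 0 \<and> reals s' (v 3) 0 \<le> reals s (v 3) 0) s1"
      using ctx1 best1 cur1 v1 by (intro wp_straight) simp_all
  qed
next
  have "l * n \<le> l * \<tau>" by (rule mult_le_mono2[OF n_le])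
  then show "40 * (l * \<tau>) + (1 + (4 + 3 * (l * n))) \<le> 50 * (l * \<tau>)"
    using l_le l by linarith
qed

text \<open>Cross-multiplication makes \<open>S l = 0\<close> harmless: then no \<open>j\<close>
  meets the premise, and the selected color is still below \<open>l\<close>.\<close>

lemma wp_select:
  fixes S :: "nat \<Rightarrow> real"
  assumes s: "ctx s"
    and S: "S = (\<lambda>m. \<Sum>j<m. max 0 (reals s (v 2) 0 / l - reals s (v 1) j))"
    and k: "nats s (v 13) 0 = k"
  shows "wp dst select (6 + 10 * l) (\<lambda>s'. nats s' (v 10) 0 < l \<and>
    (\<forall>j<l. S j * real (4 * l) \<le> k * S l \<and> k * S l < S (Suc j) * real (4 * l) \<longrightarrow> nats s' (v 10) 0 = j)) s"
proof -
  have S_mono: "S i \<le> S j" if "i \<le> j" for i j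
    unfolding S by (rule sum_mono2) (use that in auto)
  define W where "W = reals s (v 1)"
  define c where "c = reals s (v 2) 0"
  have S_Suc: "S (Suc m) = S m + max 0 (c / l - W m)" for m by (simp add: S W_def c_def)
  define I where "I = (\<lambda>m s'. ctx s' \<and> reals s' (v 1) = W \<and> reals s' (v 2) 0 = c \<and> nats s' (v 13) 0 = k \<and>
    reals s' (v 6) 0 = S m \<and> (\<forall>j<m. reals s' (v 5) j = S j))"
  define J where "J = (\<lambda>m s'. I l s' \<and> nats s' (v 10) 0 < l \<and>
    (\<forall>j<m. S j * real (4 * l) \<le> k * S l \<and> k * S l < S (Suc j) * real (4 * l) \<longrightarrow> nats s' (v 10) 0 = j))"
  have loop1: "wp dst (for_loop (v 7) (scalar (v 0))
       (Seq (RAsg (v 5) (scalar (v 7)) (RArr (v 6) (NConst 0)))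
       (Seq (RAsg (v 4) (NConst 0)
               (RMinus (RDiv (RArr (v 2) (NConst 0)) (OfNat (scalar (v 0)))) (RArr (v 1) (scalar (v 7)))))
            (If (RLess (OfNat (NConst 0)) (RArr (v 4) (NConst 0)))
               (RAsg (v 6) (NConst 0) (RPlus (RArr (v 6) (NConst 0)) (RArr (v 4) (NConst 0)))) Skip))))
     (2 + 6 * l) (I l) s'" if "I 0 s'" for s'
  proof (rule wp_for_loop[where I = I and b = l and \<tau> = 4], goal_cases)
    case (3 m s')
    then show ?case
      by (intro wp_straight) (simp_all add: I_def All_less_Suc S_Suc max_def)
  qed (use that in \<open>simp_all add: I_def\<close>)
  have loop2: "wp dst (for_loop (v 7) (scalar (v 0))
            (If (RLess (RTimes (OfNat (scalar (v 13))) (RArr (v 6) (NConst 0)))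
                   (RTimes (RArr (v 5) (scalar (v 7))) (OfNat (NTimes (NConst 4) (scalar (v 0))))))
               Skip (NAsg (v 10) (NConst 0) (scalar (v 7)))))
     (2 + 4 * l) (J l) s'" if "J 0 s'" for s'
  proof (rule wp_for_loop[where I = J and b = l and \<tau> = 2], goal_cases)
    case (3 m s')
    then have I: "I l s'" and m: "m < l" "nats s' (v 7) 0 = m" by (simp_all add: J_def)
    have simps: "nats s' (v 0) 0 = l" "nats s' (v 13) 0 = k" "reals s' (v 6) 0 = S l" "reals s' (v 5) m = S m"
      using I m by (simp_all add: I_def)
    let ?s' = "final_state dst (If (RLess (RTimes (OfNat (scalar (v 13))) (RArr (v 6) (NConst 0)))
                   (RTimes (RArr (v 5) (scalar (v 7))) (OfNat (NTimes (NConst 4) (scalar (v 0))))))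
               Skip (NAsg (v 10) (NConst 0) (scalar (v 7)))) s'"
    have s': "?s' = (if k * S l < S m * real (4 * l) then s' else set_nat (v 10) 0 m s')"
      using simps m by simp
    have "I l (set_nat (v 10) 0 m s')" using I by (simp add: I_def)
    \<comment> \<open>Candidates are overwritten in increasing order. By monotonicity of
      \<open>S\<close>, an overwrite at \<open>m\<close> shows that the threshold lies beyond the
      piece of every earlier \<open>j\<close>.\<close>
    moreover have "\<not> (S j * real (4 * l) \<le> k * S l \<and> k * S l < S (Suc j) * real (4 * l))"
      if "j < m" "\<not> k * S l < S m * real (4 * l)" for j
    proof -
      have "S (Suc j) * real (4 * l) \<le> S m * real (4 * l)"
        by (rule mult_right_mono[OF S_mono]) (use that in auto)
      then show ?thesis using that by linarith
    qed
    ultimately have "J (Suc m) ?s'"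
      using 3(1) m unfolding s' by (auto simp: J_def less_Suc_eq)
    then have "J (Suc m) (set_nat (v 7) 0 (Suc m) ?s')"
      by (simp add: J_def I_def)
    then show ?case by (intro wp_straight) simp_all
  qed (use that in \<open>simp_all add: J_def I_def\<close>)
  have "wp dst select (6 + 10 * l) (J l) s"
    unfolding select_def
  proof (rule wp_straight_Seq[where u = "5 + 10 * l"], simp, rule wp_SeqI[OF loop1, where u = "3 + 4 * l"],
      goal_cases)
    case (2 s1)
    show ?case
      by (rule wp_straight_Seq[where u = "2 + 4 * l"], simp, rule loop2)
        (use 2(1) l in \<open>simp_all add: J_def I_def\<close>)
  qed (use s k in \<open>simp_all add: I_def W_def c_def S\<close>)
  then show ?thesis by (rule wp_mono) (simp_all add: J_def)
qed

section \<open>Success probability of a round against a fixed center matrix\<close>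

context
  fixes B :: "real mat" and \<Omega> :: real and good :: "nat set"
  assumes B: "B \<in> carrier_mat n d"
  defines "\<Omega> \<equiv> \<Sum>j<l. color_EMD j B"
  defines "good \<equiv> {j. j < l \<and> l * color_EMD j B \<le> \<Omega>}"
begin

lemma current_good:
  assumes "current i s" "i \<in> good"
  shows "reals s (v 2) 0 \<le> 2 * \<beta> * \<Omega>"
proof -
  have "reals s (v 2) 0 \<le> (\<Sum>j<l. \<beta> * (color_EMD i B + color_EMD j B))"
    using assms(1) B by (auto simp: current_def block_def intro!: sum_mono)
  also have "\<dots> = \<beta> * (l * color_EMD i B + \<Omega>)"
    by (simp add: \<Omega>_def sum.distrib flip: sum_distrib_left)
  also have "\<dots> \<le> \<beta> * (2 * \<Omega>)"
    using assms(2) \<beta>_pos by (intro mult_left_mono) (auto simp: good_def)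
  finally show ?thesis by simp
qed

text \<open>A threshold in the piece of a good color leads to success by
  \<open>current_good\<close>; all others are credited with probability 0.\<close>

lemma reach_second_attempt:
  fixes S :: "nat \<Rightarrow> real"
  assumes s: "ctx s" "best s"
    and S: "S = (\<lambda>m. \<Sum>j<m. max 0 (reals s (v 2) 0 / l - reals s (v 1) j))"
  shows "reach dst second_attempt (70 * (l * \<tau>))
    (\<lambda>s'. ctx s' \<and> best s' \<and> reals s' (v 3) 0 \<le> reals s (v 3) 0)
    (card {k. k < 4 * l \<and> (\<exists>j\<in>good. S j * real (4 * l) \<le> k * S l \<and>
       k * S l < S (Suc j) * real (4 * l))} / real (4 * l))
    (\<lambda>s'. reals s' (v 3) 0 \<le> 2 * \<beta> * \<Omega>) s"
proof -
  define H where "H = (\<lambda>k. \<exists>j\<in>good. S j * real (4 * l) \<le> k * S l \<and> k * S l < S (Suc j) * real (4 * l))"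
  let ?m = "NMinus (NTimes (NConst 4) (scalar (v 0))) (NConst 1)"
  have m: "nval ?m s + 1 = 4 * l" using s l by simp
  have r: "reach dst second_attempt (1 + (6 + 10 * l + 50 * (l * \<tau>)))
    (\<lambda>s'. ctx s' \<and> best s' \<and> reals s' (v 3) 0 \<le> reals s (v 3) 0)
    ((\<Sum>k\<le>nval ?m s. of_bool (H (real k))) / (nval ?m s + 1))
    (\<lambda>s'. reals s' (v 3) 0 \<le> 2 * \<beta> * \<Omega>) s"
    unfolding second_attempt_def
  proof (rule reach_Rand)
    fix k
    define s1 where "s1 = set_nat (v 13) (nval (NConst 0) s) k s"
    have s1: "ctx s1" "best s1" "nats s1 (v 13) 0 = k" "reals s1 = reals s"
      using s by (simp_all add: s1_def best_def)
    show "reach dst (Seq select attempt) (6 + 10 * l + 50 * (l * \<tau>))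
      (\<lambda>s'. ctx s' \<and> best s' \<and> reals s' (v 3) 0 \<le> reals s (v 3) 0) (of_bool (H (real k)))
      (\<lambda>s'. reals s' (v 3) 0 \<le> 2 * \<beta> * \<Omega>) s1"
    proof (rule wp_reach_Seq, rule wp_mono[OF wp_select[OF s1(1) _ s1(3)]])
      show "S = (\<lambda>m. \<Sum>j<m. max 0 (reals s1 (v 2) 0 / l - reals s1 (v 1) j))" by (simp add: S s1)
    next
      fix s2 assume s2: "nats s2 (v 10) 0 < l \<and>
        (\<forall>j<l. S j * real (4 * l) \<le> k * S l \<and> k * S l < S (Suc j) * real (4 * l) \<longrightarrow> nats s2 (v 10) 0 = j)"
        and fr: "frame select s1 s2"
      have ctx2: "ctx s2"
        by (rule ctx_frame[OF s1(1) fr]) (simp_all add: nwrites_select rwrites_select)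
      have best2: "best s2"
        by (rule best_frame[OF s1(2) fr]) (simp_all add: nwrites_select rwrites_select)
      have v3: "reals s2 (v 3) = reals s (v 3)"
        using fr s1 by (simp add: frame_def rwrites_select)
      have sel: "nats s2 (v 10) 0 \<in> good" if "H (real k)"
        using that s2 unfolding H_def good_def by blast
      have *: "wp dst attempt (50 * (l * \<tau>)) (\<lambda>s'. (ctx s' \<and> best s' \<and> reals s' (v 3) 0 \<le> reals s (v 3) 0) \<and>
          (H (real k) \<longrightarrow> reals s' (v 3) 0 \<le> 2 * \<beta> * \<Omega>)) s2"
      proof (rule wp_mono[OF wp_attempt[OF ctx2 refl _ best2]])
        fix s3 assume s3: "ctx s3 \<and> best s3 \<and> current (nats s2 (v 10) 0) s3 \<and>
          reals s3 (v 3) 0 \<le> reals s3 (v 2) 0 \<and> reals s3 (v 3) 0 \<le> reals s2 (v 3) 0"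
        have "reals s3 (v 2) 0 \<le> 2 * \<beta> * \<Omega>" if "H (real k)"
          using current_good sel[OF that] s3 by blast
        with s3 show "(ctx s3 \<and> best s3 \<and> reals s3 (v 3) 0 \<le> reals s (v 3) 0) \<and>
          (H (real k) \<longrightarrow> reals s3 (v 3) 0 \<le> 2 * \<beta> * \<Omega>)"
          unfolding v3 by linarith
      qed (use s2 in simp_all)
      show "reach dst attempt (50 * (l * \<tau>))
          (\<lambda>s'. ctx s' \<and> best s' \<and> reals s' (v 3) 0 \<le> reals s (v 3) 0) (of_bool (H (real k)))
          (\<lambda>s'. reals s' (v 3) 0 \<le> 2 * \<beta> * \<Omega>) s2"
      proof (cases "H (real k)")
        case True
        then show ?thesis
          by (intro reach_mono[OF reach_sure[OF wp_imp_reach[OF *]]]) auto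
      next
        case False
        then show ?thesis by (intro reach_mono[OF wp_imp_reach[OF *]]) auto
      qed
    qed simp
  qed simp_all
  have sum: "(\<Sum>k\<le>nval ?m s. of_bool (H (real k)) :: real) = card {k. k < 4 * l \<and> H (real k)}"
  proof -
    have "{..nval ?m s} = {..<4 * l}" using s l by auto
    then show ?thesis by (simp add: sum.If_cases of_bool_def Collect_conj_eq lessThan_def)
  qed
  have t: "1 + (6 + 10 * l + 50 * (l * \<tau>)) \<le> 70 * (l * \<tau>)" using l_le l by linarith
  show ?thesis
    by (rule reach_mono[OF r[unfolded sum m] t]) (simp_all add: H_def)
qed

text \<open>If at least a quarter of the colors are good, the first attempt alone succeeds with
  probability 1/4. Otherwise a first color in \<open>I\<close> either suffices itself or yields
  weights for which the second attempt succeeds with probability at least 1/8.\<close>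

lemma reach_sampling_round:
  assumes s: "ctx s" "best s"
  shows "reach dst sampling_round (130 * (l * \<tau>))
    (\<lambda>s'. (ctx s' \<and> best s') \<and> (reals s (v 3) 0 \<le> 2 * \<beta> * \<Omega> \<longrightarrow> reals s' (v 3) 0 \<le> 2 * \<beta> * \<Omega>))
    (1 / 16) (\<lambda>s'. reals s' (v 3) 0 \<le> 2 * \<beta> * \<Omega>) s"
proof -
  define R where "R = (\<lambda>s'. ctx s' \<and> best s' \<and> reals s' (v 3) 0 \<le> reals s (v 3) 0)"
  define G where "G = (\<lambda>s' :: state. reals s' (v 3) 0 \<le> 2 * \<beta> * \<Omega>)"
  let ?m = "NMinus (scalar (v 0)) (NConst 1)"
  have m: "nval ?m s + 1 = l" using s l by simp
  have set_m: "{..nval ?m s} = {..<l}" using s l by auto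
  \<comment> \<open>Splits off the first draw; first colors outside \<open>I\<close> are credited
    with success probability 0.\<close>
  have main: "reach dst sampling_round (130 * (l * \<tau>)) R (c * card I / l) G s"
    if c: "0 \<le> c" "c \<le> 1" and I: "I \<subseteq> {..<l}"
      and *: "\<And>i s1. i \<in> I \<Longrightarrow> ctx s1 \<Longrightarrow> best s1 \<Longrightarrow> current i s1 \<Longrightarrow> reals s1 (v 3) 0 \<le> reals s1 (v 2) 0 \<Longrightarrow>
        reals s1 (v 3) 0 \<le> reals s (v 3) 0 \<Longrightarrow> reach dst second_attempt (70 * (l * \<tau>)) R c G s1"
    for c :: real and I
  proof -
    have r: "reach dst sampling_round (1 + (50 * (l * \<tau>) + 70 * (l * \<tau>))) R
      ((\<Sum>i\<le>nval ?m s. if i \<in> I then c else 0) / (nval ?m s + 1)) G s"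
      unfolding sampling_round_def
    proof (rule reach_Rand)
      fix i assume i: "i \<le> nval ?m s"
      define s0 where "s0 = set_nat (v 10) (nval (NConst 0) s) i s"
      have s0: "ctx s0" "best s0" "nats s0 (v 10) 0 = i" "reals s0 = reals s"
        using s by (simp_all add: s0_def best_def)
      have il: "i < l" using i m by linarith
      show "reach dst (Seq attempt second_attempt) (50 * (l * \<tau>) + 70 * (l * \<tau>)) R (if i \<in> I then c else 0) G s0"
      proof (rule wp_reach_Seq, rule wp_mono[OF wp_attempt[OF s0(1,3) il s0(2)]])
        fix s1 assume s1: "ctx s1 \<and> best s1 \<and> current i s1 \<and>
          reals s1 (v 3) 0 \<le> reals s1 (v 2) 0 \<and> reals s1 (v 3) 0 \<le> reals s0 (v 3) 0"
        show "reach dst second_attempt (70 * (l * \<tau>)) R (if i \<in> I then c else 0) G s1"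
        proof (cases "i \<in> I")
          case True
          then show ?thesis using *[OF True] s1 s0 by simp
        next
          case False
          have "reach dst second_attempt (70 * (l * \<tau>)) R 0 G s1"
            unfolding G_def
            by (rule reach_mono[OF reach_second_attempt[OF _ _ refl]]) (use s1 s0 in \<open>auto simp: R_def\<close>)
          then show ?thesis using False by simp
        qed
      qed simp
    qed (use c in auto)
    have sum: "(\<Sum>i\<le>nval ?m s. if i \<in> I then c else 0) = c * card I"
      unfolding set_m using I by (simp add: sum.If_cases Int_absorb1)
    have t: "1 + (50 * (l * \<tau>) + 70 * (l * \<tau>)) \<le> 130 * (l * \<tau>)" using l_le l by linarith
    show ?thesis by (rule reach_mono[OF r[unfolded sum m] t]) simp_all
  qed
  \<comment> \<open>A bound reached by the first attempt survives the second, since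
    \<open>v 3\<close> never increases.\<close>
  have R_mono: "reach dst second_attempt (70 * (l * \<tau>)) R 1 G s1"
    if "ctx s1" "best s1" "reals s1 (v 3) 0 \<le> reals s (v 3) 0" "G s1" for s1
    by (rule reach_mono[OF reach_sure[OF reach_second_attempt[OF that(1,2) refl], where G' = G]])
      (use that in \<open>auto simp: R_def G_def\<close>)
  have "reach dst sampling_round (130 * (l * \<tau>)) R (1 / 16) G s"
  proof (cases "l \<le> 4 * card good")
    case True
    have "reach dst sampling_round (130 * (l * \<tau>)) R (1 * real (card good) / l) G s"
    proof (rule main)
      fix i s1 assume "i \<in> good" "ctx s1" "best s1" "current i s1" "reals s1 (v 3) 0 \<le> reals s1 (v 2) 0"
        "reals s1 (v 3) 0 \<le> reals s (v 3) 0"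
      then show "reach dst second_attempt (70 * (l * \<tau>)) R 1 G s1"
        using current_good by (intro R_mono) (force simp: G_def)+
    qed (auto simp: good_def)
    moreover have "real l \<le> 4 * real (card good)" using True by linarith
    ultimately show ?thesis by - (erule reach_mono, use l in \<open>simp_all add: field_simps\<close>)
  next
    case False
    then obtain I where I: "I \<subseteq> {..<l}" "l \<le> 2 * card I"
      and sampling: "\<And>i (W :: nat \<Rightarrow> real) (S :: nat \<Rightarrow> real). i \<in> I \<Longrightarrow>
        \<forall>j<l. W j \<le> \<beta> * (color_EMD i B + color_EMD j B) \<Longrightarrow>
        S = (\<lambda>m. \<Sum>j<m. max 0 ((\<Sum>j<l. W j) / l - W j)) \<Longrightarrow>
        (\<Sum>j<l. W j) \<le> 2 * \<beta> * \<Omega> \<or>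
        l \<le> 2 * card {k. k < 4 * l \<and>
          (\<exists>j\<in>good. S j * real (4 * l) \<le> k * S l \<and> k * S l < S (Suc j) * real (4 * l))}"
      using good_color_sampling[OF l \<beta>_pos, of "\<lambda>j. color_EMD j B"] unfolding good_def \<Omega>_def by blast
    have "reach dst sampling_round (130 * (l * \<tau>)) R (1 / 8 * card I / l) G s"
    proof (rule main[OF _ _ I(1)])
      fix i s1 assume i: "i \<in> I" and s1: "ctx s1" "best s1" "current i s1"
        "reals s1 (v 3) 0 \<le> reals s1 (v 2) 0" "reals s1 (v 3) 0 \<le> reals s (v 3) 0"
      define S where "S = (\<lambda>m. \<Sum>j<m. max 0 (reals s1 (v 2) 0 / l - reals s1 (v 1) j))"
      have cost: "reals s1 (v 2) 0 = (\<Sum>j<l. reals s1 (v 1) j)" using s1 by (simp add: current_def)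
      have "\<forall>j<l. reals s1 (v 1) j \<le> \<beta> * (color_EMD i B + color_EMD j B)"
        using s1(3) B unfolding current_def block_def by blast
      from sampling[OF i this, of S] consider "G s1"
        | "l \<le> 2 * card {k. k < 4 * l \<and>
          (\<exists>j\<in>good. S j * real (4 * l) \<le> k * S l \<and> k * S l < S (Suc j) * real (4 * l))}"
        using s1(4) unfolding S_def cost G_def by fastforce
      then show "reach dst second_attempt (70 * (l * \<tau>)) R (1 / 8) G s1"
      proof cases
        case 1
        from R_mono[OF s1(1,2,5) 1] show ?thesis by (rule reach_mono) auto
      next
        case 2
        then have "real l \<le> 2 * real (card {k. k < 4 * l \<and>
          (\<exists>j\<in>good. S j * real (4 * l) \<le> k * S l \<and> k * S l < S (Suc j) * real (4 * l))})"
          by linarith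
        then have "1 / 8 \<le> card {k. k < 4 * l \<and>
          (\<exists>j\<in>good. S j * real (4 * l) \<le> k * S l \<and> k * S l < S (Suc j) * real (4 * l))} / real (4 * l)"
          using l by (simp add: field_simps)
        then show ?thesis unfolding G_def
          by (intro reach_mono[OF reach_second_attempt[OF s1(1,2) S_def]]) (use s1(5) in \<open>simp_all add: R_def\<close>)
      qed
    qed simp_all
    moreover have "real l \<le> 2 * real (card I)" using I(2) by linarith
    ultimately show ?thesis by - (erule reach_mono, use l in \<open>simp_all add: field_simps\<close>)
  qed
  then show ?thesis unfolding G_def by (rule reach_mono) (auto simp: R_def)
qed

end

end

section \<open>Input and output\<close>

definition color_rank :: "(nat \<Rightarrow> nat) \<Rightarrow> nat \<Rightarrow> nat" where
  "color_rank c x = card {y. y < x \<and> c y = c x}"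

text \<open>The target address of a stable counting sort by color.\<close>

definition position :: "nat \<Rightarrow> (nat \<Rightarrow> nat) \<Rightarrow> nat \<Rightarrow> nat" where
  "position n c x = c x * n + color_rank c x"

lemma color_rank_less:
  assumes "x < y" "c x = c y"
  shows "color_rank c x < color_rank c y"
  unfolding color_rank_def by (rule psubset_card_mono) (use assms in auto)

lemma bij_betw_color_rank:
  assumes bal: "balanced l n c" and i: "i < l"
  shows "bij_betw (color_rank c) (color_class l n c i) {..<n}"
proof -
  let ?C = "color_class l n c i"
  have C: "finite ?C" "card ?C = n" using bal i by (auto simp: balanced_def color_class_def)
  have inj: "inj_on (color_rank c) ?C"
  proof (rule inj_onI)
    fix x y assume "x \<in> ?C" "y \<in> ?C" and eq: "color_rank c x = color_rank c y"
    then have "c x = c y" by (simp add: color_class_def)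
    then show "x = y" using eq color_rank_less[of x y c] color_rank_less[of y x c]
      by (metis less_irrefl nat_neq_iff)
  qed
  have "color_rank c ` ?C \<subseteq> {..<n}"
  proof
    fix r assume "r \<in> color_rank c ` ?C"
    then obtain x where x: "x \<in> ?C" "r = color_rank c x" by auto
    have "{y. y < x \<and> c y = c x} \<subset> ?C" using x by (auto simp: color_class_def)
    from psubset_card_mono[OF C(1) this] show "r \<in> {..<n}" using x C by (simp add: color_rank_def)
  qed
  then have "color_rank c ` ?C = {..<n}"
    by (intro card_subset_eq) (simp_all add: card_image[OF inj] C)
  then show ?thesis using inj by (simp add: bij_betw_def)
qed

text \<open>Keeps the sorted copies of different points apart: division by \<open>n\<close> recovers
  the color, and ranks are distinct within a color.\<close>

lemma position_eq_iff:
  assumes bal: "balanced l n c" and x: "x < l * n" and y: "y < l * n"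
  shows "position n c x = position n c y \<longleftrightarrow> x = y"
proof
  assume eq: "position n c x = position n c y"
  have cl: "c z < l" if "z < l * n" for z using bal that by (auto simp: balanced_def)
  have r: "color_rank c z < n" if "z < l * n" for z
    using bij_betwE[OF bij_betw_color_rank[OF bal cl[OF that]]] that by (auto simp: color_class_def)
  have "c x = position n c x div n" "c y = position n c y div n"
    using r[OF x] r[OF y] by (simp_all add: position_def)
  then have cxy: "c x = c y" using eq by simp
  then have "color_rank c x = color_rank c y" using eq by (simp add: position_def)
  then show "x = y"
    by (rule inj_onD[OF bij_betw_imp_inj_on[OF bij_betw_color_rank[OF bal cl[OF x]]]])
      (use cxy x y in \<open>simp_all add: color_class_def\<close>)
qed simp

context fresh_names
begin

definition prepare :: com where
  "prepare =
     Seq (NAsg (v 0) (NConst 0) (scalar ''l''))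
    (Seq (NAsg (v 1) (NConst 0) (scalar ''n''))
    (Seq (NAsg (v 2) (NConst 0) (scalar ''d''))
    (Seq (for_loop (v 7) (scalar (v 0)) (NAsg (v 4) (scalar (v 7)) (NConst 0)))
         (for_loop (v 7) (NTimes (scalar (v 0)) (scalar (v 1)))
            (Seq (NAsg (v 3) (scalar (v 7)) (NPlus (NTimes (NArr ''c'' (scalar (v 7))) (scalar (v 1)))
                    (NArr (v 4) (NArr ''c'' (scalar (v 7))))))
            (Seq (NAsg (v 4) (NArr ''c'' (scalar (v 7)))
                    (NPlus (NArr (v 4) (NArr ''c'' (scalar (v 7)))) (NConst 1)))
                 (for_loop (v 8) (scalar (v 2))
                    (RAsg (v 0) (NPlus (NTimes (NArr (v 3) (scalar (v 7))) (scalar (v 2))) (scalar (v 8)))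
                       (RArr ''A'' (NPlus (NTimes (scalar (v 7)) (scalar (v 2))) (scalar (v 8))))))))))))"

definition finish :: com where
  "finish =
     Seq (for_loop (v 7) (NTimes (scalar (v 1)) (scalar (v 2)))
            (RAsg ''B'' (scalar (v 7))
               (RArr (v 0) (NPlus (NTimes (scalar (v 12)) (NTimes (scalar (v 1)) (scalar (v 2)))) (scalar (v 7))))))
         (for_loop (v 7) (NTimes (scalar (v 0)) (scalar (v 1)))
            (NAsg ''q'' (scalar (v 7)) (NArr (v 6) (NArr (v 3) (scalar (v 7))))))"

lemma wp_prepare:
  assumes inp: "holds_input s l n d A c" and bal: "balanced l n c"
  shows "wp dst prepare (7 + 3 * l + l * n * (6 + 3 * d)) (\<lambda>s'.
    nats s' (v 0) 0 = l \<and> nats s' (v 1) 0 = n \<and> nats s' (v 2) 0 = d \<and>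
    (\<forall>x<l * n. nats s' (v 3) x = position n c x) \<and>
    (\<forall>x<l * n. \<forall>k<d. reals s' (v 0) (position n c x * d + k) = A $$ (x, k))) s"
proof -
  define a where "a = reals s ''A''"
  define c' where "c' = nats s ''c''"
  have c': "c' x = c x" if "x < l * n" for x using inp that by (simp add: holds_input_def c'_def)
  have a: "a (x * d + k) = A $$ (x, k)" if "x < l * n" "k < d" for x k
    using inp that by (simp add: holds_input_def a_def)
  have cl: "c x < l" if "x < l * n" for x using bal that by (auto simp: balanced_def)
  define I where "I = (\<lambda>s' :: state. nats s' (v 0) 0 = l \<and> nats s' (v 1) 0 = n \<and> nats s' (v 2) 0 = d \<and>
    reals s' ''A'' = a \<and> nats s' ''c'' = c')"
  have I_set [simp]: "I s' \<Longrightarrow> I (set_nat (v 3) k x s')" "I s' \<Longrightarrow> I (set_nat (v 4) k x s')"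
    "I s' \<Longrightarrow> I (set_nat (v 7) k x s')" "I s' \<Longrightarrow> I (set_nat (v 8) k x s')"
    "I s' \<Longrightarrow> I (set_real (v 0) k y s')" for s' k x y
    by (simp_all add: I_def)
  have I [simp]: "nats s' (v 0) 0 = l" "nats s' (v (Suc 0)) 0 = n" "nats s' (v 2) 0 = d"
    "reals s' ''A'' = a" "nats s' ''c'' = c'" if "I s'" for s'
    using that by (simp_all add: I_def)
  define Z where "Z = (\<lambda>m (s' :: state). \<forall>i<m. nats s' (v 4) i = 0)"
  define J where "J = (\<lambda>m (s' :: state). I s' \<and> (\<forall>i<l. nats s' (v 4) i = card {y. y < m \<and> c y = i}) \<and>
    (\<forall>x<m. nats s' (v 3) x = position n c x) \<and>
    (\<forall>x<m. \<forall>k<d. reals s' (v 0) (position n c x * d + k) = a (x * d + k)))"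
  \<comment> \<open>Invariant of the inner loop: point \<open>m\<close> has its address and is
    counted, but only its first \<open>u\<close> coordinates are copied.\<close>
  define K where "K = (\<lambda>m u (s' :: state). I s' \<and> nats s' (v 7) 0 = m \<and>
    (\<forall>i<l. nats s' (v 4) i = card {y. y < Suc m \<and> c y = i}) \<and>
    (\<forall>x<Suc m. nats s' (v 3) x = position n c x) \<and>
    (\<forall>x<m. \<forall>k<d. reals s' (v 0) (position n c x * d + k) = a (x * d + k)) \<and>
    (\<forall>k<u. reals s' (v 0) (position n c m * d + k) = a (m * d + k)))"
  have loop1: "wp dst (for_loop (v 7) (scalar (v 0)) (NAsg (v 4) (scalar (v 7)) (NConst 0)))
      (2 + 3 * l) (J 0) s'" if "I s'" for s'
    by (rule wp_for_loop[where I = "\<lambda>m s'. I s' \<and> Z m s'" and b = l and \<tau> = 1])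
      (use that in \<open>auto simp: Z_def J_def less_Suc_eq intro!: wp_straight\<close>)
  have loop2: "wp dst (for_loop (v 8) (scalar (v 2))
                    (RAsg (v 0) (NPlus (NTimes (NArr (v 3) (scalar (v 7))) (scalar (v 2))) (scalar (v 8)))
                       (RArr ''A'' (NPlus (NTimes (scalar (v 7)) (scalar (v 2))) (scalar (v 8))))))
      (2 + d * 3) (\<lambda>s'. J (Suc m) (set_nat (v 7) 0 (Suc m) s')) s'"
    if K: "K m 0 s'" and m: "m < l * n" for m s'
  proof (rule wp_for_loop[where I = "K m" and b = d and \<tau> = 1], goal_cases)
    case (3 u s')
    \<comment> \<open>Division by \<open>d\<close> recovers the position, so coordinate blocks of
      different points are disjoint.\<close>
    have neq: "position n c m * d + u \<noteq> position n c x * d + k" if "x < m" "k < d" for x k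
    proof
      assume "position n c m * d + u = position n c x * d + k"
      then have "(position n c m * d + u) div d = (position n c x * d + k) div d" by simp
      then have "position n c m = position n c x" using that 3(2) by simp
      then show False using position_eq_iff[OF bal m, of x] that m by simp
    qed
    have "nats s' (v 3) m = position n c m" using 3(1) by (simp add: K_def)
    then show ?case
      using 3 by (intro wp_straight) (simp_all add: K_def All_less_Suc, use neq in metis)
  qed (use K in \<open>auto simp: K_def J_def less_Suc_eq\<close>)
  have loop3: "wp dst (for_loop (v 7) (NTimes (scalar (v 0)) (scalar (v 1)))
            (Seq (NAsg (v 3) (scalar (v 7)) (NPlus (NTimes (NArr ''c'' (scalar (v 7))) (scalar (v 1)))
                    (NArr (v 4) (NArr ''c'' (scalar (v 7))))))
            (Seq (NAsg (v 4) (NArr ''c'' (scalar (v 7)))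
                    (NPlus (NArr (v 4) (NArr ''c'' (scalar (v 7)))) (NConst 1)))
                 (for_loop (v 8) (scalar (v 2))
                    (RAsg (v 0) (NPlus (NTimes (NArr (v 3) (scalar (v 7))) (scalar (v 2))) (scalar (v 8)))
                       (RArr ''A'' (NPlus (NTimes (scalar (v 7)) (scalar (v 2))) (scalar (v 8)))))))))
      (2 + l * n * (6 + 3 * d)) (J (l * n)) s'" if "J 0 s'" for s'
  proof (rule wp_for_loop[where I = J and b = "l * n" and \<tau> = "4 + 3 * d"], goal_cases)
    case (3 m s')
    then have Is: "I s'" and cnt: "\<forall>i<l. nats s' (v 4) i = card {y. y < m \<and> c y = i}"
      and pos: "\<forall>x<m. nats s' (v 3) x = position n c x"
      and pts: "\<forall>x<m. \<forall>k<d. reals s' (v 0) (position n c x * d + k) = a (x * d + k)"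
      by (simp_all add: J_def)
    have cm: "c' m = c m" "c m < l" using c' cl 3(2) by auto
    have p: "c m * n + nats s' (v 4) (c m) = position n c m"
      using cnt cm by (simp add: position_def color_rank_def)
    have cards: "card {y. y < Suc m \<and> c y = i} = card {y. y < m \<and> c y = i} + (if i = c m then 1 else 0)" for i
    proof (cases "i = c m")
      case True
      then have "{y. y < Suc m \<and> c y = i} = insert m {y. y < m \<and> c y = i}" by (auto simp: less_Suc_eq)
      then show ?thesis using True by simp
    next
      case False
      then have "{y. y < Suc m \<and> c y = i} = {y. y < m \<and> c y = i}" by (auto simp: less_Suc_eq)
      then show ?thesis using False by simp
    qed
    define s1 where "s1 = set_nat (v 4) (c m) (Suc (nats s' (v 4) (c m))) (set_nat (v 3) m (position n c m) s')"
    have "K m 0 s1"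
      unfolding K_def
    proof (intro conjI)
      show "I s1" using Is by (simp add: s1_def)
      show "\<forall>i<l. nats s1 (v 4) i = card {y. y < Suc m \<and> c y = i}"
        using cnt cards by (simp add: s1_def)
      show "\<forall>x<Suc m. nats s1 (v 3) x = position n c x"
        using pos by (simp add: s1_def All_less_Suc)
      show "\<forall>x<m. \<forall>k<d. reals s1 (v 0) (position n c x * d + k) = a (x * d + k)"
        using pts by (simp add: s1_def)
    qed (use 3(3) in \<open>simp_all add: s1_def\<close>)
    from loop2[OF this 3(2)] show ?case
      by (intro wp_straight_Seq[where u = "3 + 3 * d"] wp_straight_Seq[where u = "2 + d * 3"])
        (use Is cm p 3(3) in \<open>simp_all add: s1_def\<close>)
  qed (use that in \<open>auto simp: J_def\<close>)
  have "wp dst prepare (7 + 3 * l + l * n * (6 + 3 * d)) (J (l * n)) s"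
    unfolding prepare_def
    by (rule wp_straight_Seq[where u = "6 + 3 * l + l * n * (6 + 3 * d)"], simp,
        rule wp_straight_Seq[where u = "5 + 3 * l + l * n * (6 + 3 * d)"], simp,
        rule wp_straight_Seq[where u = "4 + 3 * l + l * n * (6 + 3 * d)"], simp,
        rule wp_SeqI[OF loop1 loop3])
      (use inp in \<open>simp_all add: I_def holds_input_def a_def c'_def del: I I_set\<close>)
  then show ?thesis
    by (rule wp_mono) (simp_all add: J_def a)
qed

end

lemma (in sorted_instance) wp_finish:
  assumes s: "ctx s"
  shows "wp dst finish (4 + 3 * (n * d) + 3 * (l * n)) (\<lambda>s'.
    (\<forall>t<n * d. reals s' ''B'' t = a (nats s (v 12) 0 * (n * d) + t)) \<and>
    (\<forall>x<l * n. nats s' ''q'' x = nats s (v 6) (pos x))) s"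
proof -
  define i where "i = nats s (v 12) 0"
  define q where "q = nats s (v 6)"
  define I where "I = (\<lambda>s'. ctx s' \<and> nats s' (v 12) 0 = i \<and> nats s' (v 6) = q)"
  define J where "J = (\<lambda>m s'. I s' \<and> (\<forall>t<m. reals s' ''B'' t = a (i * (n * d) + t)))"
  define K where "K = (\<lambda>m s'. J (n * d) s' \<and> (\<forall>x<m. nats s' ''q'' x = q (pos x)))"
  have loop1: "wp dst (for_loop (v 7) (NTimes (scalar (v 1)) (scalar (v 2)))
            (RAsg ''B'' (scalar (v 7))
               (RArr (v 0) (NPlus (NTimes (scalar (v 12)) (NTimes (scalar (v 1)) (scalar (v 2)))) (scalar (v 7))))))
      (2 + 3 * (n * d)) (J (n * d)) s'" if "I s'" for s'
  proof (rule wp_for_loop[where I = J and b = "n * d" and \<tau> = 1], goal_cases)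
    case (3 m s')
    then show ?case by (intro wp_straight) (simp_all add: J_def I_def All_less_Suc)
  qed (use that in \<open>simp_all add: J_def I_def\<close>)
  have loop2: "wp dst (for_loop (v 7) (NTimes (scalar (v 0)) (scalar (v 1)))
            (NAsg ''q'' (scalar (v 7)) (NArr (v 6) (NArr (v 3) (scalar (v 7))))))
      (2 + 3 * (l * n)) (K (l * n)) s'" if "J (n * d) s'" for s'
  proof (rule wp_for_loop[where I = K and b = "l * n" and \<tau> = 1], goal_cases)
    case (3 m s')
    then show ?case by (intro wp_straight) (simp_all add: K_def J_def I_def All_less_Suc)
  qed (use that in \<open>simp_all add: K_def J_def I_def\<close>)
  have "wp dst finish (4 + 3 * (n * d) + 3 * (l * n)) (K (l * n)) s"
    unfolding finish_def
    by (rule wp_SeqI[OF loop1 loop2]) (use s in \<open>simp_all add: I_def i_def q_def\<close>)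
  then show ?thesis by (rule wp_mono) (simp_all add: K_def J_def i_def q_def)
qed

context sorted_instance
begin

lemma row_output_centers:
  assumes "\<forall>t<n * d. reals s' ''B'' t = a (i * (n * d) + t)" "r < n"
  shows "row (output_centers s' n d) r = pt (i * n + r)"
proof (rule eq_vecI)
  fix k assume "k < dim_vec (pt (i * n + r))"
  then have k: "k < d" by (simp add: pt_def)
  have "reals s' ''B'' (r * d + k) = a (i * (n * d) + (r * d + k))"
    using assms(1) index_less[OF assms(2) k] by blast
  then show "row (output_centers s' n d) r $ k = pt (i * n + r) $ k"
    using k assms(2) by (simp add: output_centers_def pt_def algebra_simps)
qed (simp add: output_centers_def pt_def)

context
  fixes A :: "real mat" and c :: "nat \<Rightarrow> nat"
  assumes A: "A \<in> carrier_mat (l * n) d" and bal: "balanced l n c"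
    and pos: "\<And>x. x < l * n \<Longrightarrow> pos x = position n c x"
    and pts: "\<And>x k. x < l * n \<Longrightarrow> k < d \<Longrightarrow> a (position n c x * d + k) = A $$ (x, k)"
begin

lemma row_input: "x < l * n \<Longrightarrow> row A x = pt (position n c x)"
  using A pts by (intro eq_vecI) (auto simp: pt_def)

text \<open>Rank is a bijection from each color class onto \<open>{..<n}\<close>, so both sides
  transport the same points.\<close>

lemma sum_color_EMD_le: "(\<Sum>i<l. color_EMD i B) \<le> fair_median_cost dst l n A c B"
  unfolding fair_median_cost_def
proof (rule sum_mono)
  fix i assume "i \<in> {..<l}"
  then have bij: "bij_betw (color_rank c) (color_class l n c i) {..<n}"
    using bij_betw_color_rank[OF bal] by simp
  define f where "f = inv_into (color_class l n c i) (color_rank c)"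
  have f: "bij_betw f {..<n} (color_class l n c i)"
    unfolding f_def by (rule bij_betw_inv_into[OF bij])
  have "pt (i * n + t) = row A (f t)" if "t \<in> {..<n}" for t
  proof -
    have "f t \<in> color_class l n c i" using bij_betwE[OF f] that by blast
    moreover have "color_rank c (f t) = t"
      unfolding f_def by (rule bij_betw_inv_into_right[OF bij that])
    ultimately show ?thesis by (simp add: row_input color_class_def position_def)
  qed
  then show "color_EMD i B \<le> EMD dst (color_class l n c i) (row A) {..<n} (row B)"
    unfolding color_EMD_def
    by (intro EMD_reindex_le[OF _ _ _ f]) (use bij_betw_same_card[OF f] in \<open>simp_all add: color_class_def\<close>)
qed

lemma output_correct:
  assumes best: "best s"
    and B: "\<forall>t<n * d. reals s' ''B'' t = a (nats s (v 12) 0 * (n * d) + t)"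
    and q: "\<forall>x<l * n. nats s' ''q'' x = nats s (v 6) (pos x)"
  shows "fair_clustering l n c (output_clusters s')"
    and "clustering_cost dst l n A (output_clusters s') (output_centers s' n d) = reals s (v 3) 0"
proof -
  define m where "m = (\<lambda>i t. nats s (v 6) (i * n + t))"
  define b where "b = nats s (v 12) 0"
  have m: "bij_betw (m i) {..<n} {..<n}" if "i < l" for i
    using best that by (simp add: best_def m_def)
  have q_eq: "output_clusters s' x = m i (color_rank c x)" if "x \<in> color_class l n c i" for x i
    using q that by (simp add: output_clusters_def pos position_def color_class_def m_def)
  have bij: "bij_betw (output_clusters s') (color_class l n c i) {..<n}" if "i < l" for i
  proof (rule iffD1[OF bij_betw_cong])
    show "bij_betw (m i \<circ> color_rank c) (color_class l n c i) {..<n}"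
      by (rule bij_betw_trans[OF bij_betw_color_rank[OF bal that] m[OF that]])
  qed (simp add: q_eq)
  have cl: "c x < l" if "x < l * n" for x using bal that by (auto simp: balanced_def)
  show "fair_clustering l n c (output_clusters s')"
    unfolding fair_clustering_def
  proof (intro conjI allI impI)
    show "output_clusters s' \<in> {..<l * n} \<rightarrow> {..<n}"
    proof
      fix x assume x: "x \<in> {..<l * n}"
      then have "x \<in> color_class l n c (c x)" by (simp add: color_class_def)
      then show "output_clusters s' x \<in> {..<n}" using bij_betwE[OF bij[OF cl]] x by blast
    qed
    fix i j assume i: "i < l" and j: "j < n"
    have "j \<in> output_clusters s' ` color_class l n c i"
      using bij_betw_imp_surj_on[OF bij[OF i]] j by simp
    then show "\<exists>!x. x \<in> color_class l n c i \<and> output_clusters s' x = j"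
      using inj_onD[OF bij_betw_imp_inj_on[OF bij[OF i]]] by blast
  qed
  have "clustering_cost dst l n A (output_clusters s') (output_centers s' n d)
      = (\<Sum>i<l. \<Sum>x\<in>color_class l n c i. dst (row A x) (row (output_centers s' n d) (output_clusters s' x)))"
    unfolding clustering_cost_def
    by (subst sum.group[of "{..<l * n}" "{..<l}" c, symmetric])
      (use cl in \<open>auto simp: color_class_def intro!: sum.cong\<close>)
  also have "\<dots> = (\<Sum>i<l. \<Sum>t<n. dst (pt (i * n + t)) (pt (b * n + m i t)))"
  proof (rule sum.cong[OF refl])
    fix i assume "i \<in> {..<l}"
    then have i: "i < l" by simp
    have "dst (row A x) (row (output_centers s' n d) (output_clusters s' x))
        = dst (pt (i * n + color_rank c x)) (pt (b * n + m i (color_rank c x)))"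
      if "x \<in> color_class l n c i" for x
    proof -
      have "output_clusters s' x < n" using bij_betwE[OF bij[OF i]] that by blast
      from row_output_centers[OF B this] have
        "row (output_centers s' n d) (output_clusters s' x) = pt (b * n + m i (color_rank c x))"
        unfolding q_eq[OF that] b_def .
      moreover have "row A x = pt (i * n + color_rank c x)"
        using that by (simp add: row_input color_class_def position_def)
      ultimately show ?thesis by simp
    qed
    then have "(\<Sum>x\<in>color_class l n c i. dst (row A x) (row (output_centers s' n d) (output_clusters s' x)))
        = (\<Sum>x\<in>color_class l n c i. dst (pt (i * n + color_rank c x)) (pt (b * n + m i (color_rank c x))))"
      by (rule sum.cong[OF refl])
    also have "\<dots> = (\<Sum>t<n. dst (pt (i * n + t)) (pt (b * n + m i t)))"
      by (rule sum.reindex_bij_betw[OF bij_betw_color_rank[OF bal i]])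
    finally show "(\<Sum>x\<in>color_class l n c i. dst (row A x) (row (output_centers s' n d) (output_clusters s' x)))
        = (\<Sum>t<n. dst (pt (i * n + t)) (pt (b * n + m i t)))" .
  qed
  also have "\<dots> = reals s (v 3) 0" using best by (simp add: best_def m_def b_def)
  finally show "clustering_cost dst l n A (output_clusters s') (output_centers s' n d) = reals s (v 3) 0" .
qed

lemma wp_finish_correct:
  assumes "ctx s" "best s"
  shows "wp dst finish (10 * (l * \<tau>)) (\<lambda>s'. fair_clustering l n c (output_clusters s') \<and>
    clustering_cost dst l n A (output_clusters s') (output_centers s' n d) = reals s (v 3) 0) s"
proof (rule wp_mono[OF wp_finish[OF assms(1)]])
  have "1 * (n * d) \<le> l * \<tau>" by (rule mult_le_mono[OF l nd_le])
  moreover have "l * n \<le> l * \<tau>" by (rule mult_le_mono2[OF n_le])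
  ultimately show "4 + 3 * (n * d) + 3 * (l * n) \<le> 10 * (l * \<tau>)" using l_le l by linarith
qed (use output_correct[OF assms(2)] in blast)

text \<open>The initial clustering around color 0 may be poor. It establishes \<open>best\<close>,
  so that the output is a fair clustering in every run and the rounds can only improve it.\<close>

lemma reach_solve:
  assumes s: "ctx s" and B: "B \<in> carrier_mat n d"
  shows "reach dst (Seq (NAsg (v 10) (NConst 0) (NConst 0))
      (Seq star (Seq save (Seq (repeated K sampling_round) finish))))
    ((130 * K + 60) * (l * \<tau>)) (\<lambda>s'. fair_clustering l n c (output_clusters s')) (1 - (15 / 16) ^ K)
    (\<lambda>s'. clustering_cost dst l n A (output_clusters s') (output_centers s' n d)
       \<le> 2 * \<beta> * fair_median_cost dst l n A c B) s"
proof -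
  define G where "G = (\<lambda>s' :: state. reals s' (v 3) 0 \<le> 2 * \<beta> * (\<Sum>j<l. color_EMD j B))"
  define R where "R = (\<lambda>s'. fair_clustering l n c (output_clusters s'))"
  define H where "H = (\<lambda>s'. clustering_cost dst l n A (output_clusters s') (output_centers s' n d)
       \<le> 2 * \<beta> * fair_median_cost dst l n A c B)"
  have GH: "2 * \<beta> * (\<Sum>j<l. color_EMD j B) \<le> 2 * \<beta> * fair_median_cost dst l n A c B"
    using sum_color_EMD_le \<beta>_pos by (intro mult_left_mono) auto
  have finish: "wp dst finish (10 * (l * \<tau>)) (\<lambda>s''. R s'' \<and> (G s' \<longrightarrow> H s'')) s'" if "ctx s' \<and> best s'" for s'
    by (rule wp_mono[OF wp_finish_correct]) (use that GH in \<open>auto simp: R_def G_def H_def\<close>)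
  have rounds: "reach dst (Seq (repeated K sampling_round) finish)
      ((K * (130 * (l * \<tau>)) + 1) + 10 * (l * \<tau>)) R (1 - (15 / 16) ^ K) H s'" if s': "ctx s'" "best s'" for s'
  proof -
    have "reach dst (repeated K sampling_round) (K * (130 * (l * \<tau>)) + 1) (\<lambda>s'. ctx s' \<and> best s')
        (1 - (1 - 1 / 16) ^ K) G s'"
      by (rule reach_repeated) (use reach_sampling_round[OF B] s' in \<open>simp_all add: G_def\<close>)
    then have "reach dst (Seq (repeated K sampling_round) finish)
      ((K * (130 * (l * \<tau>)) + 1) + 10 * (l * \<tau>)) R
      ((1 - (1 - 1 / 16) ^ K) * 1 + (1 - (1 - (1 - 1 / 16) ^ K)) * 0) H s'"
    proof (rule reach_Seq)
      fix s1 assume s1: "ctx s1 \<and> best s1"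
      from wp_imp_reach[OF finish[OF this]] show "reach dst finish (10 * (l * \<tau>)) R 0 H s1"
        by (rule reach_mono) auto
      assume "G s1"
      with s1 show "reach dst finish (10 * (l * \<tau>)) R 1 H s1"
        by (intro reach_mono[OF reach_sure[OF wp_imp_reach[OF finish[OF s1]], of H]]) auto
    qed simp_all
    then show ?thesis by simp
  qed
  define s0 where "s0 = set_nat (v 10) 0 0 s"
  have s0: "ctx s0" "nats s0 (v 10) 0 = 0" using s by (simp_all add: s0_def)
  have solve: "reach dst (Seq star (Seq save (Seq (repeated K sampling_round) finish)))
      (40 * (l * \<tau>) + (4 + 3 * (l * n) + ((K * (130 * (l * \<tau>)) + 1) + 10 * (l * \<tau>))))
      R (1 - (15 / 16) ^ K) H s0"
  proof (rule wp_reach_Seq, rule wp_mono[OF wp_star[OF s0]])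
    fix s1 assume s1: "(\<forall>j<l. block 0 j s1) \<and> reals s1 (v 2) 0 = (\<Sum>j<l. reals s1 (v 1) j)"
      and fr: "frame star s0 s1"
    have ctx1: "ctx s1" by (rule ctx_frame[OF s0(1) fr]) (auto simp: nwrites_star rwrites_star)
    have cur1: "current 0 s1"
      using s1 fr s0 l by (simp add: current_def frame_def nwrites_star)
    show "reach dst (Seq save (Seq (repeated K sampling_round) finish))
       (4 + 3 * (l * n) + ((K * (130 * (l * \<tau>)) + 1) + 10 * (l * \<tau>))) R (1 - (15 / 16) ^ K) H s1"
    proof (rule wp_reach_Seq, rule wp_mono[OF wp_save[OF ctx1 cur1]])
      fix s2 assume "best s2 \<and> reals s2 (v 3) 0 = reals s1 (v 2) 0" and fr2: "frame save s1 s2"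
      moreover have "ctx s2" by (rule ctx_frame[OF ctx1 fr2]) (simp_all add: nwrites_save rwrites_save)
      ultimately show "reach dst (Seq (repeated K sampling_round) finish)
          ((K * (130 * (l * \<tau>)) + 1) + 10 * (l * \<tau>)) R (1 - (15 / 16) ^ K) H s2"
        using rounds by blast
    qed simp
  qed simp
  have "wp dst (NAsg (v 10) (NConst 0) (NConst 0)) 1 (\<lambda>s'. s' = s0) s"
    by (rule wp_straight) (simp_all add: s0_def)
  then have "reach dst (Seq (NAsg (v 10) (NConst 0) (NConst 0))
      (Seq star (Seq save (Seq (repeated K sampling_round) finish))))
      (1 + (40 * (l * \<tau>) + (4 + 3 * (l * n) + ((K * (130 * (l * \<tau>)) + 1) + 10 * (l * \<tau>)))))
      R (1 - (15 / 16) ^ K) H s"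
    by (intro wp_reach_Seq) (erule wp_mono, simp, use solve in simp)
  moreover have "1 + (40 * (l * \<tau>) + (4 + 3 * (l * n) + ((K * (130 * (l * \<tau>)) + 1) + 10 * (l * \<tau>))))
      \<le> (130 * K + 60) * (l * \<tau>)"
  proof -
    have "l * n \<le> l * \<tau>" by (rule mult_le_mono2[OF n_le])
    moreover have "(130 * K + 60) * (l * \<tau>) = K * (130 * (l * \<tau>)) + 60 * (l * \<tau>)"
      by (simp add: algebra_simps)
    ultimately show ?thesis using l_le l by linarith
  qed
  ultimately show ?thesis unfolding R_def H_def by - (erule reach_mono, simp_all)
qed

end

end

context fresh_names
begin

definition solver :: "nat \<Rightarrow> com" where
  "solver K = Seq prepare (Seq (NAsg (v 10) (NConst 0) (NConst 0))
     (Seq star (Seq save (Seq (repeated K sampling_round) finish))))"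

lemma reach_solver:
  assumes l: "1 \<le> l" and n: "1 \<le> n" and d: "1 \<le> d"
    and A: "A \<in> carrier_mat (l * n) d" and bal: "balanced l n c" and inp: "holds_input s l n d A c"
    and B: "B \<in> carrier_mat n d"
  shows "reach dst (solver K) ((130 * K + 80) * (l * runtime n d))
    (\<lambda>s'. fair_clustering l n c (output_clusters s')) (1 - (15 / 16) ^ K)
    (\<lambda>s'. clustering_cost dst l n A (output_clusters s') (output_centers s' n d)
       \<le> 2 * \<beta> * fair_median_cost dst l n A c B) s"
proof -
  have "reach dst (solver K) ((7 + 3 * l + l * n * (6 + 3 * d)) + (130 * K + 60) * (l * runtime n d))
    (\<lambda>s'. fair_clustering l n c (output_clusters s')) (1 - (15 / 16) ^ K)
    (\<lambda>s'. clustering_cost dst l n A (output_clusters s') (output_centers s' n d)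
       \<le> 2 * \<beta> * fair_median_cost dst l n A c B) s"
    unfolding solver_def
  proof (rule wp_reach_Seq, rule wp_mono[OF wp_prepare[OF inp bal]])
    fix s1 :: state assume s1: "nats s1 (v 0) 0 = l \<and> nats s1 (v 1) 0 = n \<and> nats s1 (v 2) 0 = d \<and>
      (\<forall>x<l * n. nats s1 (v 3) x = position n c x) \<and>
      (\<forall>x<l * n. \<forall>k<d. reals s1 (v 0) (position n c x * d + k) = A $$ (x, k))"
    \<comment> \<open>The memory contents left by the sorting phase become locale parameters; the
      program text does not depend on them.\<close>
    interpret sorted_instance dst \<beta> T P v l n d "nats s1 (v 3)" "reals s1 (v 0)"
      by standard (fact l n d)+
    show "reach dst (Seq (NAsg (v 10) (NConst 0) (NConst 0))
      (Seq star (Seq save (Seq (repeated K sampling_round) finish)))) ((130 * K + 60) * (l * runtime n d))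
    (\<lambda>s'. fair_clustering l n c (output_clusters s')) (1 - (15 / 16) ^ K)
    (\<lambda>s'. clustering_cost dst l n A (output_clusters s') (output_centers s' n d)
       \<le> 2 * \<beta> * fair_median_cost dst l n A c B) s1"
    proof (rule reach_solve[OF A bal _ _ _ B])
      show "ctx s1" unfolding ctx_def using s1 by blast
    qed (use s1 in blast)+
  qed simp
  moreover have "(7 + 3 * l + l * n * (6 + 3 * d)) + (130 * K + 60) * (l * runtime n d)
      \<le> (130 * K + 80) * (l * runtime n d)"
  proof -
    have nd: "n * d \<le> runtime n d" by (rule runtime_ge[OF n d])
    moreover have "n \<le> n * d" using d by simp
    ultimately have "n \<le> runtime n d" by linarith
    then have "l * n \<le> l * runtime n d" "l * (n * d) \<le> l * runtime n d" "l * 1 \<le> l * runtime n d"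
      using nd n by (intro mult_le_mono2; linarith)+
    moreover have "l * n * (6 + 3 * d) = 6 * (l * n) + 3 * (l * (n * d))"
      "(130 * K + 80) * (l * runtime n d) = (130 * K + 60) * (l * runtime n d) + 20 * (l * runtime n d)"
      by (simp_all add: algebra_simps)
    ultimately show ?thesis using l by linarith
  qed
  ultimately show ?thesis by - (erule reach_mono, simp_all)
qed

text \<open>
  No optimal \<open>B\<close> need exist, but the events \<open>cost \<le> 2 * \<beta> * (opt + 1 / m)\<close> all have
  probability at least \<open>1 - (15 / 16) ^ K\<close>, and they decrease to the required event.
\<close>

lemma solver_approximates:
  assumes l: "1 \<le> l" and n: "1 \<le> n" and d: "1 \<le> d"
    and A: "A \<in> carrier_mat (l * n) d" and bal: "balanced l n c" and inp: "holds_input s l n d A c"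
  shows "\<exists>p. big_step dst (solver K) s p \<and>
    (\<forall>s' t. (s', t) \<in> set_pmf p \<longrightarrow> t \<le> (130 * K + 80) * (l * runtime n d)) \<and>
    1 - (15 / 16) ^ K \<le> measure_pmf.prob p {(s', t). approx_fair_median dst (2 * \<beta>) l n A c
      (output_clusters s') (output_centers s' n d)}"
proof -
  define cost where "cost = (\<lambda>s'. clustering_cost dst l n A (output_clusters s') (output_centers s' n d))"
  define opt where "opt = fair_median_opt dst l n A c"
  define a :: real where "a = 1 - (15 / 16) ^ K"
  have reach: "reach dst (solver K) ((130 * K + 80) * (l * runtime n d))
    (\<lambda>s'. fair_clustering l n c (output_clusters s')) a
    (\<lambda>s'. cost s' \<le> 2 * \<beta> * fair_median_cost dst l n A c B) s" if "B \<in> carrier_mat n d" for B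
    unfolding cost_def a_def by (rule reach_solver[OF l n d A bal inp that])
  obtain p where p: "big_step dst (solver K) s p"
    and supp: "\<And>s' t. (s', t) \<in> set_pmf p \<Longrightarrow>
      t \<le> (130 * K + 80) * (l * runtime n d) \<and> fair_clustering l n c (output_clusters s')"
    using reach[OF zero_carrier_mat] unfolding reach_def by blast
  define E where "E = (\<lambda>m :: nat. {(s' :: state, t :: nat). cost s' \<le> 2 * \<beta> * (opt + inverse (Suc m))})"
  have E: "a \<le> measure_pmf.prob p (E m)" for m
  proof -
    have "(INF B \<in> carrier_mat n d. fair_median_cost dst l n A c B) < opt + inverse (Suc m)"
      using A unfolding opt_def fair_median_opt_def by simp
    then obtain B where B: "B \<in> carrier_mat n d" "fair_median_cost dst l n A c B < opt + inverse (Suc m)"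
      using cInf_lessD[of "fair_median_cost dst l n A c ` carrier_mat n d"] zero_carrier_mat by blast
    obtain p' where p': "big_step dst (solver K) s p'"
      "a \<le> measure_pmf.prob p' {(s', t). cost s' \<le> 2 * \<beta> * fair_median_cost dst l n A c B}"
      using reach[OF B(1)] unfolding reach_def by blast
    have "2 * \<beta> * fair_median_cost dst l n A c B \<le> 2 * \<beta> * (opt + inverse (Suc m))"
      using B(2) \<beta>_pos by (intro mult_left_mono) auto
    then have "{(s' :: state, t :: nat). cost s' \<le> 2 * \<beta> * fair_median_cost dst l n A c B} \<subseteq> E m"
      by (auto simp: E_def)
    then have "measure_pmf.prob p' {(s', t). cost s' \<le> 2 * \<beta> * fair_median_cost dst l n A c B}
        \<le> measure_pmf.prob p' (E m)"
      by (rule measure_pmf.finite_measure_mono) simp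
    \<comment> \<open>Each \<open>B\<close> brings its own existentially given distribution;
      uniqueness of the semantics identifies it with the fixed \<open>p\<close>.\<close>
    then show ?thesis using p'(2) big_step_unique[OF p p'(1)] by simp
  qed
  have "decseq E"
    unfolding decseq_Suc_iff E_def using \<beta>_pos
    by (auto intro: order_trans mult_left_mono add_left_mono le_imp_inverse_le)
  then have "(\<lambda>m. measure_pmf.prob p (E m)) \<longlonglongrightarrow> measure_pmf.prob p (\<Inter>m. E m)"
    by (intro measure_pmf.finite_Lim_measure_decseq) auto
  then have "a \<le> measure_pmf.prob p (\<Inter>m. E m)"
    by (rule LIMSEQ_le_const) (use E in auto)
  also have "\<dots> \<le> measure_pmf.prob p {(s', t). approx_fair_median dst (2 * \<beta>) l n A c
      (output_clusters s') (output_centers s' n d)}"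
  proof (rule measure_pmf.finite_measure_mono_AE)
    have "cost s' \<le> 2 * \<beta> * opt" if "(s', t) \<in> (\<Inter>m. E m)" for s' t
    proof (rule LIMSEQ_le_const)
      show "(\<lambda>m. 2 * \<beta> * (opt + inverse (real (Suc m)))) \<longlonglongrightarrow> 2 * \<beta> * opt"
        using tendsto_mult_left[OF tendsto_add[OF tendsto_const LIMSEQ_inverse_real_of_nat], of "2 * \<beta>" opt]
        by simp
    qed (use that in \<open>auto simp: E_def\<close>)
    then show "AE x in measure_pmf p. x \<in> (\<Inter>m. E m) \<longrightarrow> x \<in> {(s', t). approx_fair_median dst (2 * \<beta>) l n A c
      (output_clusters s') (output_centers s' n d)}"
      using supp A unfolding AE_measure_pmf_iff approx_fair_median_def cost_def opt_def
      by (auto simp: output_centers_def)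
  qed simp
  finally show ?thesis using p supp unfolding a_def by blast
qed

end

section \<open>Number of rounds, fresh names and the final constant\<close>

lemma power_le_of_ln:
  assumes "0 < \<delta>" "16 * ln (1 / \<delta>) \<le> real K"
  shows "(15 / 16) ^ K \<le> (\<delta> :: real)"
proof -
  \<comment> \<open>\<open>15 / 16 = 1 - 1 / 16\<close>, which is why 16 rounds are spent per unit
    of \<open>ln (1 / \<delta>)\<close>.\<close>
  have "(15 / 16 :: real) \<le> exp (- 1 / 16)" using exp_ge_add_one_self[of "- 1 / 16"] by simp
  then have "(15 / 16 :: real) ^ K \<le> exp (- 1 / 16) ^ K" by (rule power_mono) simp
  also have "\<dots> = exp (- (real K / 16))" by (simp flip: exp_of_nat_mult)
  also have "\<dots> \<le> exp (- ln (1 / \<delta>))" using assms(2) by simp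
  also have "\<dots> = \<delta>" using assms(1) by (simp add: ln_div)
  finally show ?thesis .
qed

lemma exists_fresh_names:
  assumes "finite (X :: string set)"
  shows "\<exists>v :: nat \<Rightarrow> string. inj v \<and> (\<forall>k. v k \<notin> X)"
proof -
  have "infinite (- X)" using assms infinite_UNIV_listI by (metis Compl_eq_Diff_UNIV Diff_infinite_finite)
  then obtain v :: "nat \<Rightarrow> string" where "inj v" "range v \<subseteq> - X"
    using infinite_countable_subset by blast
  then show ?thesis by blast
qed

theorem theorem3:
  fixes dst :: "real vec \<Rightarrow> real vec \<Rightarrow> real" and \<beta> :: real and T :: "nat \<Rightarrow> nat \<Rightarrow> real"
  assumes metric: "\<And>d. d \<ge> 1 \<Longrightarrow> Metric_space (carrier_vec d) dst"
    and two_colors: "\<exists>P. deterministic P \<and> fair_median_algorithm dst P 2 \<beta> 0 T"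
  shows "\<exists>C::real. \<forall>\<delta>::real. 0 < \<delta> \<and> \<delta> < 1 \<longrightarrow>
           (\<exists>Q. \<forall>l\<ge>1. fair_median_algorithm dst Q l (2 * \<beta>) \<delta>
                   (\<lambda>n d. C * (real l * T n d * max 1 (ln (1 / \<delta>)))))"
proof -
  obtain P where P: "deterministic P" "fair_median_algorithm dst P 2 \<beta> 0 T"
    using two_colors by blast
  have "finite (nwrites P \<union> rwrites P \<union> {''A'', ''B'', ''c'', ''d'', ''l'', ''n'', ''q''})"
    by (simp add: finite_writes)
  from exists_fresh_names[OF this] obtain v :: "nat \<Rightarrow> string" where v: "inj v \<and>
    (\<forall>k. v k \<notin> nwrites P \<union> rwrites P \<union> {''A'', ''B'', ''c'', ''d'', ''l'', ''n'', ''q''})" ..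
  interpret fresh_names dst \<beta> T P v
    by (intro fresh_names.intro two_color_algorithm.intro fresh_names_axioms.intro)
      (fact metric P v[THEN conjunct1] v[THEN conjunct2, rule_format])+
  show ?thesis
  \<comment> \<open>\<open>K \<le> 16 * ln (1 / \<delta>) + 1\<close> gives
    \<open>130 * K + 80 \<le> 2080 * ln (1 / \<delta>) + 210\<close>, and 2080 + 210 is below
    2300.\<close>
  proof (rule exI[of _ 2300], intro allI impI)
    fix \<delta> :: real assume \<delta>: "0 < \<delta> \<and> \<delta> < 1"
    define K where "K = nat \<lceil>16 * ln (1 / \<delta>)\<rceil>"
    have K: "16 * ln (1 / \<delta>) \<le> real K" unfolding K_def by linarith
    have K_le: "130 * real K + 80 \<le> 2300 * max 1 (ln (1 / \<delta>))"
    proof -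
      have "0 \<le> ln (1 / \<delta>)" using \<delta> by simp
      then have "real K \<le> 16 * ln (1 / \<delta>) + 1" unfolding K_def by linarith
      then show ?thesis by (simp add: max_def)
    qed
    have fail: "1 - \<delta> \<le> 1 - (15 / 16) ^ K" using power_le_of_ln[OF _ K] \<delta> by simp
    have "fair_median_algorithm dst (solver K) l (2 * \<beta>) \<delta>
        (\<lambda>n d. 2300 * (real l * T n d * max 1 (ln (1 / \<delta>))))" if l: "1 \<le> l" for l
      unfolding fair_median_algorithm_def
    proof (intro allI impI)
      fix n d A c s
      assume n: "1 \<le> n" and d: "1 \<le> d" and A: "A \<in> carrier_mat (l * n) d"
        and bal: "balanced l n c" and inp: "holds_input s l n d A c"
      obtain p where p: "big_step dst (solver K) s p"
        and time: "\<And>s' t. (s', t) \<in> set_pmf p \<Longrightarrow> t \<le> (130 * K + 80) * (l * runtime n d)"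
        and prob: "1 - (15 / 16) ^ K \<le> measure_pmf.prob p {(s', t). approx_fair_median dst (2 * \<beta>) l n A c
          (output_clusters s') (output_centers s' n d)}"
        using solver_approximates[OF l n d A bal inp] by blast
      have "1 \<le> n * d" using n d by simp
      then have "1 \<le> runtime n d" using runtime_ge[OF n d] by linarith
      \<comment> \<open>\<open>nat\<close> sends a negative floor to 0; that
        \<open>runtime n d\<close> is at least 1 excludes this case.\<close>
      then have run: "real (runtime n d) \<le> T n d" unfolding runtime_def by linarith
      have "real t \<le> 2300 * (real l * T n d * max 1 (ln (1 / \<delta>)))" if "(s', t) \<in> set_pmf p" for s' t
      proof -
        have "real t \<le> real ((130 * K + 80) * (l * runtime n d))" using time[OF that] by (rule of_nat_mono)
        also have "\<dots> = (130 * real K + 80) * (real l * real (runtime n d))" by simp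
        also have "\<dots> \<le> (2300 * max 1 (ln (1 / \<delta>))) * (real l * T n d)"
          by (intro mult_mono K_le run order_refl) simp_all
        finally show ?thesis by (simp add: mult_ac)
      qed
      then show "\<exists>p. big_step dst (solver K) s p \<and>
          (\<forall>s' t. (s', t) \<in> set_pmf p \<longrightarrow> real t \<le> 2300 * (real l * T n d * max 1 (ln (1 / \<delta>)))) \<and>
          measure_pmf.prob p {(s', t). approx_fair_median dst (2 * \<beta>) l n A c
            (output_clusters s') (output_centers s' n d)} \<ge> 1 - \<delta>"
        using p prob fail by (intro exI[of _ p]) auto
    qed
    then show "\<exists>Q. \<forall>l\<ge>1. fair_median_algorithm dst Q l (2 * \<beta>) \<delta>
        (\<lambda>n d. 2300 * (real l * T n d * max 1 (ln (1 / \<delta>))))"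
      by blast
  qed
qed

end
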